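(* Let $p\ge 1$ be an integer and let $\boldsymbol{\beta}=(\beta_0,\ldots,\beta_{p-1})$ be a $p$-tuple of real numbers greater than $1$. The measure $\mu_{\boldsymbol{\beta}}\circ\phi_{\boldsymbol{\beta}}^{-1}$ is the unique $L_{\boldsymbol{\beta}}$-invariant probability measure on $\mathcal{L}_{\boldsymbol{\beta}}'$ that is absolutely continuous with respect to $\lambda_p\circ\phi_{\boldsymbol{\beta}}^{-1}$. Furthermore, $\mu_{\boldsymbol{\beta}}\circ\phi_{\boldsymbol{\beta}}^{-1}$ is equivalent to $\lambda_p\circ\phi_{\boldsymbol{\beta}}^{-1}$ on $\mathcal{L}_{\boldsymbol{\beta}}'$ and the dynamical system $\big(\bigcup_{i=0}^{p-1}(\{i\}\times(x_{\boldsymbol{\beta}^{(i)}}-1,x_{\boldsymbol{\beta}^{(i)}}]),\mathcal{L}_{\boldsymbol{\beta}}',\mu_{\boldsymbol{\beta}}\circ\phi_{\boldsymbol{\beta}}^{-1},L_{\boldsymbol{\beta}}\big)$ is ergodic and has entropy $\frac1p\log(\beta_{p-1}\cdots\beta_0)$.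
   Context: Conventions: for $n\in\mathbb{Z}$, $\beta_n=\beta_{n\bmod p}$ and $\boldsymbol{\beta}^{(n)}=(\beta_n,\ldots,\beta_{n+p-1})$. Put $x_{\boldsymbol{\beta}}=\sum_{n=0}^\infty\frac{\lceil\beta_n\rceil-1}{\prod_{k=0}^n\beta_k}$, a real number with $1\le x_{\boldsymbol{\beta}}<\infty$; $x_{\boldsymbol{\beta}^{(n)}}$ is the same quantity for the base $\boldsymbol{\beta}^{(n)}$. Here $L_{\boldsymbol{\beta}}$ is the (restricted) lazy $\boldsymbol{\beta}$-transformation of $\bigcup_{i=0}^{p-1}(\{i\}\times(x_{\boldsymbol{\beta}^{(i)}}-1,x_{\boldsymbol{\beta}^{(i)}}])$ into itself, given by $L_{\boldsymbol{\beta}}(i,x)=((i+1)\bmod p,\ \beta_ix-\lceil\beta_ix-x_{\boldsymbol{\beta}^{(i+1)}}\rceil)$. $\mathcal{B}(A)$ is the Borel $\sigma$-algebra of $A$, $\lambda$ the Lebesgue measure. $\mathcal{L}'_{\boldsymbol{\beta}}$ is the $\sigma$-algebra of all sets $\bigcup_{i=0}^{p-1}(\{i\}\times B_i)$ with $B_i\in\mathcal{B}((x_{\boldsymbol{\beta}^{(i)}}-1,x_{\boldsymbol{\beta}^{(i)}}])$ for all $i$, and $\mathcal{T}_p$ is the $\sigma$-algebra of all sets $\bigcup_{i=0}^{p-1}(\{i\}\times B_i)$ with $B_i\in\mathcal{B}([0,1))$ for all $i$. The map $\phi_{\boldsymbol{\beta}}\colon\{0,\ldots,p-1\}\times[0,1)\to\bigcup_{i=0}^{p-1}(\{i\}\times(x_{\boldsymbol{\beta}^{(i)}}-1,x_{\boldsymbol{\beta}^{(i)}}])$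 is $(i,x)\mapsto(i,x_{\boldsymbol{\beta}^{(i)}}-x)$. For a real $\beta>1$ let $T_\beta\colon[0,1)\to[0,1)$, $x\mapsto\beta x-\lfloor\beta x\rfloor$. For $i\in\{0,\ldots,p-1\}$, $\mu_{\boldsymbol{\beta},i}$ is the unique absolutely continuous (w.r.t. $\lambda$) probability measure on $\mathcal{B}([0,1))$ invariant under $T_{\beta_{i-1}}\circ\cdots\circ T_{\beta_{i-p}}$ (existence and uniqueness hold). On $\mathcal{T}_p$, $\mu_{\boldsymbol{\beta}}\big(\bigcup_{i}(\{i\}\times B_i)\big)=\frac1p\sum_{i=0}^{p-1}\mu_{\boldsymbol{\beta},i}(B_i)$ and $\lambda_p\big(\bigcup_{i}(\{i\}\times B_i)\big)=\frac1p\sum_{i=0}^{p-1}\lambda(B_i)$. Two measures are equivalent if each is absolutely continuous with respect to the other. Ergodic: $T^{-1}(B)=B$ implies $\mu(B)\in\{0,1\}$. Entropy is the measure-theoretic entropy. *)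

theory Defs
  imports "HOL-Probability.Probability"
begin

section \<open>Measures on finite disjoint unions\<close>

definition fibre_sets :: "nat \<Rightarrow> (nat \<Rightarrow> 'a measure) \<Rightarrow> (nat \<times> 'a) set set" where
  "fibre_sets p M = {(SIGMA i:{..<p}. B i) | B. \<forall>i<p. B i \<in> sets (M i)}"

text \<open>\<open>fibre_sets\<close> is already a \<open>\<sigma>\<close>-algebra and the set function below is countably additive on it,
  so that \<open>sigma\<close> and \<open>measure_of\<close> add nothing; see the lemmas \<open>sets_fibre_algebra\<close>,
  \<open>sets_fibre_measure\<close> and \<open>emeasure_fibre_measure\<close>.\<close>

definition fibre_algebra :: "nat \<Rightarrow> (nat \<Rightarrow> 'a measure) \<Rightarrow> (nat \<times> 'a) measure" where
  "fibre_algebra p M = sigma (SIGMA i:{..<p}. space (M i)) (fibre_sets p M)"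

definition fibre_measure :: "nat \<Rightarrow> (nat \<Rightarrow> 'a measure) \<Rightarrow> (nat \<times> 'a) measure" where
  "fibre_measure p M = measure_of (SIGMA i:{..<p}. space (M i)) (fibre_sets p M)
     (\<lambda>E. (\<Sum>i<p. emeasure (M i) (Pair i -` E)) / of_nat p)"

lemma fibre_sets_Pow: "fibre_sets p M \<subseteq> Pow (SIGMA i:{..<p}. space (M i))"
  by (fastforce simp: fibre_sets_def dest: sets.sets_into_space)

lemma sigma_algebra_fibre_sets: "sigma_algebra (SIGMA i:{..<p}. space (M i)) (fibre_sets p M)"
  unfolding sigma_algebra_iff2
proof (intro conjI ballI allI impI)
  show "fibre_sets p M \<subseteq> Pow (SIGMA i:{..<p}. space (M i))" by (rule fibre_sets_Pow)
  show "{} \<in> fibre_sets p M" unfolding fibre_sets_def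
    by (intro CollectI exI[of _ "\<lambda>_. {}"]) auto
next
  fix E assume "E \<in> fibre_sets p M"
  then obtain B where "E = (SIGMA i:{..<p}. B i)" "\<forall>i<p. B i \<in> sets (M i)"
    by (auto simp: fibre_sets_def)
  then show "(SIGMA i:{..<p}. space (M i)) - E \<in> fibre_sets p M"
    unfolding fibre_sets_def by (intro CollectI exI[of _ "\<lambda>i. space (M i) - B i"]) auto
next
  fix A :: "nat \<Rightarrow> _" assume "range A \<subseteq> fibre_sets p M"
  then have "\<forall>n. \<exists>B. A n = (SIGMA i:{..<p}. B i) \<and> (\<forall>i<p. B i \<in> sets (M i))"
    by (auto simp: fibre_sets_def image_subset_iff)
  then obtain B where "\<And>n. A n = (SIGMA i:{..<p}. B n i)" "\<And>n i. i < p \<Longrightarrow> B n i \<in> sets (M i)"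
    by metis
  then show "\<Union>(range A) \<in> fibre_sets p M"
    unfolding fibre_sets_def by (intro CollectI exI[of _ "\<lambda>i. \<Union>n. B n i"]) auto
qed

lemma sets_fibre_algebra: "sets (fibre_algebra p M) = fibre_sets p M"
  unfolding fibre_algebra_def
  by (simp add: fibre_sets_Pow sigma_algebra.sigma_sets_eq[OF sigma_algebra_fibre_sets])

lemma space_fibre_algebra: "space (fibre_algebra p M) = (SIGMA i:{..<p}. space (M i))"
  unfolding fibre_algebra_def by (simp add: space_measure_of fibre_sets_Pow)

lemma sets_fibre_measure: "sets (fibre_measure p M) = fibre_sets p M"
  unfolding fibre_measure_def
  by (simp add: fibre_sets_Pow sigma_algebra.sigma_sets_eq[OF sigma_algebra_fibre_sets])

lemma space_fibre_measure: "space (fibre_measure p M) = (SIGMA i:{..<p}. space (M i))"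
  unfolding fibre_measure_def by (simp add: space_measure_of fibre_sets_Pow)

lemma emeasure_fibre_measure:
  assumes B: "\<And>i. i < p \<Longrightarrow> B i \<in> sets (M i)"
  shows "emeasure (fibre_measure p M) (SIGMA i:{..<p}. B i) =
    (\<Sum>i<p. emeasure (M i) (B i)) / of_nat p"
proof -
  let ?m = "\<lambda>E. (\<Sum>i<p. emeasure (M i) (Pair i -` E)) / of_nat p"
  have fibre: "Pair i -` E \<in> sets (M i)" if "E \<in> fibre_sets p M" "i < p" for E i
    using that by (auto simp: fibre_sets_def vimage_def)
  have "emeasure (fibre_measure p M) (SIGMA i:{..<p}. B i) = ?m (SIGMA i:{..<p}. B i)"
  proof (rule emeasure_measure_of[OF fibre_measure_def fibre_sets_Pow])
    show "(SIGMA i:{..<p}. B i) \<in> sets (fibre_measure p M)"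
      unfolding sets_fibre_measure using B by (auto simp: fibre_sets_def)
    show "positive (sets (fibre_measure p M)) ?m"
      by (simp add: positive_def)
    show "countably_additive (sets (fibre_measure p M)) ?m"
      unfolding countably_additive_def sets_fibre_measure
    proof (intro allI impI)
      fix A :: "nat \<Rightarrow> (nat \<times> 'a) set"
      assume A: "range A \<subseteq> fibre_sets p M" "disjoint_family A"
      have "(\<Sum>n. emeasure (M i) (Pair i -` A n)) = emeasure (M i) (Pair i -` (\<Union>n. A n))"
        if "i < p" for i
        unfolding vimage_UN using that A fibre
        by (intro suminf_emeasure) (auto simp: disjoint_family_on_def image_subset_iff)
      then have "(\<Sum>i<p. \<Sum>n. emeasure (M i) (Pair i -` A n)) =
          (\<Sum>i<p. emeasure (M i) (Pair i -` (\<Union>n. A n)))"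
        by (intro sum.cong) auto
      then show "(\<Sum>n. ?m (A n)) = ?m (\<Union>(range A))"
        by (simp add: suminf_sum divide_ennreal_def ennreal_suminf_multc)
    qed
  qed
  also have "\<dots> = (\<Sum>i<p. emeasure (M i) (B i)) / of_nat p"
    by (intro arg_cong2[where f = "(/)"] sum.cong refl arg_cong2[where f = emeasure]) auto
  finally show ?thesis .
qed

section \<open>Dynamical systems\<close>

definition invariant_measure :: "'a measure \<Rightarrow> ('a \<Rightarrow> 'a) \<Rightarrow> bool" where
  "invariant_measure M T \<longleftrightarrow> T \<in> measurable M M \<and> distr M M T = M"

text \<open>\<open>N\<close> is a \<open>T\<close>-invariant probability measure on the \<open>\<sigma>\<close>-algebra of \<open>M\<close> with \<open>N \<lless> M\<close>.\<close>

definition ac_invariant_prob :: "'a measure \<Rightarrow> ('a \<Rightarrow> 'a) \<Rightarrow> 'a measure \<Rightarrow> bool" where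
  "ac_invariant_prob M T N \<longleftrightarrow> prob_space N \<and> sets N = sets M \<and>
     absolutely_continuous M N \<and> invariant_measure N T"

definition equivalent_measures :: "'a measure \<Rightarrow> 'a measure \<Rightarrow> bool" where
  "equivalent_measures M N \<longleftrightarrow> sets M = sets N \<and>
     absolutely_continuous M N \<and> absolutely_continuous N M"

definition ergodic :: "'a measure \<Rightarrow> ('a \<Rightarrow> 'a) \<Rightarrow> bool" where
  "ergodic M T \<longleftrightarrow> prob_space M \<and> invariant_measure M T \<and>
     (\<forall>B\<in>sets M. T -` B \<inter> space M = B \<longrightarrow> measure M B \<in> {0, 1})"

text \<open>Kolmogorov--Sinai entropy with the natural logarithm. The convention \<open>0 log 0 = 0\<close> is
  automatic. \<open>refined_partition M T P n\<close> is the join of \<open>P, T\<^sup>-\<^sup>1 P, \<dots>, T\<^sup>-\<^sup>(\<^sup>n\<^sup>-\<^sup>1\<^sup>) P\<close>.\<close>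

definition partition_entropy :: "'a measure \<Rightarrow> 'a set set \<Rightarrow> real" where
  "partition_entropy M P = - (\<Sum>A\<in>P. measure M A * ln (measure M A))"

definition refined_partition :: "'a measure \<Rightarrow> ('a \<Rightarrow> 'a) \<Rightarrow> 'a set set \<Rightarrow> nat \<Rightarrow> 'a set set" where
  "refined_partition M T P n =
     {{x \<in> space M. \<forall>k<n. (T ^^ k) x \<in> A k} | A. \<forall>k<n. A k \<in> P} - {{}}"

definition entropy_wrt :: "'a measure \<Rightarrow> ('a \<Rightarrow> 'a) \<Rightarrow> 'a set set \<Rightarrow> real" where
  "entropy_wrt M T P = lim (\<lambda>n. partition_entropy M (refined_partition M T P n) / real n)"

definition measure_entropy :: "'a measure \<Rightarrow> ('a \<Rightarrow> 'a) \<Rightarrow> ereal" where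
  "measure_entropy M T =
     (SUP P \<in> {P. finite P \<and> partition_on (space M) P \<and> P \<subseteq> sets M}. ereal (entropy_wrt M T P))"

section \<open>Alternate bases and lazy expansions\<close>

text \<open>The tuple is a list, and \<open>base_at b n\<close> is its \<open>n\<close>-th entry modulo the length, for \<open>n \<in> \<int>\<close>.\<close>

definition base_at :: "real list \<Rightarrow> int \<Rightarrow> real" where
  "base_at b n = b ! nat (n mod int (length b))"

definition base_shift :: "real list \<Rightarrow> int \<Rightarrow> real list" where
  "base_shift b n = map (\<lambda>j. base_at b (n + int j)) [0..<length b]"

definition x_base :: "real list \<Rightarrow> real" where
  "x_base b = (\<Sum>n. (of_int \<lceil>base_at b (int n)\<rceil> - 1) / (\<Prod>k\<le>n. base_at b (int k)))"

definition lazy_interval :: "real list \<Rightarrow> nat \<Rightarrow> real set" where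
  "lazy_interval b i = {x_base (base_shift b (int i)) - 1 <.. x_base (base_shift b (int i))}"

definition lazy_algebra :: "real list \<Rightarrow> (nat \<times> real) measure" where
  "lazy_algebra b = fibre_algebra (length b) (\<lambda>i. restrict_space borel (lazy_interval b i))"

definition lazy_map :: "real list \<Rightarrow> nat \<times> real \<Rightarrow> nat \<times> real" where
  "lazy_map b = (\<lambda>(i, x). ((i + 1) mod length b,
     base_at b (int i) * x -
       of_int \<lceil>base_at b (int i) * x - x_base (base_shift b (int i + 1))\<rceil>))"

definition conj_map :: "real list \<Rightarrow> nat \<times> real \<Rightarrow> nat \<times> real" where
  "conj_map b = (\<lambda>(i, x). (i, x_base (base_shift b (int i)) - x))"

definition greedy_map :: "real \<Rightarrow> real \<Rightarrow> real" where
  "greedy_map c x = c * x - of_int \<lfloor>c * x\<rfloor>"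

text \<open>\<open>fold\<close> applies the map of the leftmost index \<open>i - p\<close> first.\<close>

definition greedy_return :: "real list \<Rightarrow> nat \<Rightarrow> real \<Rightarrow> real" where
  "greedy_return b i =
     fold (\<lambda>j. greedy_map (base_at b j)) [int i - int (length b)..int i - 1]"

definition lebesgue01 :: "real measure" where
  "lebesgue01 = restrict_space lborel {0..<1}"

definition mu_fibre :: "real list \<Rightarrow> nat \<Rightarrow> real measure" where
  "mu_fibre b i = (THE N. ac_invariant_prob lebesgue01 (greedy_return b i) N)"

definition mu_base :: "real list \<Rightarrow> (nat \<times> real) measure" where
  "mu_base b = fibre_measure (length b) (mu_fibre b)"

definition lambda_p :: "nat \<Rightarrow> (nat \<times> real) measure" where
  "lambda_p p = fibre_measure p (\<lambda>_. lebesgue01)"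

definition mu_lazy :: "real list \<Rightarrow> (nat \<times> real) measure" where
  "mu_lazy b = distr (mu_base b) (lazy_algebra b) (conj_map b)"

definition lambda_lazy :: "real list \<Rightarrow> (nat \<times> real) measure" where
  "lambda_lazy b = distr (lambda_p (length b)) (lazy_algebra b) (conj_map b)"

end

theory Submission
  imports Defs
begin

text \<open>
  The involution \<open>(i, x) \<mapsto> (i, x\<^sub>i - x)\<close> conjugates the lazy map to the skew product \<open>T\<close> of the greedy
  maps, because \<open>\<beta>\<^sub>i x\<^sub>i = \<lceil>\<beta>\<^sub>i\<rceil> - 1 + x\<^sub>i\<^sub>+\<^sub>1\<close>; so everything is proved for \<open>T\<close>.

  The transfer operator of a greedy map preserves non-increasing densities and satisfies
  \<open>(P f)(0) \<le> f(0) / \<beta> + \<integral> f\<close>, which bounds all iterates uniformly. A bounded non-increasing density of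
  mass \<open>1\<close> is at least \<open>1/2\<close> near \<open>0\<close>, hence after finitely many steps at least some \<open>\<epsilon> > 0\<close> everywhere.
  Splitting off the constant \<open>\<epsilon>\<close> and repeating gives uniform exponential convergence of the iterates of
  the return operator to an invariant density between two positive constants. If \<open>B\<close> is invariant up to
  null sets, applying this to the densities \<open>1\<^bsub>[0,t)\<^esub> / t\<close> gives \<open>\<lambda> (B \<inter> [0,t)) = t \<mu> B\<close> for all \<open>t\<close>,
  hence \<open>\<lambda> B \<in> {0, 1}\<close>: ergodicity, and with it uniqueness.

  For the entropy \<open>h\<close>, every word of digits of length \<open>n\<close> is that of a preimage of \<open>0\<close>, and these are counted by
  the transfer operator applied to the constant \<open>1\<close>, so there are \<open>O(e\<^sup>n\<^sup>h)\<close> words; cylinders have measure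
  \<open>O(e\<^sup>-\<^sup>n\<^sup>h)\<close> because they are short and the density is bounded. The second fact bounds the entropy from
  below. For an arbitrary finite partition, Gibbs' inequality against a random perturbation of labels
  predicted from a uniformly chosen word of digits gives the upper bound.
\<close>

section \<open>The transfer operator of a greedy map\<close>

text \<open>The obstacle is the incomplete last branch of a greedy map with non-integer slope.
  Monotonicity disposes of it: a density set to zero off [0,1) is still non-increasing on the whole
  half-line from 0, so the missing part of the branch contributes zero terms and the sum may run
  over all inverse branches. In this class f(0) is the supremum, so one number does the work of a
  norm and all convergence is pointwise and uniform. The class also contains the normalised
  indicators of initial segments, which are enough to test a Borel set, so no approximation of
  general integrable densities is required.

  In the entropy bound, a finite window of digits predicts the cell of an arbitrary partition only
  up to a small error, whereas Gibbs' inequality needs a reference distribution that charges every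
  word that occurs. This is what the random perturbation is for: a correct prediction then costs
  almost nothing, and a wrong one a bounded amount.\<close>

definition transfer :: "real \<Rightarrow> (real \<Rightarrow> real) \<Rightarrow> real \<Rightarrow> real" where
  "transfer c f y = (if 0 \<le> y \<and> y < 1 then (\<Sum>d<nat \<lceil>c\<rceil>. f ((y + real d) / c)) / c else 0)"

text \<open>Comparison with points beyond 1, where f is 0, also forces f to be nonnegative.\<close>

definition decreasing_density :: "(real \<Rightarrow> real) \<Rightarrow> bool" where
  "decreasing_density f \<longleftrightarrow> (\<forall>x. x < 0 \<or> 1 \<le> x \<longrightarrow> f x = 0) \<and> (\<forall>x y. 0 \<le> x \<longrightarrow> x \<le> y \<longrightarrow> f y \<le> f x)"

definition mass :: "(real \<Rightarrow> real) \<Rightarrow> real" where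
  "mass f = (\<integral>x. f x \<partial>lborel)"

lemma decreasing_densityD:
  assumes "decreasing_density f"
  shows "x < 0 \<Longrightarrow> f x = 0" "1 \<le> x \<Longrightarrow> f x = 0" "0 \<le> x \<Longrightarrow> x \<le> y \<Longrightarrow> f y \<le> f x"
  using assms unfolding decreasing_density_def by auto

lemma decreasing_density_nonneg: "decreasing_density f \<Longrightarrow> 0 \<le> f x"
  by (metis decreasing_densityD linorder_le_cases linorder_not_le order_refl)

lemma decreasing_density_le: "decreasing_density f \<Longrightarrow> f x \<le> f 0"
  by (metis decreasing_densityD(1,3) decreasing_density_nonneg linorder_not_le order_refl)

lemma decreasing_density_measurable [measurable_dest]:
  assumes f: "decreasing_density f"
  shows "f \<in> borel_measurable borel"
proof -
  \<comment> \<open>Monotone functions on the line are Borel; \<open>max 0\<close> removes the jump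
    at 0, where f may rise.\<close>
  have "mono (\<lambda>x. - f (max 0 x))"
    by (intro monoI) (simp add: decreasing_densityD(3)[OF f])
  then have [measurable]: "(\<lambda>x. - f (max 0 x)) \<in> borel_measurable borel"
    by (rule borel_measurable_mono)
  have "f = (\<lambda>x. indicator {0..} x * - (- f (max 0 x)))"
    using decreasing_densityD(1)[OF f] by (auto simp: fun_eq_iff indicator_def max_def not_le)
  also have "\<dots> \<in> borel_measurable borel" by measurable
  finally show ?thesis .
qed

lemma decreasing_density_indicator: "t \<le> 1 \<Longrightarrow> decreasing_density (indicator {0..<t})"
  unfolding decreasing_density_def by (auto simp: indicator_def)

lemma decreasing_density_integrable:
  assumes f: "decreasing_density f"
  shows "integrable lborel f"
proof -
  have [measurable]: "f \<in> borel_measurable borel" using f by (rule decreasing_density_measurable)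
  have "integrable lborel (\<lambda>x. indicator {0..1} x *\<^sub>R f x)"
    using decreasing_density_le[OF f] decreasing_density_nonneg[OF f]
    by (intro integrableI_bounded_set_indicator[where B = "f 0"]) auto
  also have "(\<lambda>x. indicator {0..1} x *\<^sub>R f x) = f"
  proof
    fix x show "indicator {0..1} x *\<^sub>R f x = f x"
      using decreasing_densityD(1,2)[OF f, of x] by (cases "x < 0"; cases "1 \<le> x") (auto simp: indicator_def)
  qed
  finally show ?thesis .
qed

text \<open>Every inverse branch \<open>y \<mapsto> (y + d) / c\<close> is increasing, and where it
  leaves [0,1) it meets 0, the least value of a decreasing density.\<close>

lemma transfer_decreasing_density:
  assumes c: "c > 0" and f: "decreasing_density f"
  shows "decreasing_density (transfer c f)"
  unfolding decreasing_density_def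
proof (intro conjI allI impI)
  fix x :: real assume "x < 0 \<or> 1 \<le> x" then show "transfer c f x = 0" by (auto simp: transfer_def)
next
  fix x y :: real assume xy: "0 \<le> x" "x \<le> y"
  have "(\<Sum>d<nat \<lceil>c\<rceil>. f ((y + real d) / c)) \<le> (\<Sum>d<nat \<lceil>c\<rceil>. f ((x + real d) / c))"
    using xy c by (intro sum_mono decreasing_densityD(3)[OF f] divide_right_mono) auto
  moreover have "0 \<le> (\<Sum>d<nat \<lceil>c\<rceil>. f ((x + real d) / c))"
    by (intro sum_nonneg decreasing_density_nonneg[OF f])
  ultimately show "transfer c f y \<le> transfer c f x"
    using xy c by (auto simp: transfer_def divide_right_mono)
qed

text \<open>Shift the branches by one: since y < 1, the d-th term at y is at least the (d+1)-th term
  at 0. Only the term f(0) of the first branch is lost, and the term with index \<lceil>c\<rceil>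
  that the shift adds is 0.\<close>

lemma transfer_0_le:
  assumes c: "c > 0" and f: "decreasing_density f" and y: "0 \<le> y" "y < 1"
  shows "transfer c f 0 - f 0 / c \<le> transfer c f y"
proof -
  obtain n where n: "nat \<lceil>c\<rceil> = Suc n" using c by (cases "nat \<lceil>c\<rceil>") auto
  have n1: "real (Suc n) \<ge> c" using n by linarith
  have "(\<Sum>d<Suc n. f ((0 + real d) / c)) - f 0 = (\<Sum>d<n. f ((0 + real (Suc d)) / c))"
    by (simp only: sum.lessThan_Suc_shift) simp
  also have "\<dots> = (\<Sum>d<Suc n. f ((0 + real (Suc d)) / c))"
    using n1 c by (simp add: decreasing_densityD(2)[OF f])
  also have "\<dots> \<le> (\<Sum>d<Suc n. f ((y + real d) / c))"
    using y c by (intro sum_mono decreasing_densityD(3)[OF f] divide_right_mono) auto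
  finally have "(\<Sum>d<Suc n. f ((0 + real d) / c)) \<le> f 0 + (\<Sum>d<Suc n. f ((y + real d) / c))"
    by simp
  from divide_right_mono[OF this, of c] show ?thesis
    using c y n by (simp add: transfer_def add_divide_distrib)
qed

lemma space_lebesgue01 [simp]: "space lebesgue01 = {0..<1}"
  by (simp add: lebesgue01_def space_restrict_space)

lemma sets_lebesgue01: "sets lebesgue01 = sets (restrict_space borel {0..<1})"
  unfolding lebesgue01_def by (intro sets_restrict_space_cong) simp

lemma sets_lebesgue01_iff: "B \<in> sets lebesgue01 \<longleftrightarrow> B \<in> sets borel \<and> B \<subseteq> {0..<1}"
  unfolding sets_lebesgue01 by (subst sets_restrict_space_iff) auto

lemma greedy_map_range: "greedy_map c x \<in> {0..<1}"
  unfolding greedy_map_def by (auto simp: algebra_simps) linarith+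

lemma greedy_map_measurable: "greedy_map c \<in> measurable borel borel"
  unfolding greedy_map_def by measurable

lemma greedy_map_measurable01: "greedy_map c \<in> measurable lebesgue01 lebesgue01"
proof -
  have "greedy_map c \<in> measurable (restrict_space borel {0..<1}) (restrict_space borel {0..<1})"
    by (intro measurable_restrict_space3 greedy_map_measurable) (use greedy_map_range in auto)
  then show ?thesis by (simp add: measurable_cong_sets[OF sets_lebesgue01 sets_lebesgue01])
qed

lemma borel_measurable_lebesgue01:
  "f \<in> borel_measurable borel \<Longrightarrow> f \<in> borel_measurable lebesgue01"
  unfolding lebesgue01_def by (intro measurable_restrict_space1) simp

lemma emeasure_density_lebesgue01:
  assumes [measurable]: "f \<in> borel_measurable borel" and B: "B \<in> sets lebesgue01"
  shows "emeasure (density lebesgue01 (\<lambda>x. ennreal (f x))) B = (\<integral>\<^sup>+x. ennreal (f x) * indicator B x \<partial>lborel)"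
proof -
  have [measurable]: "B \<in> sets borel" and B1: "B \<subseteq> {0..<1}" using B by (auto simp: sets_lebesgue01_iff)
  have "emeasure (density lebesgue01 (\<lambda>x. ennreal (f x))) B = (\<integral>\<^sup>+x. ennreal (f x) * indicator B x \<partial>lebesgue01)"
    using B by (intro emeasure_density borel_measurable_lebesgue01) auto
  also have "\<dots> = (\<integral>\<^sup>+x. ennreal (f x) * indicator B x * indicator {0..<1} x \<partial>lborel)"
    unfolding lebesgue01_def by (subst nn_integral_restrict_space) auto
  also have "\<dots> = (\<integral>\<^sup>+x. ennreal (f x) * indicator B x \<partial>lborel)"
    using B1 by (intro nn_integral_cong) (auto simp: indicator_def)
  finally show ?thesis .
qed

lemma transfer_measurable:
  assumes [measurable]: "f \<in> borel_measurable borel"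
  shows "transfer c f \<in> borel_measurable borel"
  unfolding transfer_def[abs_def] by measurable

lemma greedy_map_eqI: "0 \<le> c * x - of_int d \<Longrightarrow> c * x - of_int d < 1 \<Longrightarrow> greedy_map c x = c * x - of_int d"
  unfolding greedy_map_def by (simp add: floor_unique algebra_simps)

lemma floor_less_ceiling:
  assumes c: "c > 0" and x: "0 \<le> x" "x < (1::real)"
  shows "nat \<lfloor>c * x\<rfloor> < nat \<lceil>c\<rceil>"
proof -
  have "c * x < c" using c x by simp
  then have "\<lfloor>c * x\<rfloor> < \<lceil>c\<rceil>" by linarith
  then show ?thesis using c x by simp
qed

lemma distr_greedy_map_density:
  assumes c: "c > 0" and f [measurable]: "f \<in> borel_measurable borel"
    and f0: "\<And>x. x < 0 \<or> 1 \<le> x \<Longrightarrow> f x = 0" and nn: "\<And>x. 0 \<le> f x"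
  shows "distr (density lebesgue01 (\<lambda>x. ennreal (f x))) lebesgue01 (greedy_map c)
    = density lebesgue01 (\<lambda>x. ennreal (transfer c f x))"
proof (rule measure_eqI)
  fix B assume "B \<in> sets (distr (density lebesgue01 (\<lambda>x. ennreal (f x))) lebesgue01 (greedy_map c))"
  then have B: "B \<in> sets lebesgue01" by simp
  then have [measurable]: "B \<in> sets borel" and B1: "B \<subseteq> {0..<1}" by (auto simp: sets_lebesgue01_iff)
  have T: "greedy_map c \<in> measurable (density lebesgue01 (\<lambda>x. ennreal (f x))) lebesgue01"
    using greedy_map_measurable01 by simp
  let ?V = "greedy_map c -` B \<inter> space (density lebesgue01 (\<lambda>x. ennreal (f x)))"
  have V: "?V \<in> sets lebesgue01"
    using measurable_sets[OF greedy_map_measurable01 B] by simp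
  have "emeasure (distr (density lebesgue01 (\<lambda>x. ennreal (f x))) lebesgue01 (greedy_map c)) B
      = (\<integral>\<^sup>+x. ennreal (f x) * indicator ?V x \<partial>lborel)"
    using T B V by (simp add: emeasure_distr emeasure_density_lebesgue01)
  \<comment> \<open>As B lies in [0,1), at most one d puts \<open>c * x - d\<close> into B, namely
    the floor of \<open>c * x\<close>; so the indicator of the preimage splits into a sum over
    d.\<close>
  also have "\<dots> = (\<integral>\<^sup>+x. (\<Sum>d<nat \<lceil>c\<rceil>. ennreal (f x) * indicator B (c * x - real d)) \<partial>lborel)"
  proof (intro nn_integral_cong)
    fix x :: real
    show "ennreal (f x) * indicator ?V x = (\<Sum>d<nat \<lceil>c\<rceil>. ennreal (f x) * indicator B (c * x - real d))"
    proof (cases "0 \<le> x \<and> x < 1")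
      case True
      let ?d = "nat \<lfloor>c * x\<rfloor>"
      have d: "?d \<in> {..<nat \<lceil>c\<rceil>}" using floor_less_ceiling[OF c] True by auto
      have Td: "greedy_map c x = c * x - real ?d" using True c by (simp add: greedy_map_def)
      have other: "c * x - real d \<notin> B" if "d \<noteq> ?d" for d
      proof
        assume "c * x - real d \<in> B"
        then have "greedy_map c x = c * x - of_int (int d)" using B1
          by (intro greedy_map_eqI) auto
        with Td that show False by simp
      qed
      have "(\<Sum>d<nat \<lceil>c\<rceil>. ennreal (f x) * indicator B (c * x - real d)) = ennreal (f x) * indicator B (c * x - real ?d)"
        by (subst sum.remove[OF _ d]) (auto intro!: sum.neutral simp: other)
      then show ?thesis using True Td by (simp add: indicator_def)
    next
      case False then show ?thesis using f0[of x] by auto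
    qed
  qed
  also have "\<dots> = (\<Sum>d<nat \<lceil>c\<rceil>. (\<integral>\<^sup>+x. ennreal (f x) * indicator B (c * x - real d) \<partial>lborel))"
    by (intro nn_integral_sum) measurable
  also have "\<dots> = (\<Sum>d<nat \<lceil>c\<rceil>. (\<integral>\<^sup>+y. ennreal (f ((y + real d) / c) / c) * indicator B y \<partial>lborel))"
  proof (intro sum.cong refl)
    fix d
    have "(\<integral>\<^sup>+x. ennreal (f x) * indicator B (c * x - real d) \<partial>lborel)
        = ennreal \<bar>1 / c\<bar> * (\<integral>\<^sup>+y. ennreal (f (real d / c + 1 / c * y)) * indicator B (c * (real d / c + 1 / c * y) - real d) \<partial>lborel)"
      by (rule nn_integral_real_affine) (measurable, use c in simp)
    also have "\<dots> = (\<integral>\<^sup>+y. ennreal \<bar>1 / c\<bar> * (ennreal (f (real d / c + 1 / c * y)) * indicator B (c * (real d / c + 1 / c * y) - real d)) \<partial>lborel)"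
      by (intro nn_integral_cmult[symmetric]) measurable
    also have "\<dots> = (\<integral>\<^sup>+y. ennreal (f ((y + real d) / c) / c) * indicator B y \<partial>lborel)"
    proof (intro nn_integral_cong)
      fix y :: real
      have "real d / c + 1 / c * y = (y + real d) / c" "c * ((y + real d) / c) - real d = y"
        using c by (auto simp: field_simps)
      then show "ennreal \<bar>1 / c\<bar> * (ennreal (f (real d / c + 1 / c * y)) * indicator B (c * (real d / c + 1 / c * y) - real d))
          = ennreal (f ((y + real d) / c) / c) * indicator B y"
        using c nn by (simp add: ennreal_mult'[symmetric] mult.assoc[symmetric])
    qed
    finally show "(\<integral>\<^sup>+x. ennreal (f x) * indicator B (c * x - real d) \<partial>lborel)
        = (\<integral>\<^sup>+y. ennreal (f ((y + real d) / c) / c) * indicator B y \<partial>lborel)" .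
  qed
  also have "\<dots> = (\<integral>\<^sup>+y. (\<Sum>d<nat \<lceil>c\<rceil>. ennreal (f ((y + real d) / c) / c) * indicator B y) \<partial>lborel)"
    by (intro nn_integral_sum[symmetric]) measurable
  also have "\<dots> = (\<integral>\<^sup>+y. ennreal (transfer c f y) * indicator B y \<partial>lborel)"
  proof (intro nn_integral_cong)
    fix y :: real
    show "(\<Sum>d<nat \<lceil>c\<rceil>. ennreal (f ((y + real d) / c) / c) * indicator B y) = ennreal (transfer c f y) * indicator B y"
      using c nn B1
      by (auto simp: transfer_def indicator_def sum_divide_distrib subset_iff)
  qed
  also have "\<dots> = emeasure (density lebesgue01 (\<lambda>x. ennreal (transfer c f x))) B"
    using B by (simp add: emeasure_density_lebesgue01 transfer_measurable)
  finally show "emeasure (distr (density lebesgue01 (\<lambda>x. ennreal (f x))) lebesgue01 (greedy_map c)) B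
      = emeasure (density lebesgue01 (\<lambda>x. ennreal (transfer c f x))) B" .
qed simp

lemma emeasure_density_mass:
  assumes f: "decreasing_density f"
  shows "emeasure (density lebesgue01 (\<lambda>x. ennreal (f x))) {0..<1} = ennreal (mass f)"
proof -
  have "emeasure (density lebesgue01 (\<lambda>x. ennreal (f x))) {0..<1} = (\<integral>\<^sup>+x. ennreal (f x) * indicator {0..<1} x \<partial>lborel)"
    using f by (intro emeasure_density_lebesgue01 decreasing_density_measurable) (auto simp: sets_lebesgue01_iff)
  also have "\<dots> = (\<integral>\<^sup>+x. ennreal (f x) \<partial>lborel)"
    using decreasing_densityD[OF f] by (intro nn_integral_cong) (auto simp: indicator_def not_le not_less)
  also have "\<dots> = ennreal (mass f)" unfolding mass_def
    by (intro nn_integral_eq_integral decreasing_density_integrable f AE_I2 decreasing_density_nonneg)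
  finally show ?thesis .
qed

lemma mass_nonneg: "decreasing_density f \<Longrightarrow> 0 \<le> mass f"
  unfolding mass_def by (intro Bochner_Integration.integral_nonneg decreasing_density_nonneg)

lemma distr_fold_greedy:
  assumes "\<forall>c\<in>set cs. c > 0" and "decreasing_density f"
  shows "decreasing_density (fold transfer cs f) \<and>
    fold greedy_map cs \<in> measurable lebesgue01 lebesgue01 \<and>
    distr (density lebesgue01 (\<lambda>x. ennreal (f x))) lebesgue01 (fold greedy_map cs)
    = density lebesgue01 (\<lambda>x. ennreal (fold transfer cs f x))"
  using assms
proof (induction cs arbitrary: f)
  case Nil
  have "distr (density lebesgue01 (\<lambda>x. ennreal (f x))) lebesgue01 (\<lambda>x. x) = density lebesgue01 (\<lambda>x. ennreal (f x))"
    by (rule distr_id2) simp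
  then show ?case using Nil by (simp add: id_def)
next
  case (Cons c cs)
  let ?D = "\<lambda>f. density lebesgue01 (\<lambda>x. ennreal (f x))"
  have tf: "decreasing_density (transfer c f)" using Cons.prems by (intro transfer_decreasing_density) auto
  note IH = Cons.IH[OF _ tf]
  have m: "fold greedy_map cs \<in> measurable lebesgue01 lebesgue01" using IH Cons.prems by auto
  have m1: "greedy_map c \<in> measurable (?D f) lebesgue01" using greedy_map_measurable01 by simp
  have "distr (?D f) lebesgue01 (fold greedy_map (c # cs)) =
      distr (distr (?D f) lebesgue01 (greedy_map c)) lebesgue01 (fold greedy_map cs)"
    using distr_distr[OF m m1] by (simp add: comp_def)
  also have "distr (?D f) lebesgue01 (greedy_map c) = ?D (transfer c f)"
    using Cons.prems by (intro distr_greedy_map_density decreasing_density_measurable)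
      (auto simp: decreasing_densityD decreasing_density_nonneg)
  also have "distr \<dots> lebesgue01 (fold greedy_map cs) = ?D (fold transfer cs (transfer c f))"
    using IH Cons.prems by auto
  finally show ?case using IH Cons.prems measurable_comp[OF greedy_map_measurable01 m] by (simp add: comp_def)
qed

text \<open>The new density belongs to a push-forward, and push-forwards keep the total
  measure.\<close>

lemma mass_fold_transfer:
  assumes "\<forall>c\<in>set cs. c > 0" and f: "decreasing_density f"
  shows "mass (fold transfer cs f) = mass f"
proof -
  note D = distr_fold_greedy[OF assms]
  let ?D = "\<lambda>f. density lebesgue01 (\<lambda>x. ennreal (f x))"
  have m: "fold greedy_map cs \<in> measurable (?D f) lebesgue01" using D by simp
  have "ennreal (mass (fold transfer cs f)) = emeasure (distr (?D f) lebesgue01 (fold greedy_map cs)) {0..<1}"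
    using D by (simp add: emeasure_density_mass)
  also have "\<dots> = emeasure (?D f) (fold greedy_map cs -` {0..<1} \<inter> {0..<1})"
    using m by (subst emeasure_distr) (auto simp: sets_lebesgue01_iff)
  also have "fold greedy_map cs -` {0..<1} \<inter> {0..<1} = {0..<1}"
    using measurable_space[OF m] by auto
  also have "emeasure (?D f) {0..<1} = ennreal (mass f)" using f by (rule emeasure_density_mass)
  finally show ?thesis using mass_nonneg f D by simp
qed

section \<open>Contraction of the transfer operator\<close>

lemma mass_ge:
  assumes f: "decreasing_density f" and a: "\<And>x. 0 \<le> x \<Longrightarrow> x < 1 \<Longrightarrow> a \<le> f x"
  shows "a \<le> mass f"
proof -
  have int: "integrable lborel (\<lambda>x. a * indicator {0..<1::real} x)" by simp
  have "a = (\<integral>x. a * indicator {0..<1::real} x \<partial>lborel)" by simp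
  also have "\<dots> \<le> mass f" unfolding mass_def
    using a decreasing_density_nonneg[OF f]
    by (intro integral_mono[OF int decreasing_density_integrable[OF f]]) (auto simp: indicator_def)
  finally show ?thesis .
qed

text \<open>Average \<open>transfer_0_le\<close> over all y in [0,1). This takes the place of a
  Lasota-Yorke inequality: the supremum shrinks by the slope, up to a multiple of the conserved
  mass.\<close>

lemma transfer_0_le_mass:
  assumes c: "c > 0" and f: "decreasing_density f"
  shows "transfer c f 0 \<le> f 0 / c + mass f"
proof -
  have "transfer c f 0 - f 0 / c \<le> mass (transfer c f)"
    by (intro mass_ge transfer_decreasing_density transfer_0_le c f)
  also have "mass (transfer c f) = mass f" using mass_fold_transfer[of "[c]" f] c f by simp
  finally show ?thesis by simp
qed

text \<open>Iterating the one-step bound sums the mass terms to at most the geometric series with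
  value \<open>b / (b - 1)\<close>, independently of the number of maps.\<close>

lemma fold_transfer_0_le:
  assumes b: "b > 1" and "\<forall>c\<in>set cs. b \<le> c" and f: "decreasing_density f"
  shows "fold transfer cs f 0 \<le> f 0 / b ^ length cs + mass f * (b / (b - 1))"
  using assms(2)
proof (induction cs rule: rev_induct)
  case Nil
  then show ?case using b mass_nonneg[OF f] by simp
next
  case (snoc c cs)
  let ?g = "fold transfer cs f"
  have cs: "\<forall>c\<in>set cs. c > 0" and c: "b \<le> c" using snoc.prems b by auto
  have g: "decreasing_density ?g" "mass ?g = mass f"
    using distr_fold_greedy[OF cs f] mass_fold_transfer[OF cs f] by auto
  have "fold transfer (cs @ [c]) f 0 \<le> ?g 0 / c + mass f"
    using transfer_0_le_mass[OF _ g(1), of c] c b g(2) by simp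
  also have "\<dots> \<le> ?g 0 / b + mass f"
    using c b decreasing_density_nonneg[OF g(1), of 0] by (simp add: frac_le)
  also have "\<dots> \<le> (f 0 / b ^ length cs + mass f * (b / (b - 1))) / b + mass f"
    using snoc b by (intro add_right_mono divide_right_mono) auto
  also have "\<dots> = f 0 / b ^ length (cs @ [c]) + mass f * (b / (b - 1))"
    using b by (simp add: field_simps)
  finally show ?case .
qed

lemma fold_transfer_linear:
  "fold transfer cs (\<lambda>x. u * f x + v * g x) = (\<lambda>x. u * fold transfer cs f x + v * fold transfer cs g x)"
proof (induction cs arbitrary: f g)
  case (Cons c cs)
  have "transfer c (\<lambda>x. u * f x + v * g x) = (\<lambda>x. u * transfer c f x + v * transfer c g x)"
    by (auto simp: transfer_def fun_eq_iff sum.distrib sum_distrib_left[symmetric] add_divide_distrib)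
  then show ?case using Cons.IH by simp
qed simp

text \<open>Keep only the branch d = 0 in every step: it stretches the interval [0,s) by c and
  divides the lower bound a by c.\<close>

lemma fold_transfer_lower:
  assumes "\<forall>c\<in>set cs. 1 \<le> c" and "decreasing_density f" and "0 \<le> a"
    and "\<And>x. 0 \<le> x \<Longrightarrow> x < s \<Longrightarrow> x < 1 \<Longrightarrow> a \<le> f x"
    and "0 \<le> y" "y < 1" "y < s * prod_list cs"
  shows "a / prod_list cs \<le> fold transfer cs f y"
  using assms
proof (induction cs arbitrary: f a s)
  case (Cons c cs)
  have c: "1 \<le> c" using Cons.prems by simp
  have tf: "decreasing_density (transfer c f)" using c Cons.prems by (intro transfer_decreasing_density) auto
  have "a / c \<le> transfer c f x" if x: "0 \<le> x" "x < s * c" "x < 1" for x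
  proof -
    have "a \<le> f ((x + real 0) / c)" using x c by (intro Cons.prems(4)) (auto simp: field_simps)
    also have "\<dots> \<le> (\<Sum>d<nat \<lceil>c\<rceil>. f ((x + real d) / c))"
      using c decreasing_density_nonneg[OF Cons.prems(2)] by (intro member_le_sum) auto
    finally show ?thesis using x c by (simp add: transfer_def divide_right_mono)
  qed
  then have "(a / c) / prod_list cs \<le> fold transfer cs (transfer c f) y"
    using Cons.prems c tf by (intro Cons.IH[where s = "s * c"]) (auto simp: mult.assoc)
  then show ?case by (simp add: field_simps)
qed auto

lemma prod_list_ge_power: "1 \<le> b \<Longrightarrow> \<forall>c\<in>set cs. b \<le> c \<Longrightarrow> b ^ length cs \<le> (prod_list cs :: real)"
  by (induction cs) (auto intro!: mult_mono prod_list_nonneg simp: order_trans[of 0 1] order_trans[of 0 b])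

section \<open>Doeblin minorization and uniform contraction on bounded decreasing densities\<close>

definition unit_density :: "real \<Rightarrow> (real \<Rightarrow> real) \<Rightarrow> bool" where
  "unit_density M f \<longleftrightarrow> decreasing_density f \<and> mass f = 1 \<and> f 0 \<le> M"

text \<open>Any M with \<open>b / (b - 1) \<le> M\<close> satisfies
  \<open>M / b + 1 \<le> M\<close>, so the bound survives a transfer step. The extra 1 is the room
  needed to split off a constant and renormalise in \<open>unit_density_doeblin\<close>.\<close>

definition sup_bound :: "real \<Rightarrow> real" where
  "sup_bound b = b / (b - 1) + 1"

lemma unit_density_fold:
  assumes b: "b > 1" and cs: "\<forall>c\<in>set cs. b \<le> c" and f: "unit_density (sup_bound b) f"
  shows "unit_density (sup_bound b) (fold transfer cs f)"
  using cs f
proof (induction cs arbitrary: f)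
  case (Cons c cs)
  have c: "b \<le> c" "c > 0" and f: "decreasing_density f" "mass f = 1" "f 0 \<le> sup_bound b"
    using Cons.prems b by (auto simp: unit_density_def)
  have "transfer c f 0 \<le> f 0 / c + 1" using transfer_0_le_mass[OF c(2) f(1)] f by simp
  also have "\<dots> \<le> sup_bound b / b + 1"
    using f(3) b c decreasing_density_nonneg[OF f(1), of 0] by (intro add_right_mono frac_le) auto
  also have "\<dots> \<le> sup_bound b"
  proof -
    have "sup_bound b / b = 1 / (b - 1) + 1 / b" using b unfolding sup_bound_def by (simp add: add_divide_distrib)
    moreover have "sup_bound b = 1 / (b - 1) + 2" using b unfolding sup_bound_def by (simp add: field_simps)
    moreover have "1 / b \<le> 1" using b by simp
    ultimately show ?thesis by linarith
  qed
  finally have "unit_density (sup_bound b) (transfer c f)"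
    using f mass_fold_transfer[of "[c]" f] c transfer_decreasing_density[OF c(2) f(1)]
    by (simp add: unit_density_def)
  then show ?case using Cons by simp
qed simp

text \<open>If f(x) < 1/2, then f is at most M on [0,x) and at most 1/2 on [x,1), so its mass is at
  most Mx + (1 - x)/2 < 1.\<close>

lemma unit_density_ge_half:
  assumes f: "unit_density M f" and M: "M \<ge> 1" and x: "0 \<le> x" "x < 1 / (2 * M)"
  shows "1 / 2 \<le> f x"
proof (rule ccontr)
  assume less: "\<not> 1 / 2 \<le> f x"
  have d: "decreasing_density f" "mass f = 1" "f 0 \<le> M" using f by (auto simp: unit_density_def)
  have "1 / (2 * M) \<le> 1" using M by (simp add: field_simps)
  with x have x1: "x < 1" by simp
  have "mass f \<le> (\<integral>y. M * indicator {0..<x} y + 1 / 2 * indicator {x..<1} y \<partial>lborel)"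
    unfolding mass_def
  proof (intro integral_mono[OF decreasing_density_integrable[OF d(1)]])
    show "integrable lborel (\<lambda>y. M * indicator {0..<x} y + 1 / 2 * indicator {x..<1} y)"
    proof (rule Bochner_Integration.integrable_add)
      show "integrable lborel (\<lambda>y. M * indicator {0..<x} y)" using x by simp
      show "integrable lborel (\<lambda>y. 1 / 2 * indicator {x..<1} y :: real)"
        by (rule integrable_mult_right) (use x1 in simp)
    qed
    fix y show "f y \<le> M * indicator {0..<x} y + 1 / 2 * indicator {x..<1} y"
      using decreasing_densityD[OF d(1)] decreasing_density_le[OF d(1), of y] d(3) less x M
      by (auto simp: indicator_def) (smt (verit, best))+
  qed
  also have "\<dots> = M * x + 1 / 2 * (1 - x)" using x x1 by simp
  also have "\<dots> < 1" using x M by (simp add: field_simps)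
  finally show False using d by simp
qed

text \<open>The length condition acts twice. It stretches the interval on which f is at least 1/2
  over all of [0,1), and it pushes the value at 0 down to M - 1/2, where M is
  \<open>sup_bound b\<close>. The spare 1/2 pays for the division by \<open>1 - \<epsilon>\<close>:
  the factor M in the denominator of \<epsilon> ensures M\<epsilon> \<le> 1/2.\<close>

lemma unit_density_doeblin:
  assumes b: "b > 1" and cs: "\<forall>c\<in>set cs. b \<le> c" and f: "unit_density (sup_bound b) f"
    and len: "2 * sup_bound b \<le> b ^ length cs"
    and \<epsilon>: "\<epsilon> = 1 / (2 * sup_bound b * prod_list cs)"
  shows "\<exists>g. unit_density (sup_bound b) g \<and>
    fold transfer cs f = (\<lambda>x. (1 - \<epsilon>) * g x + \<epsilon> * indicator {0..<1} x)"
proof -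
  let ?M = "sup_bound b" and ?F = "fold transfer cs f"
  have M: "?M \<ge> 1" using b by (simp add: sup_bound_def)
  have P: "prod_list cs \<ge> b ^ length cs" using b cs by (intro prod_list_ge_power) auto
  have P2: "prod_list cs \<ge> 2 * ?M" using P len by simp
  have P1: "prod_list cs \<ge> 1" using P2 M by simp
  have f': "decreasing_density f" "mass f = 1" "f 0 \<le> ?M" using f by (auto simp: unit_density_def)
  have cs0: "\<forall>c\<in>set cs. c > 0" using cs b by auto
  have F: "decreasing_density ?F" "mass ?F = 1"
    using distr_fold_greedy[OF cs0 f'(1)] mass_fold_transfer[OF cs0 f'(1)] f'(2) by auto
  have e0: "\<epsilon> > 0" using \<epsilon> M P1 by simp
  have e1: "\<epsilon> \<le> 1 / (2 * ?M)" unfolding \<epsilon> using M P1 by (intro divide_left_mono) auto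
  have e2: "\<epsilon> \<le> (1 / 2) / prod_list cs" unfolding \<epsilon> using M P1 by (simp add: field_simps)
  have elt: "\<epsilon> \<le> 1 / 2" using e1 M by (smt (verit) frac_le)
  have low: "\<epsilon> \<le> ?F y" if y: "0 \<le> y" "y < 1" for y
  proof -
    have "1 / 2 / prod_list cs \<le> ?F y"
    proof (rule fold_transfer_lower[where s = "1 / (2 * ?M)"])
      show "\<forall>c\<in>set cs. 1 \<le> c" using cs b by auto
      have "y * (2 * ?M) < 1 * (2 * ?M)" using y M by (intro mult_strict_right_mono) auto
      then have "y * (2 * ?M) < prod_list cs" using P2 by simp
      then show "y < 1 / (2 * ?M) * prod_list cs" using M by (simp add: field_simps)
    qed (use f' y unit_density_ge_half[OF f M] in auto)
    with e2 show ?thesis by simp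
  qed
  define g where "g x = (?F x - \<epsilon> * indicator {0..<1} x) / (1 - \<epsilon>)" for x
  have gF: "?F = (\<lambda>x. (1 - \<epsilon>) * g x + \<epsilon> * indicator {0..<1} x)"
    using elt by (auto simp: g_def fun_eq_iff)
  have dg: "decreasing_density g"
    unfolding decreasing_density_def
  proof (intro conjI allI impI)
    fix x :: real assume "x < 0 \<or> 1 \<le> x" then show "g x = 0"
      using decreasing_densityD[OF F(1)] by (auto simp: g_def)
  next
    fix x y :: real assume xy: "0 \<le> x" "x \<le> y"
    show "g y \<le> g x"
    proof (cases "y < 1")
      case True
      then show ?thesis using xy elt decreasing_densityD(3)[OF F(1) xy]
        by (simp add: g_def divide_right_mono)
    next
      case False
      then have "g y = 0" using decreasing_densityD(2)[OF F(1), of y] by (simp add: g_def)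
      moreover have "0 \<le> g x" using low[of x] xy elt decreasing_density_nonneg[OF F(1)]
        by (auto simp: g_def indicator_def)
      ultimately show ?thesis by simp
    qed
  qed
  have "mass ?F = (1 - \<epsilon>) * mass g + \<epsilon>"
    unfolding mass_def by (subst gF) (simp add: decreasing_density_integrable[OF dg])
  then have "(1 - \<epsilon>) * mass g = (1 - \<epsilon>) * 1" using F by (simp add: algebra_simps)
  then have mg: "mass g = 1" using elt by (subst (asm) mult_left_cancel) auto
  have "?F 0 \<le> ?M / b ^ length cs + b / (b - 1)"
    using fold_transfer_0_le[OF b cs f'(1)] f' divide_right_mono[OF f'(3), of "b ^ length cs"] b by simp
  also have "?M / b ^ length cs \<le> 1 / 2" using len M b by (simp add: field_simps)
  finally have "?F 0 - \<epsilon> \<le> 1 / 2 + (?M - 1) - \<epsilon>" by (simp add: sup_bound_def)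
  also have "\<dots> \<le> ?M * (1 - \<epsilon>)" using e1 e0 M by (simp add: field_simps)
  finally have "g 0 \<le> ?M" using elt by (simp add: g_def field_simps)
  with dg mg gF show ?thesis by (auto simp: unit_density_def)
qed

lemma fold_concat_replicate: "fold f (concat (replicate n cs)) = fold f cs ^^ n"
  by (induction n) (auto simp: funpow_swap1 fun_eq_iff)

text \<open>The constant part split off from both densities is the same and cancels in the
  difference; what is left is \<open>1 - \<epsilon>\<close> times a difference of unit densities, to
  which the induction applies. Initially both functions take values between 0 and the bound.\<close>

lemma unit_density_contraction:
  assumes b: "b > 1" and cs: "\<forall>c\<in>set cs. b \<le> c"
    and len: "2 * sup_bound b \<le> b ^ length cs"
    and \<epsilon>: "\<epsilon> = 1 / (2 * sup_bound b * prod_list cs)"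
    and f: "unit_density (sup_bound b) f" and g: "unit_density (sup_bound b) g"
  shows "\<bar>(fold transfer cs ^^ n) f x - (fold transfer cs ^^ n) g x\<bar> \<le> (1 - \<epsilon>) ^ n * sup_bound b"
  using f g
proof (induction n arbitrary: f g)
  case 0
  have "0 \<le> f x" "f x \<le> sup_bound b" "0 \<le> g x" "g x \<le> sup_bound b"
    using 0 decreasing_density_le[of f x] decreasing_density_le[of g x]
    by (auto simp: unit_density_def decreasing_density_nonneg)
  then show ?case by simp
next
  case (Suc n)
  let ?Q = "fold transfer cs"
  have "prod_list cs \<ge> b ^ length cs" using b cs by (intro prod_list_ge_power) auto
  moreover have "sup_bound b \<ge> 1" using b by (simp add: sup_bound_def)
  ultimately have "2 * sup_bound b * prod_list cs \<ge> 1" using len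
    by (smt (verit, best) mult_le_cancel_left1 mult_mono)
  then have e1: "\<epsilon> \<le> 1" unfolding \<epsilon> by (subst divide_le_eq_1_pos) linarith+
  obtain f' where f': "unit_density (sup_bound b) f'" "?Q f = (\<lambda>x. (1 - \<epsilon>) * f' x + \<epsilon> * indicator {0..<1} x)"
    using unit_density_doeblin[OF b cs Suc.prems(1) len \<epsilon>] by blast
  obtain g' where g': "unit_density (sup_bound b) g'" "?Q g = (\<lambda>x. (1 - \<epsilon>) * g' x + \<epsilon> * indicator {0..<1} x)"
    using unit_density_doeblin[OF b cs Suc.prems(2) len \<epsilon>] by blast
  note lin = fold_transfer_linear[of "concat (replicate n cs)", unfolded fold_concat_replicate]
  have eq: "(?Q ^^ Suc n) f x - (?Q ^^ Suc n) g x = (1 - \<epsilon>) * ((?Q ^^ n) f' x - (?Q ^^ n) g' x)"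
    unfolding funpow_Suc_right o_apply f'(2) g'(2) lin by (simp add: algebra_simps)
  have "\<bar>(?Q ^^ Suc n) f x - (?Q ^^ Suc n) g x\<bar> = (1 - \<epsilon>) * \<bar>(?Q ^^ n) f' x - (?Q ^^ n) g' x\<bar>"
    unfolding eq using e1 by (simp add: abs_mult)
  also have "\<dots> \<le> (1 - \<epsilon>) * ((1 - \<epsilon>) ^ n * sup_bound b)"
    using e1 by (intro mult_left_mono Suc.IH f' g') auto
  finally show ?case by (simp add: mult.assoc)
qed

lemma transfer_tendsto:
  assumes "\<And>x. (\<lambda>n. u n x) \<longlonglongrightarrow> f x"
  shows "(\<lambda>n. fold transfer cs (u n) x) \<longlonglongrightarrow> fold transfer cs f x"
  using assms
proof (induction cs arbitrary: u f x)
  case (Cons c cs)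
  have "(\<lambda>n. transfer c (u n) x) \<longlonglongrightarrow> transfer c f x" for x
    unfolding transfer_def divide_inverse by (auto intro!: tendsto_intros Cons.prems)
  from Cons.IH[OF this] show ?case by simp
qed simp

text \<open>The density is the limit of iterates of the constant 1. Invariance is first obtained for
  a power of the operator, long enough for the minorization, and then for the operator
  itself.\<close>

lemma exists_invariant_density:
  assumes b: "b > 1" and cs: "\<forall>c\<in>set cs. b \<le> c" and ne: "cs \<noteq> []"
  obtains h \<epsilon> where "unit_density (sup_bound b) h" "fold transfer cs h = h"
    "\<epsilon> > 0" "\<And>x. 0 \<le> x \<Longrightarrow> x < 1 \<Longrightarrow> \<epsilon> \<le> h x"
    "\<And>f \<delta>. decreasing_density f \<Longrightarrow> mass f = 1 \<Longrightarrow> 0 < \<delta> \<Longrightarrow> \<exists>n. \<forall>x. \<bar>(fold transfer cs ^^ n) f x - h x\<bar> \<le> \<delta>"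
proof -
  let ?M = "sup_bound b" and ?Q = "fold transfer cs"
  have M: "?M \<ge> 1" using b by (simp add: sup_bound_def)
  \<comment> \<open>k repetitions of the list are long enough for
    \<open>unit_density_doeblin\<close>.\<close>
  obtain k where k: "2 * ?M < b ^ k" using real_arch_pow[OF b] by blast
  define ds where "ds = concat (replicate k cs)"
  have ds: "\<forall>c\<in>set ds. b \<le> c" using cs by (auto simp: ds_def)
  have "length ds = k * length cs" by (simp add: ds_def length_concat sum_list_replicate)
  then have "length ds \<ge> k" using ne by (cases cs) auto
  then have "b ^ k \<le> b ^ length ds" using b by (intro power_increasing) auto
  with k have len: "2 * ?M \<le> b ^ length ds" by simp
  define \<epsilon> where \<epsilon>: "\<epsilon> = 1 / (2 * ?M * prod_list ds)"
  have P: "prod_list ds \<ge> b ^ length ds" using b ds by (intro prod_list_ge_power) auto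
  have P1: "prod_list ds \<ge> 2" using P len M by simp
  have e: "\<epsilon> > 0" "\<epsilon> < 1"
  proof -
    show "\<epsilon> > 0" using \<epsilon> M P1 by simp
    have "1 * 2 \<le> (2 * ?M) * prod_list ds" using M P1 by (intro mult_mono) auto
    then show "\<epsilon> < 1" unfolding \<epsilon> by (subst divide_less_eq_1_pos) linarith+
  qed
  define R where "R = fold transfer ds"
  have RQ: "R = ?Q ^^ k" by (simp add: R_def ds_def fold_concat_replicate)
  note contr = unit_density_contraction[OF b ds len \<epsilon>, folded R_def]
  have Rn: "R ^^ n = fold transfer (concat (replicate n ds))" for n by (simp add: R_def fold_concat_replicate)
  have Runit: "unit_density ?M ((R ^^ n) f)" if "unit_density ?M f" for f n
    unfolding Rn using ds by (intro unit_density_fold[OF b] that) auto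
  define one where "one = (indicator {0..<1} :: real \<Rightarrow> real)"
  have one: "unit_density ?M one"
    unfolding unit_density_def one_def mass_def using decreasing_density_indicator[of 1] M by simp
  define u where "u n = (R ^^ n) one" for n
  have u: "unit_density ?M (u n)" for n unfolding u_def by (rule Runit[OF one])
  have ucauchy: "\<bar>u (n + m) x - u n x\<bar> \<le> (1 - \<epsilon>) ^ n * ?M" for n m x
    using contr[OF u[of m] one] by (simp add: u_def funpow_add)
  have pow0: "(\<lambda>n. (1 - \<epsilon>) ^ n * ?M) \<longlonglongrightarrow> 0"
    using e by (intro tendsto_mult_left_zero LIMSEQ_realpow_zero) auto
  have conv: "convergent (\<lambda>n. u n x)" for x
  proof (rule Cauchy_convergent, rule CauchyI')
    fix r :: real assume "0 < r"
    then obtain N where N: "\<forall>n\<ge>N. norm ((1 - \<epsilon>) ^ n * ?M - 0) < r" using LIMSEQ_D[OF pow0] by blast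
    show "\<exists>M. \<forall>m\<ge>M. \<forall>n>m. dist (u m x) (u n x) < r"
    proof (intro exI allI impI)
      fix m n assume "N \<le> m" "m < n"
      then have "\<bar>u n x - u m x\<bar> \<le> (1 - \<epsilon>) ^ m * ?M" using ucauchy[of m "n - m" x] by simp
      also have "\<dots> < r" using N \<open>N \<le> m\<close> by force
      finally show "dist (u m x) (u n x) < r" by (simp add: dist_real_def abs_minus_commute)
    qed
  qed
  define h where "h x = lim (\<lambda>n. u n x)" for x
  have uh: "(\<lambda>n. u n x) \<longlonglongrightarrow> h x" for x
    unfolding h_def using conv[of x] by (simp add: convergent_LIMSEQ_iff)
  have ud: "decreasing_density (u n)" "mass (u n) = 1" "u n 0 \<le> ?M" for n using u by (auto simp: unit_density_def)
  have hd: "decreasing_density h"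
    unfolding decreasing_density_def
  proof (intro conjI allI impI)
    fix x :: real assume "x < 0 \<or> 1 \<le> x"
    then have "u n x = 0" for n using decreasing_densityD[OF ud(1)] by auto
    with uh[of x] show "h x = 0" by (simp add: LIMSEQ_const_iff)
  next
    fix x y :: real assume "0 \<le> x" "x \<le> y"
    then show "h y \<le> h x" using uh decreasing_densityD(3)[OF ud(1)] by (intro LIMSEQ_le[OF uh uh]) auto
  qed
  have bound: "\<bar>u n x\<bar> \<le> ?M * indicator {0..1} x" for n x
    using decreasing_density_le[OF ud(1), of n x] ud(3)[of n] decreasing_density_nonneg[OF ud(1), of n x]
      decreasing_densityD(1,2)[OF ud(1), of x n]
    by (auto simp: indicator_def not_le)
  have "(\<lambda>n. mass (u n)) \<longlonglongrightarrow> mass h"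
    unfolding mass_def
  proof (rule integral_dominated_convergence)
    show "integrable lborel (\<lambda>x. ?M * indicator {0..1::real} x)" by simp
  qed (use bound uh decreasing_density_measurable[OF hd] decreasing_density_measurable[OF ud(1)] in auto)
  then have hm: "mass h = 1" using ud(2) by (simp add: LIMSEQ_const_iff)
  have h0: "h 0 \<le> ?M" using uh[of 0] ud(3) by (intro LIMSEQ_le_const2[OF uh]) auto
  have hu: "unit_density ?M h" using hd hm h0 by (simp add: unit_density_def)
  have Rh: "R h = h"
  proof
    fix x
    have "(\<lambda>n. R (u n) x) \<longlonglongrightarrow> R h x" unfolding R_def by (rule transfer_tendsto) (rule uh)
    moreover have "(\<lambda>n. R (u n) x) \<longlonglongrightarrow> h x" using LIMSEQ_Suc[OF uh[of x]] by (simp add: u_def)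
    ultimately show "R h x = h x" by (rule LIMSEQ_unique)
  qed
  have Rnh: "(R ^^ n) h = h" for n by (induction n) (auto simp: Rh)
  \<comment> \<open>R is a power of the operator and commutes with it, so the image of h is again a
    unit density fixed by R; contraction leaves room for only one.\<close>
  have Qh: "?Q h = h"
  proof
    fix x
    have RnQ: "(R ^^ n) (?Q h) = ?Q h" for n
    proof (induction n)
      case (Suc n)
      have "R (?Q h) = ?Q (R h)" unfolding RQ by (metis funpow_swap1)
      with Suc Rh show ?case by simp
    qed simp
    have "unit_density ?M (?Q h)" using unit_density_fold[OF b cs hu] .
    from contr[OF this hu] have "\<bar>?Q h x - h x\<bar> \<le> (1 - \<epsilon>) ^ n * ?M" for n by (simp add: RnQ Rnh)
    then have "\<bar>?Q h x - h x\<bar> \<le> 0" by (intro LIMSEQ_le_const[OF pow0]) auto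
    then show "?Q h x = h x" by simp
  qed
  have hlow: "\<epsilon> \<le> h x" if x: "0 \<le> x" "x < 1" for x
  proof -
    obtain g where g: "unit_density ?M g" "R h = (\<lambda>x. (1 - \<epsilon>) * g x + \<epsilon> * indicator {0..<1} x)"
      using unit_density_doeblin[OF b ds hu len \<epsilon>] unfolding R_def by blast
    have "0 \<le> g x" using g(1) by (auto simp: unit_density_def decreasing_density_nonneg)
    moreover have "h x = (1 - \<epsilon>) * g x + \<epsilon>" using g(2) x fun_cong[OF Rh, of x] by simp
    ultimately show ?thesis using e by simp
  qed
  have "\<exists>n. \<forall>x. \<bar>(?Q ^^ n) f x - h x\<bar> \<le> \<delta>" if f: "decreasing_density f" "mass f = 1" and d: "0 < \<delta>" for f \<delta>
  proof -
    \<comment> \<open>The peak f(0) may be arbitrarily high; j rounds of the list bring its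
      contribution below 1, and the image is then a unit density.\<close>
    obtain j where j: "f 0 < b ^ j" using real_arch_pow[OF b] by blast
    define es where "es = concat (replicate j cs)"
    have es: "\<forall>c\<in>set es. b \<le> c" using cs by (auto simp: es_def)
    then have es0: "\<forall>c\<in>set es. c > 0" using b by force
    have "length es = j * length cs" by (simp add: es_def length_concat sum_list_replicate)
    then have "length es \<ge> j" using ne by (cases cs) auto
    then have "b ^ j \<le> b ^ length es" using b by (intro power_increasing) auto
    with j have j': "f 0 \<le> b ^ length es" by simp
    have "fold transfer es f 0 \<le> f 0 / b ^ length es + 1 * (b / (b - 1))"
      using fold_transfer_0_le[OF b es f(1)] f by simp
    also have "f 0 / b ^ length es \<le> 1" using j' b by (subst divide_le_eq_1_pos) auto
    also have "1 + 1 * (b / (b - 1)) = ?M" by (simp add: sup_bound_def)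
    finally have "unit_density ?M (fold transfer es f)"
      unfolding unit_density_def using distr_fold_greedy[OF es0 f(1)] mass_fold_transfer[OF es0 f(1)] f(2) by auto
    note c = contr[OF this hu, unfolded Rnh]
    obtain N where "\<forall>n\<ge>N. norm ((1 - \<epsilon>) ^ n * ?M - 0) < \<delta>" using LIMSEQ_D[OF pow0 d] by blast
    then have "(1 - \<epsilon>) ^ N * ?M < \<delta>" by force
    then have "\<bar>(R ^^ N) (fold transfer es f) x - h x\<bar> \<le> \<delta>" for x using c[of N x] by simp
    moreover have "(R ^^ N) (fold transfer es f) = (?Q ^^ (k * N + j)) f"
      by (simp add: RQ es_def fold_concat_replicate funpow_mult funpow_add)
    ultimately show ?thesis by metis
  qed
  with that hu Qh e hlow show thesis by blast
qed

section \<open>Ergodicity and uniqueness\<close>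

text \<open>The set that decides uniqueness in \<open>ac_invariant_unique\<close> is invariant only
  up to null sets, so \<open>ergodic\<close>, which tests strictly invariant sets, would be too weak
  there.\<close>

definition ae_ergodic :: "'a measure \<Rightarrow> ('a \<Rightarrow> 'a) \<Rightarrow> bool" where
  "ae_ergodic M T \<longleftrightarrow> (\<forall>B\<in>sets M. (AE x in M. T x \<in> B \<longleftrightarrow> x \<in> B) \<longrightarrow> measure M B \<in> {0, 1})"

lemma AE_distr_iff_preserving:
  assumes "invariant_measure M T" "{x \<in> space M. P x} \<in> sets M"
  shows "(AE x in M. P (T x)) \<longleftrightarrow> (AE x in M. P x)"
proof -
  have "T \<in> measurable M M" and d: "distr M M T = M" using assms by (auto simp: invariant_measure_def)
  from AE_distr_iff[OF this(1) assms(2)] show ?thesis unfolding d ..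
qed

lemma ergodic_if_ae_ergodic:
  assumes "prob_space M" "invariant_measure M T" "ae_ergodic M T"
  shows "ergodic M T"
proof -
  have "measure M B \<in> {0, 1}" if B: "B \<in> sets M" "T -` B \<inter> space M = B" for B
  proof -
    have "AE x in M. T x \<in> B \<longleftrightarrow> x \<in> B" using B(2) by (intro AE_I2) blast
    with B(1) assms(3) show ?thesis unfolding ae_ergodic_def by blast
  qed
  with assms show ?thesis unfolding ergodic_def by blast
qed

text \<open>M(E) is finite and cancels, so the integral of g - 1 over E vanishes although the
  integrand is positive on E.\<close>

lemma null_set_if_density_gt_1:
  assumes M: "finite_measure M" and [measurable]: "g \<in> borel_measurable M" and E [measurable]: "E \<in> sets M"
    and g: "\<And>x. x \<in> E \<Longrightarrow> 1 < g x" and le: "(\<integral>\<^sup>+x. g x * indicator E x \<partial>M) \<le> emeasure M E"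
  shows "E \<in> null_sets M"
proof -
  interpret finite_measure M by fact
  have "(\<integral>\<^sup>+x. g x * indicator E x \<partial>M) = (\<integral>\<^sup>+x. indicator E x + (g x - 1) * indicator E x \<partial>M)"
    using g by (intro nn_integral_cong) (auto simp: indicator_def add_diff_eq_ennreal less_imp_le)
  also have "\<dots> = emeasure M E + (\<integral>\<^sup>+x. (g x - 1) * indicator E x \<partial>M)"
    by (subst nn_integral_add) auto
  finally have "emeasure M E + (\<integral>\<^sup>+x. (g x - 1) * indicator E x \<partial>M) \<le> emeasure M E + 0" using le by simp
  then have "(\<integral>\<^sup>+x. (g x - 1) * indicator E x \<partial>M) = 0"
    by (subst (asm) ennreal_add_left_cancel_le) auto
  then have "AE x in M. (g x - 1) * indicator E x = 0" by (subst (asm) nn_integral_0_iff_AE) auto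
  then have "AE x in M. x \<notin> E"
  proof eventually_elim
    case (elim x)
    show ?case
    proof
      assume x: "x \<in> E"
      then have "g x - 1 = 0" using elim by simp
      with g[OF x] show False by (simp add: diff_eq_0_iff_ennreal not_le[symmetric])
    qed
  qed
  then show ?thesis using E by (auto simp: AE_iff_null_sets)
qed

text \<open>The set where the density of the competing measure exceeds \<open>1\<close> is invariant up to null sets:
  its part leaving under \<open>T\<close> and its part entering have equal size for both measures.\<close>

lemma ac_invariant_unique:
  assumes M: "prob_space M" "invariant_measure M T" "ae_ergodic M T"
    and N: "prob_space N" "sets N = sets M" "absolutely_continuous M N" "invariant_measure N T"
  shows "N = M"
proof -
  interpret M: prob_space M by fact
  interpret N: prob_space N by fact
  define g where "g = RN_deriv M N"
  have g [measurable]: "g \<in> borel_measurable M" by (simp add: g_def)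
  have Ng: "density M g = N" unfolding g_def by (intro M.density_RN_deriv N)
  have Nem: "emeasure N E = (\<integral>\<^sup>+x. g x * indicator E x \<partial>M)" if "E \<in> sets M" for E
    using that by (subst Ng[symmetric]) (simp add: emeasure_density)
  have T [measurable]: "T \<in> measurable M M" and dM: "distr M M T = M" and dN: "distr N N T = N"
    and TN: "T \<in> measurable N N"
    using M N by (auto simp: invariant_measure_def)
  have sp: "space N = space M" using N(2) by (rule sets_eq_imp_space_eq)
  define C where "C = {x\<in>space M. 1 < g x}"
  have C [measurable]: "C \<in> sets M" unfolding C_def by measurable
  define D where "D = T -` C \<inter> space M"
  have D [measurable]: "D \<in> sets M" unfolding D_def by measurable
  have Mpres: "emeasure M D = emeasure M C" unfolding D_def using emeasure_distr[OF T C] dM by simp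
  have Npres: "emeasure N D = emeasure N C" unfolding D_def
    using emeasure_distr[OF TN, of C] dN C N(2) sp by simp
  have split: "emeasure K (C - D) = emeasure K (D - C)"
    if K: "finite_measure K" "sets K = sets M" "emeasure K D = emeasure K C" for K
  proof -
    interpret K: finite_measure K by fact
    have "emeasure K (C - D) + emeasure K (C \<inter> D) = emeasure K C"
      using K(1,2) C D by (subst plus_emeasure) (auto intro!: arg_cong[where f = "emeasure K"])
    moreover have "emeasure K (D - C) + emeasure K (C \<inter> D) = emeasure K D"
      using K(1,2) C D by (subst plus_emeasure) (auto intro!: arg_cong[where f = "emeasure K"])
    ultimately have "emeasure K (C \<inter> D) + emeasure K (C - D) = emeasure K (C \<inter> D) + emeasure K (D - C)"
      using K(3) by (simp add: add.commute)
    then show ?thesis by (subst (asm) ennreal_add_left_cancel) auto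
  qed
  have eM: "emeasure M (C - D) = emeasure M (D - C)"
    by (rule split) (use Mpres in \<open>auto intro: M.finite_measure_axioms\<close>)
  have eN: "emeasure N (C - D) = emeasure N (D - C)"
    by (rule split) (use Npres N in \<open>auto intro: N.finite_measure_axioms\<close>)
  \<comment> \<open>Outside C the density is at most 1. With the two equalities this bounds N(C - D)
    by M(C - D), although the density exceeds 1 on C - D; hence that set is null.\<close>
  have "emeasure N (D - C) \<le> emeasure M (D - C)"
  proof -
    have "emeasure N (D - C) \<le> (\<integral>\<^sup>+x. indicator (D - C) x \<partial>M)"
      unfolding Nem[OF sets.Diff[OF D C]]
      by (intro nn_integral_mono) (auto simp: indicator_def C_def D_def not_less)
    then show ?thesis by simp
  qed
  then have "C - D \<in> null_sets M"
    unfolding eM[symmetric] eN[symmetric]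
    by (intro null_set_if_density_gt_1[of M g]) (auto simp: Nem[symmetric] M.finite_measure_axioms, auto simp: C_def)
  moreover from this have "D - C \<in> null_sets M" using eM by (auto simp: null_sets_def)
  ultimately have "AE x in M. x \<notin> C - D" "AE x in M. x \<notin> D - C" by (auto simp only: AE_not_in)
  then have "AE x in M. T x \<in> C \<longleftrightarrow> x \<in> C"
    using AE_space by eventually_elim (auto simp: D_def)
  then have "measure M C \<in> {0, 1}" using M(3) C unfolding ae_ergodic_def by blast
  moreover have "measure M C \<noteq> 1"
  proof
    assume 1: "measure M C = 1"
    have "emeasure N C \<le> emeasure M C" using N.emeasure_le_1[of C] 1 by (simp add: M.emeasure_eq_measure)
    then have "C \<in> null_sets M"
      by (intro null_set_if_density_gt_1[of M g]) (auto simp: Nem[symmetric] C_def M.finite_measure_axioms)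
    with 1 show False by (simp add: null_sets_def measure_def)
  qed
  ultimately have "C \<in> null_sets M" by (auto simp: M.emeasure_eq_measure null_sets_def)
  then have "AE x in M. x \<notin> C" by (rule AE_not_in)
  then have g1: "AE x in M. g x \<le> 1" using AE_space by eventually_elim (auto simp: C_def not_less)
  have int: "(\<integral>\<^sup>+x. g x \<partial>M) = 1"
  proof -
    have "1 = (\<integral>\<^sup>+x. g x * indicator (space M) x \<partial>M)" using N.emeasure_space_1 sp Nem[of "space M"] by simp
    also have "\<dots> = (\<integral>\<^sup>+x. g x \<partial>M)" by (intro nn_integral_cong) auto
    finally show ?thesis by simp
  qed
  \<comment> \<open>The density is at most 1 almost everywhere and has integral 1, so it equals
    1.\<close>
  have "(\<integral>\<^sup>+x. 1 - g x \<partial>M) = (\<integral>\<^sup>+x. 1 \<partial>M) - (\<integral>\<^sup>+x. g x \<partial>M)"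
    using int g1 by (intro nn_integral_diff) auto
  then have "(\<integral>\<^sup>+x. 1 - g x \<partial>M) = 0" using int by (simp add: M.emeasure_space_1)
  then have "AE x in M. 1 - g x = 0" by (subst (asm) nn_integral_0_iff_AE) auto
  with g1 have "AE x in M. g x = 1"
    by eventually_elim (auto simp: diff_eq_0_iff_ennreal)
  then have "density M g = density M (\<lambda>_. 1)" by (intro density_cong) auto
  then show ?thesis using Ng by (simp add: density_1)
qed

text \<open>The hypothesis says that Lebesgue measure restricted to B and m times Lebesgue measure
  on [0,1) agree on half-lines. They then agree on all Borel sets, in particular on B
  itself.\<close>

lemma lebesgue01_initial_segments:
  assumes B: "B \<in> sets lebesgue01" and m: "0 \<le> m" "m \<le> 1"
    and seg: "\<And>t. 0 < t \<Longrightarrow> t \<le> 1 \<Longrightarrow> measure lborel (B \<inter> {0..<t}) = t * m"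
  shows "measure lborel B \<in> {0, 1} \<and> m = measure lborel B"
proof -
  have [measurable]: "B \<in> sets borel" and B1: "B \<subseteq> {0..<1}" using B by (auto simp: sets_lebesgue01_iff)
  have fin: "emeasure lborel (B \<inter> X) < \<infinity>" for X
  proof -
    have "emeasure lborel (B \<inter> X) \<le> emeasure lborel {0..<1::real}" using B1 by (intro emeasure_mono) auto
    also have "\<dots> < \<infinity>" by simp
    finally show ?thesis .
  qed
  have fin1: "emeasure lborel ({0..<1::real} \<inter> X) < \<infinity>" for X
  proof -
    have "emeasure lborel ({0..<1} \<inter> X) \<le> emeasure lborel {0..<1::real}" by (intro emeasure_mono) auto
    also have "\<dots> < \<infinity>" by simp
    finally show ?thesis .
  qed
  have Bm: "measure lborel B = m" using seg[of 1] B1 by (simp add: Int_absorb2)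
  let ?N1 = "density lborel (indicator B)"
  let ?N2 = "density lborel (\<lambda>x. ennreal m * indicator {0..<1::real} x)"
  have e1: "emeasure ?N1 X = emeasure lborel (B \<inter> X)" if "X \<in> sets borel" for X
    using that by (simp add: emeasure_density indicator_inter_arith[symmetric])
  have e2: "emeasure ?N2 X = ennreal m * emeasure lborel ({0..<1} \<inter> X)" if "X \<in> sets borel" for X
    using that by (simp add: emeasure_density nn_integral_cmult indicator_inter_arith[symmetric] mult.assoc)
  have "?N1 = ?N2"
  proof (rule measure_eqI_lessThan)
    fix x :: real
    show "emeasure ?N1 {x<..} < \<infinity>" using e1 fin by simp
    consider "x < 0" | "0 \<le> x" "x < 1" | "1 \<le> x" by linarith
    then have "measure lborel (B \<inter> {x<..}) = m * measure lborel ({0..<1} \<inter> {x<..})"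
    proof cases
      case 1
      then have "B \<inter> {x<..} = B" "{0..<1} \<inter> {x<..} = {0..<1}" using B1 by auto
      then show ?thesis using Bm by simp
    next
      case 2
      have "measure lborel (B \<inter> {x<..}) = measure lborel B - measure lborel (B \<inter> {0..<x})"
      proof -
        have "measure lborel B = measure lborel (B \<inter> {0..<x}) + measure lborel (B \<inter> {x..})"
          using B1 2 fin[THEN less_imp_neq] by (subst measure_Union[symmetric]) (auto intro!: arg_cong[where f = "measure lborel"])
        moreover have "measure lborel (B \<inter> {x..}) = measure lborel (B \<inter> {x<..})"
        proof (rule measure_eq_AE)
          show "AE y in lborel. (y \<in> B \<inter> {x..}) = (y \<in> B \<inter> {x<..})"
            using AE_lborel_singleton[of x] by eventually_elim auto
        qed auto
        ultimately show ?thesis by simp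
      qed
      also have "\<dots> = m - x * m" using Bm seg[of x] 2 by (cases "x = 0") auto
      also have "{0..<1} \<inter> {x<..} = {x<..<1}" using 2 by auto
      then have "m - x * m = m * measure lborel ({0..<1} \<inter> {x<..})" using 2 by (simp add: algebra_simps)
      finally show ?thesis .
    next
      case 3
      then have "B \<inter> {x<..} = {}" "{0..<1} \<inter> {x<..} = {}" using B1 by auto
      then show ?thesis by simp
    qed
    moreover have "emeasure lborel (B \<inter> {x<..}) = ennreal (measure lborel (B \<inter> {x<..}))"
      "emeasure lborel ({0..<1} \<inter> {x<..}) = ennreal (measure lborel ({0..<1} \<inter> {x<..}))"
      using fin[of "{x<..}"] fin1[of "{x<..}"] by (auto simp: emeasure_eq_ennreal_measure)
    ultimately show "emeasure ?N1 {x<..} = emeasure ?N2 {x<..}"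
      using m by (simp add: e1 e2 ennreal_mult)
  qed auto
  \<comment> \<open>Evaluation at B turns proportionality into m = m * m.\<close>
  then have eq: "emeasure lborel (B \<inter> B) = ennreal m * emeasure lborel ({0..<1} \<inter> B)"
    using e1[of B] e2[of B] by simp
  have "{0..<1} \<inter> B = B" using B1 by auto
  with eq have "ennreal m = ennreal (m * m)"
    using fin[of UNIV] Bm m by (simp add: emeasure_eq_ennreal_measure less_top ennreal_mult)
  then have "m = m * m" using m by simp
  then have "m = 0 \<or> m = 1" by auto
  with Bm show ?thesis by auto
qed

locale expanding_composition =
  fixes cs :: "real list" and b :: real
  assumes b: "b > 1" and cs: "\<forall>c\<in>set cs. b \<le> c" and ne: "cs \<noteq> []"
begin

lemma cs_pos: "\<forall>c\<in>set cs. c > 0" using cs b by force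

lemma iterate_pos: "\<forall>c\<in>set (concat (replicate n cs)). c > 0" using cs_pos by auto

lemma acip_facts:
  obtains h \<epsilon> where "decreasing_density h" "h 0 \<le> sup_bound b" "\<epsilon> > 0" "\<And>x. 0 \<le> x \<Longrightarrow> x < 1 \<Longrightarrow> \<epsilon> \<le> h x"
    "prob_space (density lebesgue01 (\<lambda>x. ennreal (h x)))"
    "invariant_measure (density lebesgue01 (\<lambda>x. ennreal (h x))) (fold greedy_map cs)"
    "ae_ergodic (density lebesgue01 (\<lambda>x. ennreal (h x))) (fold greedy_map cs)"
proof -
  let ?S = "fold greedy_map cs" and ?Q = "fold transfer cs"
  let ?D = "\<lambda>f. density lebesgue01 (\<lambda>x. ennreal (f x))"
  obtain h \<epsilon> where h: "unit_density (sup_bound b) h" "?Q h = h"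
    and e: "\<epsilon> > 0" "\<And>x. 0 \<le> x \<Longrightarrow> x < 1 \<Longrightarrow> \<epsilon> \<le> h x"
    and conv: "\<And>f \<delta>. decreasing_density f \<Longrightarrow> mass f = 1 \<Longrightarrow> 0 < \<delta> \<Longrightarrow> \<exists>n. \<forall>x. \<bar>(?Q ^^ n) f x - h x\<bar> \<le> \<delta>"
    by (rule exists_invariant_density[OF b cs ne]) blast
  have hd: "decreasing_density h" "mass h = 1" "h 0 \<le> sup_bound b" using h by (auto simp: unit_density_def)
  note hD = distr_fold_greedy[OF cs_pos hd(1)]
  have S: "?S \<in> measurable lebesgue01 lebesgue01" using hD by simp
  have prob: "prob_space (?D f)" if "decreasing_density f" "mass f = 1" for f
    using that by (intro prob_spaceI) (simp add: emeasure_density_mass)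
  interpret mu: prob_space "?D h" by (intro prob hd)
  have inv: "invariant_measure (?D h) ?S"
    unfolding invariant_measure_def
  proof
    show "?S \<in> measurable (?D h) (?D h)" using S by simp
    have "distr (?D h) (?D h) ?S = distr (?D h) lebesgue01 ?S" by (rule distr_cong) auto
    also have "\<dots> = ?D h" using hD h(2) by simp
    finally show "distr (?D h) (?D h) ?S = ?D h" .
  qed
  have real: "measure (?D f) B = (\<integral>x. f x * indicator B x \<partial>lborel)"
    if f: "decreasing_density f" and B: "B \<in> sets lebesgue01" for f B
  proof -
    have [measurable]: "B \<in> sets borel" "f \<in> borel_measurable borel"
      using B f by (auto simp: sets_lebesgue01_iff decreasing_density_measurable)
    have "emeasure (?D f) B = (\<integral>\<^sup>+x. ennreal (f x * indicator B x) \<partial>lborel)"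
      unfolding emeasure_density_lebesgue01[OF \<open>f \<in> borel_measurable borel\<close> B]
      by (intro nn_integral_cong) (auto simp: indicator_def)
    also have "\<dots> = ennreal (\<integral>x. f x * indicator B x \<partial>lborel)"
      using f decreasing_density_nonneg[OF f]
      by (intro nn_integral_eq_integral integrable_real_mult_indicator decreasing_density_integrable) auto
    finally show ?thesis
      using decreasing_density_nonneg[OF f] by (simp add: measure_def integral_nonneg)
  qed
  have "ae_ergodic (?D h) ?S"
    unfolding ae_ergodic_def
  proof (intro ballI impI)
    fix B assume "B \<in> sets (?D h)" and ae: "AE x in ?D h. (?S x \<in> B) = (x \<in> B)"
    then have B: "B \<in> sets lebesgue01" by simp
    then have [measurable]: "B \<in> sets borel" and B1: "B \<subseteq> {0..<1}" by (auto simp: sets_lebesgue01_iff)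
    have S' [measurable]: "?S \<in> measurable (?D h) (?D h)" using S by simp
    have Bh [measurable]: "B \<in> sets (?D h)" using B by simp
    \<comment> \<open>The statement for n also holds almost everywhere at the image point, since the
      measure is invariant.\<close>
    have aen: "AE x in ?D h. ((?S ^^ n) x \<in> B) = (x \<in> B)" for n
    proof (induction n)
      case (Suc n)
      have m [measurable]: "?S ^^ n \<in> measurable (?D h) (?D h)" by (rule measurable_compose_n) (rule S')
      have "AE x in ?D h. ((?S ^^ n) (?S x) \<in> B) = (?S x \<in> B)"
        by (subst AE_distr_iff_preserving[OF inv, where P = "\<lambda>x. ((?S ^^ n) x \<in> B) = (x \<in> B)"])
          (measurable, rule Suc.IH)
      with ae show ?case by eventually_elim (simp add: funpow_swap1)
    qed simp
    \<comment> \<open>The positive lower bound of h turns null sets of the invariant measure into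
      Lebesgue null sets, so that the statement can be used for measures with other
      densities.\<close>
    have aen1: "AE x in lebesgue01. ((?S ^^ n) x \<in> B) = (x \<in> B)" for n
    proof -
      have "AE x in lebesgue01. ennreal (h x) > 0 \<longrightarrow> ((?S ^^ n) x \<in> B) = (x \<in> B)"
        using aen[of n] by (subst (asm) AE_density)
          (use decreasing_density_measurable[OF hd(1)] in \<open>auto intro!: borel_measurable_lebesgue01\<close>)
      then show ?thesis using AE_space
      proof eventually_elim
        case (elim x)
        then show ?case using e(1) e(2)[of x] by (auto simp: zero_less_iff_neq_zero ennreal_eq_0_iff)
      qed
    qed
    have seg: "measure lborel (B \<inter> {0..<t}) = t * measure (?D h) B" if t: "0 < t" "t \<le> 1" for t
    proof -
      define f where "f x = 1 / t * indicator {0..<t} x" for x :: real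
      have f: "decreasing_density f" unfolding decreasing_density_def f_def using t by (auto simp: indicator_def)
      have fm: "mass f = 1" unfolding mass_def f_def using t by simp
      have ft: "measure (?D f) B = measure lborel (B \<inter> {0..<t}) / t"
      proof -
        have "measure (?D f) B = (\<integral>x. 1 / t * indicator (B \<inter> {0..<t}) x \<partial>lborel)"
          unfolding real[OF f B] by (intro Bochner_Integration.integral_cong) (auto simp: indicator_def f_def)
        then show ?thesis by simp
      qed
      have "\<bar>measure (?D f) B - measure (?D h) B\<bar> \<le> \<delta>" if d: "0 < \<delta>" for \<delta>
      proof -
        obtain n where n: "\<And>x. \<bar>(?Q ^^ n) f x - h x\<bar> \<le> \<delta>" using conv[OF f fm d] by blast
        let ?fn = "(?Q ^^ n) f"
        have fn: "decreasing_density ?fn" "distr (?D f) lebesgue01 (?S ^^ n) = ?D ?fn" "?S ^^ n \<in> measurable lebesgue01 lebesgue01"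
          using distr_fold_greedy[OF iterate_pos f, of n] by (auto simp: fold_concat_replicate)
        have Sn: "?S ^^ n \<in> measurable (?D f) lebesgue01" using fn(3) by simp
        have "emeasure (?D ?fn) B = emeasure (?D f) ((?S ^^ n) -` B \<inter> space (?D f))"
          unfolding fn(2)[symmetric] using Sn B by (rule emeasure_distr)
        \<comment> \<open>B and its n-th preimage differ by a Lebesgue null set. So the mass that f
          gives to B equals the mass that its n-th iterate gives to B, for every n.\<close>
        also have "\<dots> = emeasure (?D f) B"
        proof (rule emeasure_eq_AE)
          have "AE x in ?D f. ((?S ^^ n) x \<in> B) = (x \<in> B)"
            by (rule AE_density[THEN iffD2]) (use aen1[of n] decreasing_density_measurable[OF f] in \<open>auto intro!: borel_measurable_lebesgue01\<close>)
          then show "AE x in ?D f. (x \<in> (?S ^^ n) -` B \<inter> space (?D f)) = (x \<in> B)"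
            using AE_space by eventually_elim auto
        qed (use B measurable_sets[OF Sn B] in auto)
        finally have "measure (?D f) B = (\<integral>x. ?fn x * indicator B x \<partial>lborel)"
          unfolding real[OF fn(1) B, symmetric] by (simp add: measure_def)
        then have "measure (?D f) B - measure (?D h) B = (\<integral>x. ?fn x * indicator B x - h x * indicator B x \<partial>lborel)"
          unfolding real[OF hd(1) B]
          by (simp add: Bochner_Integration.integral_diff integrable_real_mult_indicator decreasing_density_integrable fn(1) hd(1))
        also have "\<bar>\<dots>\<bar> \<le> (\<integral>x. \<delta> * indicator {0..<1::real} x \<partial>lborel)"
        proof -
          have int: "integrable lborel (\<lambda>x. ?fn x * indicator B x - h x * indicator B x)"
            by (intro Bochner_Integration.integrable_diff integrable_real_mult_indicator decreasing_density_integrable fn(1) hd(1)) auto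
          have "\<bar>\<integral>x. ?fn x * indicator B x - h x * indicator B x \<partial>lborel\<bar>
              \<le> (\<integral>x. \<bar>?fn x * indicator B x - h x * indicator B x\<bar> \<partial>lborel)"
            by (rule integral_abs_bound)
          also have "\<dots> \<le> (\<integral>x. \<delta> * indicator {0..<1::real} x \<partial>lborel)"
          proof (rule integral_mono)
            show "integrable lborel (\<lambda>x. \<bar>?fn x * indicator B x - h x * indicator B x\<bar>)" using int by simp
            show "integrable lborel (\<lambda>x. \<delta> * indicator {0..<1::real} x)" by simp
            fix x show "\<bar>?fn x * indicator B x - h x * indicator B x\<bar> \<le> \<delta> * indicator {0..<1} x"
              using n[of x] B1 d by (auto simp: indicator_def)
          qed
          finally show ?thesis .
        qed
        finally show ?thesis by simp
      qed
      then have "\<bar>measure (?D f) B - measure (?D h) B\<bar> \<le> 0" by (rule field_le_epsilon) auto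
      then show ?thesis unfolding ft using t by (simp add: field_simps)
    qed
    have "measure lborel B \<in> {0, 1} \<and> measure (?D h) B = measure lborel B"
      by (rule lebesgue01_initial_segments[OF B _ _ seg]) (auto simp: mu.prob_le_1)
    then show "measure (?D h) B \<in> {0, 1}" by auto
  qed
  with that hd e inv mu.prob_space_axioms show thesis by blast
qed

end

lemma density_lebesgue01_null_sets:
  assumes h: "h \<in> borel_measurable borel" and pos: "\<And>x. 0 \<le> x \<Longrightarrow> x < 1 \<Longrightarrow> 0 < h x"
  shows "null_sets (density lebesgue01 (\<lambda>x. ennreal (h x))) = null_sets lebesgue01"
proof -
  have "A \<in> null_sets (density lebesgue01 (\<lambda>x. ennreal (h x))) \<longleftrightarrow> A \<in> null_sets lebesgue01" for A
  proof -
    have "A \<in> null_sets (density lebesgue01 (\<lambda>x. ennreal (h x))) \<longleftrightarrow>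
        A \<in> sets lebesgue01 \<and> (AE x in lebesgue01. x \<in> A \<longrightarrow> ennreal (h x) = 0)"
      using h by (intro null_sets_density_iff) (auto intro: borel_measurable_lebesgue01)
    also have "\<dots> \<longleftrightarrow> A \<in> sets lebesgue01 \<and> (AE x in lebesgue01. x \<notin> A)"
      using pos by (intro conj_cong refl AE_cong) (auto simp: ennreal_eq_0_iff not_le not_less[symmetric])
    also have "\<dots> \<longleftrightarrow> A \<in> null_sets lebesgue01"
      using AE_iff_null_sets[of A lebesgue01] by (auto dest: null_setsD2)
    finally show ?thesis .
  qed
  then show ?thesis by blast
qed

section \<open>Entropy of systems with a generating code\<close>

text \<open>Fekete's lemma; nonnegativity keeps the infimum of the quotients finite.\<close>

lemma subadditive_convergent:
  fixes a :: "nat \<Rightarrow> real"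
  assumes sub: "\<And>m n. a (m + n) \<le> a m + a n" and nonneg: "\<And>n. 0 \<le> a n"
  shows "convergent (\<lambda>n. a n / real n)"
proof -
  define l where "l = Inf ((\<lambda>n. a n / real n) ` {1..})"
  have bdd: "bdd_below ((\<lambda>n. a n / real n) ` {1..})"
    by (rule bdd_belowI[of _ 0]) (auto simp: nonneg)
  have low: "l \<le> a n / real n" if "n \<ge> 1" for n
    unfolding l_def using that by (intro cInf_lower bdd) auto
  have mult: "a (q * m + r) \<le> real q * a m + a r" for q m r
  proof (induction q)
    case (Suc q)
    have "a (Suc q * m + r) \<le> a m + a (q * m + r)" using sub[of m "q * m + r"] by (simp add: algebra_simps)
    with Suc show ?case by (simp add: algebra_simps)
  qed simp
  have "(\<lambda>n. a n / real n) \<longlonglongrightarrow> l"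
  proof (rule LIMSEQ_I)
    fix r :: real assume r: "0 < r"
    have "l < l + r / 2" using r by simp
    then obtain y where y: "y \<in> (\<lambda>n. a n / real n) ` {1..}" "y < l + r / 2"
      unfolding l_def using cInf_lessD[of "(\<lambda>n. a n / real n) ` {1..}"] by blast
    then obtain m where m: "m \<ge> 1" "a m / real m < l + r / 2" by auto
    \<comment> \<open>Writing n as a multiple of m plus a remainder, B bounds the term of the
      remainder, which disappears after division by n.\<close>
    define B where "B = Max (a ` {..<m})"
    have B: "a k \<le> B" if "k < m" for k unfolding B_def using that by (intro Max_ge) auto
    have B0: "0 \<le> B" using B[of 0] nonneg[of 0] m by simp
    obtain N :: nat where N: "real N > 2 * B / r" using reals_Archimedean2 by blast
    have "norm (a n / real n - l) < r" if n: "n \<ge> max N 1" for n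
    proof -
      have n1: "real n \<ge> 1" using n by simp
      have "a n \<le> real (n div m) * a m + a (n mod m)" using mult[of "n div m" m "n mod m"] by simp
      also have "\<dots> \<le> real n / real m * a m + B"
        using B[of "n mod m"] m nonneg[of m] of_nat_div_le_of_nat[of n m, where ?'a = real] by (intro add_mono mult_right_mono) auto
      finally have "a n / real n \<le> (real n / real m * a m + B) / real n" using n1 by (intro divide_right_mono) auto
      also have "\<dots> = a m / real m + B / real n" using n1 m by (simp add: field_simps)
      also have "B / real n < r / 2"
      proof -
        have "2 * B / r < real n" using N n by linarith
        then show ?thesis using r n1 by (simp add: field_simps)
      qed
      finally have "a n / real n < l + r" using m by simp
      with low[of n] n show ?thesis by simp
    qed
    then show "\<exists>no. \<forall>n\<ge>no. norm (a n / real n - l) < r" by blast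
  qed
  then show ?thesis by (rule convergentI)
qed

text \<open>Gibbs' inequality, termwise from ln t \<le> t - 1 with t = q/p. Terms with p = 0 only
  require q to be nonnegative.\<close>

lemma sum_mult_ln_le:
  fixes p q :: "'i \<Rightarrow> real"
  assumes I: "finite I" and p: "\<And>i. i \<in> I \<Longrightarrow> 0 \<le> p i" and p1: "sum p I = 1"
    and q: "\<And>i. i \<in> I \<Longrightarrow> 0 < p i \<Longrightarrow> 0 < q i" "\<And>i. i \<in> I \<Longrightarrow> 0 \<le> q i" and q1: "sum q I \<le> 1"
  shows "(\<Sum>i\<in>I. p i * ln (q i)) \<le> (\<Sum>i\<in>I. p i * ln (p i))"
proof -
  have "p i * ln (q i) \<le> p i * ln (p i) + (q i - p i)" if i: "i \<in> I" for i
  proof (cases "p i = 0")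
    case True
    then show ?thesis using q(2)[OF i] by simp
  next
    case False
    then have pos: "0 < p i" "0 < q i" using p[OF i] q(1)[OF i] by auto
    have "ln (q i) - ln (p i) = ln (q i / p i)" using pos by (simp add: ln_div)
    also have "\<dots> \<le> q i / p i - 1" using pos by (intro ln_le_minus_one) auto
    finally have "p i * (ln (q i) - ln (p i)) \<le> p i * (q i / p i - 1)" using pos by (intro mult_left_mono) auto
    then show ?thesis using pos by (simp add: algebra_simps)
  qed
  then have "(\<Sum>i\<in>I. p i * ln (q i)) \<le> (\<Sum>i\<in>I. p i * ln (p i) + (q i - p i))" by (rule sum_mono)
  also have "\<dots> = (\<Sum>i\<in>I. p i * ln (p i)) + (sum q I - 1)" by (simp add: sum.distrib sum_subtractf p1)
  finally show ?thesis using q1 by simp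
qed

section \<open>Words, itineraries and the entropy of labellings\<close>

definition words :: "'c set \<Rightarrow> nat \<Rightarrow> 'c list set" where
  "words L n = {w. set w \<subseteq> L \<and> length w = n}"

lemma finite_words: "finite L \<Longrightarrow> finite (words L n)"
  unfolding words_def by (rule finite_lists_length_eq)

lemma words_Suc: "words L (Suc n) = (\<lambda>(a, w). a # w) ` (L \<times> words L n)"
  by (auto simp: words_def image_iff length_Suc_conv)

lemma sum_words_prod:
  fixes F :: "nat \<Rightarrow> 'c \<Rightarrow> real"
  assumes L: "finite L"
  shows "(\<Sum>w\<in>words L n. \<Prod>k<n. F k (w ! k)) = (\<Prod>k<n. \<Sum>a\<in>L. F k a)"
proof (induction n arbitrary: F)
  case 0
  have "words L 0 = {[]}" by (auto simp: words_def)
  then show ?case by simp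
next
  case (Suc n)
  have "(\<Sum>w\<in>words L (Suc n). \<Prod>k<Suc n. F k (w ! k)) = (\<Sum>(a, w)\<in>L \<times> words L n. F 0 a * (\<Prod>k<n. F (Suc k) (w ! k)))"
    unfolding words_Suc by (subst sum.reindex)
      (auto simp: inj_on_def prod.lessThan_Suc_shift case_prod_unfold simp del: prod.lessThan_Suc intro!: sum.cong)
  also have "\<dots> = (\<Sum>a\<in>L. F 0 a) * (\<Sum>w\<in>words L n. \<Prod>k<n. F (Suc k) (w ! k))"
    by (simp add: sum.cartesian_product[symmetric] sum_product)
  finally show ?case unfolding Suc.IH[of "\<lambda>k. F (Suc k)"] by (simp add: prod.lessThan_Suc_shift del: prod.lessThan_Suc)
qed

definition itinerary :: "('a \<Rightarrow> 'a) \<Rightarrow> ('a \<Rightarrow> 'c) \<Rightarrow> nat \<Rightarrow> 'a \<Rightarrow> 'c list" where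
  "itinerary T X n x = map (\<lambda>k. X ((T ^^ k) x)) [0..<n]"

lemma length_itinerary [simp]: "length (itinerary T X n x) = n"
  by (simp add: itinerary_def)

lemma nth_itinerary [simp]: "k < n \<Longrightarrow> itinerary T X n x ! k = X ((T ^^ k) x)"
  by (simp add: itinerary_def)

lemma take_drop_itinerary:
  "k + m \<le> n \<Longrightarrow> take m (drop k (itinerary T X n x)) = itinerary T X m ((T ^^ k) x)"
proof (rule nth_equalityI)
  fix j assume km: "k + m \<le> n" and "j < length (take m (drop k (itinerary T X n x)))"
  then have "j < m" "k + j < n" by auto
  moreover have "(T ^^ (k + j)) x = (T ^^ j) ((T ^^ k) x)"
    unfolding add.commute[of k j] funpow_add by simp
  ultimately show "take m (drop k (itinerary T X n x)) ! j = itinerary T X m ((T ^^ k) x) ! j"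
    using km by simp
qed simp

lemma take_itinerary: "m \<le> n \<Longrightarrow> take m (itinerary T X n x) = itinerary T X m x"
  using take_drop_itinerary[of 0 m n T X x] by simp

lemma drop_itinerary: "drop n (itinerary T X (n + m) x) = itinerary T X m ((T ^^ n) x)"
  using take_drop_itinerary[of n m "n + m" T X x] by simp

locale preserving_system = prob_space M for M :: "'a measure" +
  fixes T :: "'a \<Rightarrow> 'a"
  assumes inv: "invariant_measure M T"
begin

lemma T_measurable [measurable]: "T \<in> measurable M M"
  using inv by (simp add: invariant_measure_def)

lemma T_pow_measurable [measurable]: "T ^^ n \<in> measurable M M"
  by (rule measurable_compose_n) (rule T_measurable)

lemma distr_T_pow: "distr M M (T ^^ n) = M"
proof (induction n)
  case 0
  then show ?case by (simp add: id_def distr_id2)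
next
  case (Suc n)
  have "distr M M (T ^^ Suc n) = distr (distr M M (T ^^ n)) M T"
    by (subst distr_distr) auto
  also have "\<dots> = M" using Suc inv by (simp add: invariant_measure_def)
  finally show ?case .
qed

lemma integral_T_pow: "f \<in> borel_measurable M \<Longrightarrow> (\<integral>x. f ((T ^^ n) x) \<partial>M) = (\<integral>x. (f x :: real) \<partial>M)"
  using integral_distr[of "T ^^ n" M M f] distr_T_pow[of n] by simp

text \<open>A finite measurable partition given by names of its cells, so that the joins become
  words of names; L may contain names that do not occur.\<close>

definition labelling :: "('a \<Rightarrow> 'c) \<Rightarrow> 'c set \<Rightarrow> bool" where
  "labelling X L \<longleftrightarrow> finite L \<and> X ` space M \<subseteq> L \<and> (\<forall>c. {x\<in>space M. X x = c} \<in> events)"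

lemma T_pow_space: "x \<in> space M \<Longrightarrow> (T ^^ k) x \<in> space M"
  using measurable_space[OF T_pow_measurable] by blast

lemma itinerary_words:
  assumes "labelling X L" "x \<in> space M"
  shows "itinerary T X n x \<in> words L n"
  using assms T_pow_space by (auto simp: words_def itinerary_def labelling_def)

lemma finite_valued_events:
  assumes W: "finite W" "\<And>x. x \<in> space M \<Longrightarrow> Y x \<in> W" and Y: "\<And>w. {x\<in>space M. Y x = w} \<in> events"
  shows "{x\<in>space M. P (Y x)} \<in> events"
proof -
  have "{x\<in>space M. P (Y x)} = (\<Union>w\<in>{w\<in>W. P w}. {x\<in>space M. Y x = w})" using W by auto
  also have "\<dots> \<in> events" using W Y by (intro sets.finite_UN) auto
  finally show ?thesis .
qed

lemma labelling_itinerary: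
  assumes X: "labelling X L"
  shows "labelling (itinerary T X n) (words L n)"
proof -
  have [measurable]: "Measurable.pred M (\<lambda>x. X x = c)" for c
    using X by (simp add: labelling_def pred_def)
  have "{x\<in>space M. itinerary T X n x = w} \<in> events" for w
  proof (cases "length w = n")
    case True
    have "{x\<in>space M. itinerary T X n x = w} = {x\<in>space M. \<forall>k. k < n \<longrightarrow> X ((T ^^ k) x) = w ! k}"
      using True by (auto simp: list_eq_iff_nth_eq)
    also have "\<dots> \<in> events" by measurable
    finally show ?thesis .
  next
    case False
    then have "{x\<in>space M. itinerary T X n x = w} = {}" by auto
    then show ?thesis by (simp only: sets.empty_sets)
  qed
  then show ?thesis using itinerary_words[OF X] X finite_words
    unfolding labelling_def by blast
qed

lemma integral_labelling:
  assumes Y: "labelling Y W"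
  shows "integrable M (\<lambda>x. f (Y x) :: real)" "(\<integral>x. f (Y x) \<partial>M) = (\<Sum>w\<in>W. f w * prob {x\<in>space M. Y x = w})"
proof -
  have W: "finite W" "\<And>x. x \<in> space M \<Longrightarrow> Y x \<in> W" "\<And>w. {x\<in>space M. Y x = w} \<in> events"
    using Y by (auto simp: labelling_def)
  have eq: "f (Y x) = (\<Sum>w\<in>W. f w * indicator {x\<in>space M. Y x = w} x)" if "x \<in> space M" for x
  proof -
    have "(\<Sum>w\<in>W. f w * indicator {x\<in>space M. Y x = w} x) = (\<Sum>w\<in>W. if w = Y x then f w else 0)"
      using that by (intro sum.cong) auto
    then show ?thesis using W that by simp
  qed
  have int: "integrable M (\<lambda>x. f w * indicator {x\<in>space M. Y x = w} x)" for w
    using W by (intro integrable_mult_right integrable_real_indicator) (auto simp: less_top[symmetric])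
  then show "integrable M (\<lambda>x. f (Y x) :: real)"
    by (subst Bochner_Integration.integrable_cong[OF refl eq]) auto
  have "(\<integral>x. f (Y x) \<partial>M) = (\<integral>x. (\<Sum>w\<in>W. f w * indicator {x\<in>space M. Y x = w} x) \<partial>M)"
    by (intro Bochner_Integration.integral_cong refl eq)
  also have "\<dots> = (\<Sum>w\<in>W. f w * prob {x\<in>space M. Y x = w})"
    using int by (subst Bochner_Integration.integral_sum) (auto intro!: sum.cong simp: Int_absorb2 Collect_conj_eq)
  finally show "(\<integral>x. f (Y x) \<partial>M) = (\<Sum>w\<in>W. f w * prob {x\<in>space M. Y x = w})" .
qed

definition pr :: "('a \<Rightarrow> 'c) \<Rightarrow> 'c \<Rightarrow> real" where
  "pr Y w = prob {x\<in>space M. Y x = w}"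

definition label_entropy :: "('a \<Rightarrow> 'c) \<Rightarrow> 'c set \<Rightarrow> real" where
  "label_entropy Y W = - (\<Sum>w\<in>W. pr Y w * ln (pr Y w))"

lemma sum_pr: "labelling Y W \<Longrightarrow> sum (pr Y) W = 1"
  using integral_labelling(2)[of Y W "\<lambda>_. 1"] by (simp add: pr_def prob_space)

lemma pr_bounds: "0 \<le> pr Y w" "pr Y w \<le> 1"
  by (auto simp: pr_def)

lemma label_entropy_nonneg: "0 \<le> label_entropy Y W"
proof -
  have "pr Y w * ln (pr Y w) \<le> 0" for w
    using pr_bounds[of Y w] by (cases "pr Y w = 0") (auto intro: mult_nonneg_nonpos)
  then show ?thesis unfolding label_entropy_def by (simp add: sum_nonpos)
qed

lemma label_entropy_le:
  assumes Y: "labelling Y W" and q: "\<And>w. w \<in> W \<Longrightarrow> 0 < pr Y w \<Longrightarrow> 0 < q w" "\<And>w. w \<in> W \<Longrightarrow> 0 \<le> q w"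
    and q1: "sum q W \<le> 1"
  shows "label_entropy Y W \<le> (\<integral>x. - ln (q (Y x)) \<partial>M)"
proof -
  have "(\<Sum>w\<in>W. pr Y w * ln (q w)) \<le> (\<Sum>w\<in>W. pr Y w * ln (pr Y w))"
    using Y sum_pr[OF Y] pr_bounds q q1 by (intro sum_mult_ln_le) (auto simp: labelling_def)
  then show ?thesis
    unfolding integral_labelling(2)[OF Y, of "\<lambda>w. - ln (q w)"] label_entropy_def
    by (simp add: pr_def sum_negf mult.commute)
qed

lemma pr_mono: "labelling Y W \<Longrightarrow> (\<And>x. x \<in> space M \<Longrightarrow> Z x = z \<Longrightarrow> Y x = y) \<Longrightarrow> pr Z z \<le> pr Y y"
  unfolding pr_def labelling_def by (intro finite_measure_mono) auto

lemma pr_itinerary_shift: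
  assumes X: "labelling X L"
  shows "prob {x\<in>space M. itinerary T X m ((T ^^ n) x) = w} = pr (itinerary T X m) w"
proof -
  have E: "{x\<in>space M. itinerary T X m x = w} \<in> events"
    using labelling_itinerary[OF X] by (auto simp: labelling_def)
  have "pr (itinerary T X m) w = measure (distr M M (T ^^ n)) {x\<in>space M. itinerary T X m x = w}"
    by (simp add: pr_def distr_T_pow)
  also have "\<dots> = prob ((T ^^ n) -` {x\<in>space M. itinerary T X m x = w} \<inter> space M)"
    using E by (subst measure_distr) auto
  also have "(T ^^ n) -` {x\<in>space M. itinerary T X m x = w} \<inter> space M = {x\<in>space M. itinerary T X m ((T ^^ n) x) = w}"
    using T_pow_space by auto
  finally show ?thesis by simp
qed

definition itinerary_entropy :: "('a \<Rightarrow> 'c) \<Rightarrow> 'c set \<Rightarrow> nat \<Rightarrow> real" where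
  "itinerary_entropy X L n = label_entropy (itinerary T X n) (words L n)"

text \<open>Gibbs' inequality with the product of the marginals of the first n and the last m
  letters as reference. Invariance of the measure makes the second marginal the distribution of the
  m-letter itinerary.\<close>

lemma itinerary_entropy_subadditive:
  assumes X: "labelling X L"
  shows "itinerary_entropy X L (n + m) \<le> itinerary_entropy X L n + itinerary_entropy X L m"
proof -
  let ?I = "itinerary T X" and ?W = "words L (n + m)"
  let ?a = "\<lambda>w. pr (?I n) (take n w)" and ?b = "\<lambda>w. pr (?I m) (drop n w)"
  note lab = labelling_itinerary[OF X]
  have fin: "finite L" using X by (simp add: labelling_def)
  have pos: "0 < ?a w" "0 < ?b w" if w: "0 < pr (?I (n + m)) w" for w
  proof -
    have "pr (?I (n + m)) w \<le> ?a w" by (rule pr_mono[OF lab]) (auto simp: take_itinerary)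
    with w show "0 < ?a w" by simp
    have "pr (?I (n + m)) w \<le> prob {x\<in>space M. ?I m ((T ^^ n) x) = drop n w}"
      unfolding pr_def
    proof (rule finite_measure_mono)
      have [measurable]: "Measurable.pred M (\<lambda>x. ?I m x = drop n w)" using lab[of m] by (simp add: labelling_def pred_def)
      show "{x\<in>space M. ?I m ((T ^^ n) x) = drop n w} \<in> events" by measurable
    qed (auto simp: drop_itinerary)
    with w show "0 < ?b w" using pr_itinerary_shift[OF X] by simp
  qed
  \<comment> \<open>Cutting a word after n letters is injective, so the products are part of a
    double sum with value 1.\<close>
  have "(\<Sum>w\<in>?W. ?a w * ?b w) = (\<Sum>(u, v)\<in>(\<lambda>w. (take n w, drop n w)) ` ?W. pr (?I n) u * pr (?I m) v)"
    by (subst sum.reindex) (auto simp: inj_on_def intro: append_take_drop_id[THEN subst] | metis append_take_drop_id)+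
  also have "\<dots> \<le> (\<Sum>(u, v)\<in>words L n \<times> words L m. pr (?I n) u * pr (?I m) v)"
    using fin by (intro sum_mono2)
      (auto simp: words_def finite_words[unfolded words_def] pr_bounds(1) dest: in_set_takeD in_set_dropD)
  also have "\<dots> = sum (pr (?I n)) (words L n) * sum (pr (?I m)) (words L m)"
    by (simp add: sum.cartesian_product[symmetric] sum_product)
  also have "\<dots> = 1" using sum_pr[OF lab] by simp
  finally have q1: "(\<Sum>w\<in>?W. ?a w * ?b w) \<le> 1" .
  have "(\<Sum>w\<in>?W. pr (?I (n + m)) w * ln (?a w * ?b w)) \<le> (\<Sum>w\<in>?W. pr (?I (n + m)) w * ln (pr (?I (n + m)) w))"
    using pos q1 sum_pr[OF lab] fin by (intro sum_mult_ln_le finite_words) (auto simp: pr_bounds)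
  moreover have "(\<Sum>w\<in>?W. pr (?I (n + m)) w * ln (?a w * ?b w))
      = (\<Sum>w\<in>?W. ln (?a w) * pr (?I (n + m)) w) + (\<Sum>w\<in>?W. ln (?b w) * pr (?I (n + m)) w)"
    unfolding sum.distrib[symmetric]
  proof (intro sum.cong refl)
    fix w
    show "pr (?I (n + m)) w * ln (?a w * ?b w) = ln (?a w) * pr (?I (n + m)) w + ln (?b w) * pr (?I (n + m)) w"
      using pos[of w] pr_bounds(1)[of "?I (n + m)" w]
      by (cases "pr (?I (n + m)) w = 0") (auto simp: ln_mult algebra_simps)
  qed
  moreover have "(\<Sum>w\<in>?W. ln (?a w) * pr (?I (n + m)) w) = - itinerary_entropy X L n"
  proof -
    have "(\<Sum>w\<in>?W. ln (?a w) * pr (?I (n + m)) w) = (\<integral>x. ln (?a (?I (n + m) x)) \<partial>M)"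
      unfolding integral_labelling(2)[OF lab, of "\<lambda>w. ln (?a w)" "n + m"] by (simp add: pr_def)
    also have "\<dots> = (\<integral>x. ln (pr (?I n) (?I n x)) \<partial>M)" by (simp add: take_itinerary)
    also have "\<dots> = - itinerary_entropy X L n"
      unfolding integral_labelling(2)[OF lab, of "\<lambda>w. ln (pr (?I n) w)" n]
      by (simp add: itinerary_entropy_def label_entropy_def pr_def mult.commute)
    finally show ?thesis .
  qed
  moreover have "(\<Sum>w\<in>?W. ln (?b w) * pr (?I (n + m)) w) = - itinerary_entropy X L m"
  proof -
    have "(\<Sum>w\<in>?W. ln (?b w) * pr (?I (n + m)) w) = (\<integral>x. ln (?b (?I (n + m) x)) \<partial>M)"
      unfolding integral_labelling(2)[OF lab, of "\<lambda>w. ln (?b w)" "n + m"] by (simp add: pr_def)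
    also have "\<dots> = (\<integral>x. ln (pr (?I m) (?I m ((T ^^ n) x))) \<partial>M)" by (simp add: drop_itinerary)
    also have "\<dots> = (\<integral>x. ln (pr (?I m) (?I m x)) \<partial>M)"
      by (rule integral_T_pow)
        (rule borel_measurable_integrable[OF integral_labelling(1)[OF lab, where f = "\<lambda>w. ln (pr (?I m) w)"]])
    also have "\<dots> = - itinerary_entropy X L m"
      unfolding integral_labelling(2)[OF lab, of "\<lambda>w. ln (pr (?I m) w)" m]
      by (simp add: itinerary_entropy_def label_entropy_def pr_def mult.commute)
    finally show ?thesis .
  qed
  ultimately show ?thesis by (simp add: itinerary_entropy_def label_entropy_def)
qed

text \<open>Gibbs' inequality against the distribution that draws a \<open>C\<close>-word uniformly, predicts the
  \<open>X\<close>-labels from it by \<open>g\<close>, and replaces each predicted label with probability \<open>\<delta>\<close> by a uniform one.\<close>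

lemma itinerary_entropy_le:
  assumes X: "labelling X L" and C: "labelling C D" and g: "\<And>w. g w \<in> L" and d: "0 < \<delta>" "\<delta> < 1"
  shows "itinerary_entropy X L n \<le> ln (real (card (itinerary T C (n + m) ` space M))) +
    real n * (- ln (1 - \<delta>) + ln (real (card L) / \<delta>) * prob {x\<in>space M. X x \<noteq> g (itinerary T C m x)})"
proof -
  let ?I = "itinerary T X n" and ?C = "itinerary T C (n + m)"
  define V where "V = ?C ` space M"
  define K where "K = real (card L)"
  have fin: "finite L" using X by (simp add: labelling_def)
  have K: "K \<ge> 1" using fin g[of undefined] by (auto simp: K_def Suc_le_eq card_gt_0_iff)
  have V: "finite V" "V \<noteq> {}"
    using labelling_itinerary[OF C, of "n + m"] not_empty unfolding V_def labelling_def
    by (auto intro: finite_subset)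
  then have cV: "real (card V) > 0" by (auto simp: card_gt_0_iff)
  define s where "s a z = (if a = z then 1 - \<delta> else 0) + \<delta> / K" for a z :: 'b
  have spos: "0 < s a z" for a z using d K by (auto simp: s_def add_nonneg_pos)
  have ssum: "(\<Sum>a\<in>L. s a z) = 1" if "z \<in> L" for z
    using that fin K by (auto simp: s_def sum.distrib K_def)
  \<comment> \<open>The prediction at time k reads the m letters of c from position k on; this is
    why c has length n + m.\<close>
  define q where "q w = (\<Sum>c\<in>V. \<Prod>k<n. s (w ! k) (g (take m (drop k c)))) / real (card V)" for w
  have qpos: "0 < q w" for w
    unfolding q_def using V cV spos by (intro divide_pos_pos sum_pos prod_pos) auto
  have "sum q (words L n) = (\<Sum>c\<in>V. \<Sum>w\<in>words L n. \<Prod>k<n. s (w ! k) (g (take m (drop k c)))) / real (card V)"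
    unfolding q_def sum_divide_distrib[symmetric] by (subst sum.swap) simp
  also have "\<dots> = 1" using cV fin ssum g by (simp add: sum_words_prod[of L "\<lambda>k a. s a (g (take m (drop k _)))"])
  finally have q1: "sum q (words L n) \<le> 1" by simp
  define E where "E = {x\<in>space M. X x \<noteq> g (itinerary T C m x)}"
  have E [measurable]: "E \<in> events"
  proof -
    have "E = {x\<in>space M. (\<lambda>(a, w). a \<noteq> g w) (X x, itinerary T C m x)}" by (auto simp: E_def)
    also have "\<dots> \<in> events"
    proof (rule finite_valued_events[where W = "L \<times> words D m"])
      fix y
      have "{x\<in>space M. (X x, itinerary T C m x) = y} = {x\<in>space M. X x = fst y} \<inter> {x\<in>space M. itinerary T C m x = snd y}"
        by auto
      then show "{x\<in>space M. (X x, itinerary T C m x) = y} \<in> events"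
        using X labelling_itinerary[OF C, of m] by (auto simp: labelling_def)
    qed (use X C labelling_itinerary[OF C, of m] in \<open>auto simp: labelling_def\<close>)
    finally show ?thesis .
  qed
  let ?e = "\<lambda>k x. - ln (1 - \<delta>) + ln (K / \<delta>) * indicator E ((T ^^ k) x)"
  \<comment> \<open>Of the average over V only the true code word of x is kept. A correct prediction
    then costs at most \<open>- ln (1 - \<delta>)\<close>, and a wrong one at most
    \<open>ln (K / \<delta>)\<close>.\<close>
  have point: "- ln (q (?I x)) \<le> ln (real (card V)) + (\<Sum>k<n. ?e k x)" if x: "x \<in> space M" for x
  proof -
    let ?t = "\<lambda>k. s (X ((T ^^ k) x)) (g (itinerary T C m ((T ^^ k) x)))"
    have "(\<Prod>k<n. ?t k) = (\<Prod>k<n. s (?I x ! k) (g (take m (drop k (?C x)))))"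
      by (intro prod.cong refl) (simp add: take_drop_itinerary)
    also have "\<dots> \<le> (\<Sum>c\<in>V. \<Prod>k<n. s (?I x ! k) (g (take m (drop k c))))"
    proof (rule member_le_sum)
      show "?C x \<in> V" using x by (simp add: V_def)
      show "0 \<le> (\<Prod>k<n. s (?I x ! k) (g (take m (drop k c))))" for c
        using spos by (intro prod_nonneg) (simp add: less_imp_le)
    qed (rule V)
    finally have le: "(\<Prod>k<n. ?t k) / real (card V) \<le> q (?I x)"
      unfolding q_def using cV by (intro divide_right_mono) auto
    have tpos: "0 < (\<Prod>k<n. ?t k)" using spos by (intro prod_pos) auto
    have "ln ((\<Prod>k<n. ?t k) / real (card V)) \<le> ln (q (?I x))"
      using le tpos cV qpos by (subst ln_le_cancel_iff) auto
    then have "- ln (q (?I x)) \<le> ln (real (card V)) - ln (\<Prod>k<n. ?t k)"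
      unfolding ln_divide_pos[OF tpos cV] by simp
    also have "ln (\<Prod>k<n. ?t k) = (\<Sum>k<n. ln (?t k))"
      by (rule ln_prod) (simp_all add: spos spos[THEN less_imp_neq, symmetric])
    also have "ln (real (card V)) - (\<Sum>k<n. ln (?t k)) = ln (real (card V)) + (\<Sum>k<n. - ln (?t k))"
      by (simp add: sum_negf)
    also have "\<dots> \<le> ln (real (card V)) + (\<Sum>k<n. ?e k x)"
    proof (intro add_left_mono sum_mono)
      fix k
      have sp: "(T ^^ k) x \<in> space M" using x by (rule T_pow_space)
      show "- ln (?t k) \<le> ?e k x"
      proof (cases "(T ^^ k) x \<in> E")
        case True
        have "\<delta> / K \<le> ?t k" using d by (simp add: s_def)
        then have "ln (\<delta> / K) \<le> ln (?t k)" using d K by (subst ln_le_cancel_iff) (auto simp: spos)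
        moreover have "ln (\<delta> / K) = - ln (K / \<delta>)" using d K by (simp add: ln_div)
        moreover have "ln (1 - \<delta>) \<le> 0" using d by simp
        ultimately show ?thesis using True by simp
      next
        case False
        then have "1 - \<delta> \<le> ?t k" using d K sp by (simp add: s_def E_def)
        then have "ln (1 - \<delta>) \<le> ln (?t k)" using d by (subst ln_le_cancel_iff) (auto simp: spos)
        then show ?thesis using False by simp
      qed
    qed
    finally show ?thesis .
  qed
  have "itinerary_entropy X L n \<le> (\<integral>x. - ln (q (?I x)) \<partial>M)"
    unfolding itinerary_entropy_def
    using qpos q1 by (intro label_entropy_le labelling_itinerary X) (auto intro: less_imp_le)
  also have "\<dots> \<le> (\<integral>x. ln (real (card V)) + (\<Sum>k<n. ?e k x) \<partial>M)"
  proof (rule integral_mono)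
    show "integrable M (\<lambda>x. - ln (q (?I x)))" by (rule integral_labelling(1)[OF labelling_itinerary[OF X]])
    have "integrable M (\<lambda>x. indicator E ((T ^^ k) x) :: real)" for k
      by (rule integrable_const_bound[where B = 1]) (auto simp: indicator_def)
    then show "integrable M (\<lambda>x. ln (real (card V)) + (\<Sum>k<n. ?e k x))" by simp
  qed (use point in auto)
  also have "\<dots> = ln (real (card V)) + real n * (- ln (1 - \<delta>) + ln (K / \<delta>) * prob E)"
  proof -
    have i: "integrable M (\<lambda>x. indicator E ((T ^^ k) x) :: real)" for k
      by (rule integrable_const_bound[where B = 1]) (auto simp: indicator_def)
    have "(\<integral>x. indicator E ((T ^^ k) x) \<partial>M) = prob E" for k
      by (subst integral_T_pow[of "indicator E"]) auto
    then show ?thesis using i by (simp add: prob_space)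
  qed
  finally show ?thesis by (simp add: V_def K_def E_def)
qed

section \<open>Entropy of finite partitions\<close>

definition cell :: "'a set set \<Rightarrow> 'a \<Rightarrow> 'a set" where
  "cell P x = (THE A. A \<in> P \<and> x \<in> A)"

lemma cell_eq_iff:
  assumes P: "partition_on (space M) P" and x: "x \<in> space M" and A: "A \<in> P"
  shows "cell P x = A \<longleftrightarrow> x \<in> A"
proof -
  have "\<exists>!A. A \<in> P \<and> x \<in> A"
    using P x by (auto simp: partition_on_def disjoint_def)
  from theI'[OF this] this A show ?thesis unfolding cell_def by blast
qed

lemma cell_in:
  assumes P: "partition_on (space M) P" and x: "x \<in> space M"
  shows "cell P x \<in> P"
proof -
  obtain A where "A \<in> P" "x \<in> A" using P x by (auto simp: partition_on_def)
  then show ?thesis using cell_eq_iff[OF P x] by blast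
qed

lemma labelling_cell:
  assumes P: "finite P" "partition_on (space M) P" "P \<subseteq> events"
  shows "labelling (cell P) P"
proof -
  have "{x\<in>space M. cell P x = A} \<in> events" for A
  proof (cases "A \<in> P")
    case True
    then have "{x\<in>space M. cell P x = A} = A"
      using cell_eq_iff[OF P(2)] partition_onD1[OF P(2)] by auto
    then show ?thesis using True P by auto
  next
    case False
    then have "{x\<in>space M. cell P x = A} = {}" using cell_in[OF P(2)] by auto
    then show ?thesis by (simp only: sets.empty_sets)
  qed
  then show ?thesis using P(1) cell_in[OF P(2)] by (auto simp: labelling_def)
qed

text \<open>Distinct words have disjoint cells, so nonempty cells correspond to words bijectively;
  words with an empty cell have probability 0 and add nothing.\<close>

lemma partition_entropy_refined_partition:
  assumes P: "finite P" "partition_on (space M) P"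
  shows "partition_entropy M (refined_partition M T P n) = itinerary_entropy (cell P) P n"
proof -
  define Z where "Z w = {x\<in>space M. itinerary T (cell P) n x = w}" for w
  have iff: "itinerary T (cell P) n x = w \<longleftrightarrow> (\<forall>k<n. (T ^^ k) x \<in> w ! k)"
    if "w \<in> words P n" "x \<in> space M" for w x
    using that cell_eq_iff[OF P(2) T_pow_space[OF that(2)]] nth_mem[of _ w]
    by (auto simp: list_eq_iff_nth_eq words_def subset_iff)
  have Z: "Z w = {x\<in>space M. \<forall>k<n. (T ^^ k) x \<in> w ! k}" if "w \<in> words P n" for w
    using iff[OF that] by (auto simp: Z_def)
  have "{{x \<in> space M. \<forall>k<n. (T ^^ k) x \<in> A k} | A. \<forall>k<n. A k \<in> P} = Z ` words P n"
  proof (intro equalityI subsetI)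
    fix B assume "B \<in> {{x \<in> space M. \<forall>k<n. (T ^^ k) x \<in> A k} | A. \<forall>k<n. A k \<in> P}"
    then obtain A where A: "\<forall>k<n. A k \<in> P" "B = {x \<in> space M. \<forall>k<n. (T ^^ k) x \<in> A k}" by auto
    then have w: "map A [0..<n] \<in> words P n" by (auto simp: words_def)
    have "B = Z (map A [0..<n])" unfolding Z[OF w] A(2) by simp
    then show "B \<in> Z ` words P n" using w by blast
  next
    fix B assume "B \<in> Z ` words P n"
    then obtain w where w: "w \<in> words P n" "B = Z w" by auto
    then have "\<forall>k<n. w ! k \<in> P" using nth_mem[of _ w] by (auto simp: words_def)
    then show "B \<in> {{x \<in> space M. \<forall>k<n. (T ^^ k) x \<in> A k} | A. \<forall>k<n. A k \<in> P}"
      using w Z[OF w(1)] by blast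
  qed
  then have ref: "refined_partition M T P n = Z ` {w\<in>words P n. Z w \<noteq> {}}"
    unfolding refined_partition_def by auto
  have inj: "inj_on Z {w\<in>words P n. Z w \<noteq> {}}"
    by (auto simp: inj_on_def Z_def)
  have "(\<Sum>A\<in>refined_partition M T P n. prob A * ln (prob A)) = (\<Sum>w\<in>{w\<in>words P n. Z w \<noteq> {}}. prob (Z w) * ln (prob (Z w)))"
    unfolding ref by (subst sum.reindex[OF inj]) simp
  also have "\<dots> = (\<Sum>w\<in>words P n. prob (Z w) * ln (prob (Z w)))"
    using P(1) by (intro sum.mono_neutral_left finite_words) auto
  finally show ?thesis
    by (simp add: partition_entropy_def itinerary_entropy_def label_entropy_def pr_def Z_def)
qed

text \<open>Subadditivity makes the \<open>lim\<close> in \<open>entropy_wrt\<close> a genuine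
  limit.\<close>

lemma itinerary_entropy_tendsto:
  assumes P: "finite P" "partition_on (space M) P" "P \<subseteq> events"
  shows "(\<lambda>n. itinerary_entropy (cell P) P n / real n) \<longlonglongrightarrow> entropy_wrt M T P"
proof -
  have "convergent (\<lambda>n. itinerary_entropy (cell P) P n / real n)"
    using itinerary_entropy_subadditive[OF labelling_cell[OF P]]
    by (intro subadditive_convergent) (auto simp: itinerary_entropy_def label_entropy_nonneg)
  then show ?thesis
    unfolding entropy_wrt_def partition_entropy_refined_partition[OF P(1,2)] by (simp add: convergent_LIMSEQ_iff)
qed

text \<open>The bound on cylinders makes the code itself carry entropy at least h. The bound on the
  number of words limits every partition from above, because \<open>gen\<close> lets its labels be
  read off from a finite window of the code with few errors.\<close>

theorem measure_entropy_eqI: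
  assumes C: "finite (C ` space M)" "\<And>c. {x\<in>space M. C x = c} \<in> events"
    and card: "\<And>n. real (card (itinerary T C n ` space M)) \<le> K * exp (real n * h)"
    and cyl: "\<And>n w. prob {x\<in>space M. itinerary T C n x = w} \<le> K * exp (- (real n * h))"
    and gen: "\<And>A \<epsilon>. A \<in> events \<Longrightarrow> 0 < \<epsilon> \<Longrightarrow> \<exists>m W. prob {x\<in>space M. (x \<in> A) \<noteq> (itinerary T C m x \<in> W)} \<le> \<epsilon>"
  shows "measure_entropy M T = ereal h"
proof -
  have labC: "labelling C (C ` space M)" using C by (auto simp: labelling_def)
  have Cev: "{x\<in>space M. Q (itinerary T C n x)} \<in> events" for Q n
  proof (rule finite_valued_events[where Y = "itinerary T C n" and P = Q])
    note l = labelling_itinerary[OF labC, of n, unfolded labelling_def]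
    show "finite (words (C ` space M) n)" using l by blast
    show "itinerary T C n x \<in> words (C ` space M) n" if "x \<in> space M" for x using l that by blast
    show "{x\<in>space M. itinerary T C n x = w} \<in> events" for w using l by blast
  qed
  have K: "K > 0"
  proof -
    have "itinerary T C 0 ` space M = {[]}" using not_empty by (auto simp: itinerary_def image_iff)
    then show ?thesis using card[of 0] by simp
  qed
  have upper: "entropy_wrt M T P \<le> h" if P: "finite P" "partition_on (space M) P" "P \<subseteq> events" for P
  proof (rule field_le_epsilon)
    fix \<eta> :: real assume \<eta>: "0 < \<eta>"
    have Pne: "P \<noteq> {}" using P(2) not_empty by (auto simp: partition_on_def)
    define N where "N = real (card P)"
    have N: "N \<ge> 1" using Pne P(1) by (auto simp: N_def Suc_le_eq card_gt_0_iff)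
    \<comment> \<open>This makes the perturbation cost \<eta>/2 per letter when the prediction is
      correct.\<close>
    define \<delta> where "\<delta> = 1 - exp (- (\<eta> / 2))"
    have \<delta>: "0 < \<delta>" "\<delta> < 1" "- ln (1 - \<delta>) = \<eta> / 2" using \<eta> by (auto simp: \<delta>_def)
    define l where "l = ln (N / \<delta>)"
    have l: "l \<ge> 0" using N \<delta> by (simp add: l_def)
    \<comment> \<open>Errors are added over the N cells and cost l each, which stays within the
      other \<eta>/2; the summand 1 keeps the denominator positive.\<close>
    define \<epsilon> where "\<epsilon> = \<eta> / 2 / (l + 1) / N"
    have \<epsilon>: "\<epsilon> > 0" using \<eta> l N by (simp add: \<epsilon>_def)
    have "\<forall>A\<in>P. \<exists>m W. prob {x\<in>space M. (x \<in> A) \<noteq> (itinerary T C m x \<in> W)} \<le> \<epsilon>"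
      using gen P(3) \<epsilon> by blast
    then obtain m0 W0 where W0: "\<And>A. A \<in> P \<Longrightarrow> prob {x\<in>space M. (x \<in> A) \<noteq> (itinerary T C (m0 A) x \<in> W0 A)} \<le> \<epsilon>"
      by metis
    \<comment> \<open>One window serves all cells: the sets \<open>W A\<close> below look only at
      the prefix of length \<open>m0 A\<close>.\<close>
    define m where "m = Max (m0 ` P)"
    have m: "m0 A \<le> m" if "A \<in> P" for A unfolding m_def using that P(1) by (intro Max_ge) auto
    define W where "W A = {w. take (m0 A) w \<in> W0 A}" for A
    define E where "E A = {x\<in>space M. (x \<in> A) \<noteq> (itinerary T C m x \<in> W A)}" for A
    have E: "prob (E A) \<le> \<epsilon>" if "A \<in> P" for A
      using W0[OF that] m[OF that] by (simp add: E_def W_def take_itinerary)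
    have Eev: "E A \<in> events" if "A \<in> P" for A
    proof -
      have "E A = (A - {x\<in>space M. itinerary T C m x \<in> W A}) \<union> ({x\<in>space M. itinerary T C m x \<in> W A} - A)"
        using sets.sets_into_space that P(3) by (auto simp: E_def)
      also have "\<dots> \<in> events" using that P(3) Cev[of "\<lambda>w. w \<in> W A" m] by blast
      finally show ?thesis .
    qed
    \<comment> \<open>Outside all error sets the word lies in \<open>W A\<close> for exactly one A,
      the true cell; elsewhere any cell will do as a value.\<close>
    define g where "g w = (if \<exists>A\<in>P. w \<in> W A then SOME A. A \<in> P \<and> w \<in> W A else SOME A. A \<in> P)" for w
    have gP: "g w \<in> P" for w
      unfolding g_def using Pne someI_ex[of "\<lambda>A. A \<in> P \<and> w \<in> W A"] by (auto simp: some_in_eq)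
    have sub: "{x\<in>space M. cell P x \<noteq> g (itinerary T C m x)} \<subseteq> (\<Union>A\<in>P. E A)"
    proof (rule subsetI, rule ccontr)
      fix x assume x: "x \<in> {x\<in>space M. cell P x \<noteq> g (itinerary T C m x)}" and "x \<notin> (\<Union>A\<in>P. E A)"
      then have eq: "itinerary T C m x \<in> W A \<longleftrightarrow> cell P x = A" if "A \<in> P" for A
        using that cell_eq_iff[OF P(2), of x A] by (auto simp: E_def)
      then have "g (itinerary T C m x) = (SOME A. A \<in> P \<and> itinerary T C m x \<in> W A)"
        using cell_in[OF P(2), of x] x by (auto simp: g_def)
      also have "\<dots> = cell P x"
        using eq cell_in[OF P(2), of x] x by (intro some_equality) auto
      finally show False using x by simp
    qed
    have "prob {x\<in>space M. cell P x \<noteq> g (itinerary T C m x)} \<le> prob (\<Union>A\<in>P. E A)"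
      using sub Eev P(1) by (intro finite_measure_mono sets.finite_UN) auto
    also have "\<dots> \<le> (\<Sum>A\<in>P. prob (E A))"
      using Eev P(1) by (intro finite_measure_subadditive_finite) auto
    also have "\<dots> \<le> N * \<epsilon>" unfolding N_def by (rule sum_bounded_above) (rule E)
    also have "\<dots> = \<eta> / 2 / (l + 1)" using N by (simp add: \<epsilon>_def)
    finally have perr: "prob {x\<in>space M. cell P x \<noteq> g (itinerary T C m x)} \<le> \<eta> / 2 / (l + 1)" .
    have "l * prob {x\<in>space M. cell P x \<noteq> g (itinerary T C m x)} \<le> (l + 1) * (\<eta> / 2 / (l + 1))"
      using perr l by (intro mult_mono) auto
    also have "(l + 1) * (x / (l + 1)) = x" for x using l by (simp add: field_simps)
    finally have err: "- ln (1 - \<delta>) + l * prob {x\<in>space M. cell P x \<noteq> g (itinerary T C m x)} \<le> \<eta>"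
      using \<delta>(3) by simp
    \<comment> \<open>The m extra letters of the window contribute mh in total, hence nothing in the
      limit.\<close>
    have "itinerary_entropy (cell P) P n / real n \<le> (ln K + real m * h) / real n + (h + \<eta>)" if n: "n \<ge> 1" for n
    proof -
      have "itinerary T C (n + m) ` space M \<noteq> {}" using not_empty by simp
      moreover have "finite (itinerary T C (n + m) ` space M)"
        using labelling_itinerary[OF labC, of "n + m"] unfolding labelling_def by (auto intro: finite_subset)
      ultimately have c0: "real (card (itinerary T C (n + m) ` space M)) > 0" by (simp add: card_gt_0_iff)
      then have "ln (real (card (itinerary T C (n + m) ` space M))) \<le> ln (K * exp (real (n + m) * h))"
        using card[of "n + m"] K by (subst ln_le_cancel_iff) auto
      also have "\<dots> = ln K + (real n + real m) * h" using K by (simp add: ln_mult_pos)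
      finally have c1: "ln (real (card (itinerary T C (n + m) ` space M))) \<le> ln K + (real n + real m) * h" .
      have "real n * (- ln (1 - \<delta>) + l * prob {x\<in>space M. cell P x \<noteq> g (itinerary T C m x)}) \<le> real n * \<eta>"
        by (rule mult_left_mono[OF err]) simp
      with itinerary_entropy_le[where g = g, OF labelling_cell[OF P] labC gP \<delta>(1,2), of n m] c1
      have "itinerary_entropy (cell P) P n \<le> ln K + (real n + real m) * h + real n * \<eta>"
        unfolding N_def l_def by linarith
      from divide_right_mono[OF this, of "real n"]
      have "itinerary_entropy (cell P) P n / real n \<le> (ln K + (real n + real m) * h + real n * \<eta>) / real n" by simp
      also have "\<dots> = (ln K + real m * h) / real n + (h + \<eta>)" using n by (simp add: field_simps)
      finally show ?thesis .
    qed
    then have ev: "\<exists>N. \<forall>n\<ge>N. itinerary_entropy (cell P) P n / real n \<le> (ln K + real m * h) / real n + (h + \<eta>)" by blast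
    have "(\<lambda>n. (ln K + real m * h) / real n + (h + \<eta>)) \<longlonglongrightarrow> 0 + (h + \<eta>)"
      by (intro tendsto_add tendsto_const lim_const_over_n)
    then show "entropy_wrt M T P \<le> h + \<eta>"
      using LIMSEQ_le[OF itinerary_entropy_tendsto[OF P] _ ev] by simp
  qed
  define P0 where "P0 = (\<lambda>c. {x\<in>space M. C x = c}) ` C ` space M"
  have P0: "finite P0" "partition_on (space M) P0" "P0 \<subseteq> events"
    using C by (auto simp: P0_def partition_on_def disjoint_def)
  have lower: "h \<le> entropy_wrt M T P0"
  proof -
    let ?I = "itinerary T (cell P0)"
    have cell0: "cell P0 x = {y\<in>space M. C y = C x}" if "x \<in> space M" for x
      using that cell_eq_iff[OF P0(2), of x "{y\<in>space M. C y = C x}"] by (auto simp: P0_def)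
    note lab = labelling_itinerary[OF labelling_cell[OF P0]]
    have low: "real n * h - ln K \<le> itinerary_entropy (cell P0) P0 n" for n
    proof -
      \<comment> \<open>Each word has probability at most K exp(-nh), so its information is at least
        nh - ln K; averaging keeps this bound.\<close>
      have "pr (?I n) w * ln (pr (?I n) w) \<le> pr (?I n) w * (ln K - real n * h)" for w
      proof (cases "pr (?I n) w = 0")
        case False
        then have pos: "pr (?I n) w > 0" using pr_bounds(1)[of "?I n" w] by simp
        have "{x\<in>space M. ?I n x = w} \<noteq> {}"
        proof
          assume "{x\<in>space M. ?I n x = w} = {}"
          then have "pr (?I n) w = prob {}" by (simp only: pr_def)
          with False show False by simp
        qed
        then obtain x where x: "x \<in> space M" "?I n x = w" by auto
        \<comment> \<open>A cell of \<open>P0\<close> determines the letter, so equal words of cells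
          mean equal code words and \<open>cyl\<close> applies.\<close>
        have same: "itinerary T C n y = itinerary T C n x" if y: "y \<in> space M" "?I n y = w" for y
        proof (rule nth_equalityI)
          fix k assume "k < length (itinerary T C n y)"
          then have k: "k < n" by simp
          have "cell P0 ((T ^^ k) y) = cell P0 ((T ^^ k) x)"
            using arg_cong[where f = "\<lambda>l. l ! k", OF trans[OF y(2) x(2)[symmetric]]] k by simp
          then show "itinerary T C n y ! k = itinerary T C n x ! k"
            using cell0[OF T_pow_space[OF y(1), of k]] cell0[OF T_pow_space[OF x(1), of k]] T_pow_space[OF y(1), of k] k by auto
        qed simp
        have "pr (?I n) w \<le> prob {y\<in>space M. itinerary T C n y = itinerary T C n x}"
          unfolding pr_def using same Cev[of "\<lambda>v. v = itinerary T C n x" n] by (intro finite_measure_mono) auto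
        also have "\<dots> \<le> K * exp (- (real n * h))" by (rule cyl)
        finally have "ln (pr (?I n) w) \<le> ln (K * exp (- (real n * h)))" using pos K by (subst ln_le_cancel_iff) auto
        also have "\<dots> = ln K - real n * h" using K by (simp add: ln_mult_pos)
        finally show ?thesis using pos by (intro mult_left_mono) auto
      qed simp
      then have "(\<Sum>w\<in>words P0 n. pr (?I n) w * ln (pr (?I n) w)) \<le> (\<Sum>w\<in>words P0 n. pr (?I n) w * (ln K - real n * h))"
        by (rule sum_mono)
      also have "\<dots> = ln K - real n * h" using sum_pr[OF lab] by (simp add: sum_distrib_right[symmetric])
      finally show ?thesis by (simp add: itinerary_entropy_def label_entropy_def)
    qed
    have "h - ln K / real n \<le> itinerary_entropy (cell P0) P0 n / real n" if "n \<ge> 1" for n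
      using divide_right_mono[OF low[of n], of "real n"] that by (simp add: field_simps)
    then have ev: "\<exists>N. \<forall>n\<ge>N. h - ln K / real n \<le> itinerary_entropy (cell P0) P0 n / real n" by blast
    have "(\<lambda>n. h - ln K / real n) \<longlonglongrightarrow> h - 0" by (intro tendsto_diff tendsto_const lim_const_over_n)
    then show ?thesis using LIMSEQ_le[OF _ itinerary_entropy_tendsto[OF P0] ev] by simp
  qed
  show ?thesis
    unfolding measure_entropy_def
  proof (rule antisym)
    show "(SUP P\<in>{P. finite P \<and> partition_on (space M) P \<and> P \<subseteq> events}. ereal (entropy_wrt M T P)) \<le> ereal h"
      using upper by (intro SUP_least) auto
    show "ereal h \<le> (SUP P\<in>{P. finite P \<and> partition_on (space M) P \<and> P \<subseteq> events}. ereal (entropy_wrt M T P))"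
      using P0 lower by (intro SUP_upper2[of P0]) auto
  qed
qed

end

section \<open>Sets approximable by finite windows of a code\<close>

context preserving_system
begin

definition approximable :: "('a \<Rightarrow> 'c) \<Rightarrow> 'a set \<Rightarrow> bool" where
  "approximable C A \<longleftrightarrow> A \<in> events \<and>
    (\<forall>\<epsilon>>0. \<exists>m W. prob {x\<in>space M. (x \<in> A) \<noteq> (itinerary T C m x \<in> W)} \<le> \<epsilon>)"

lemma itinerary_sym_diff_events:
  assumes C: "labelling C D" and A: "A \<in> events"
  shows "{x\<in>space M. (x \<in> A) \<noteq> (itinerary T C m x \<in> W)} \<in> events"
proof -
  have W: "{x\<in>space M. itinerary T C m x \<in> W} \<in> events"
  proof (rule finite_valued_events[where Y = "itinerary T C m" and P = "\<lambda>w. w \<in> W"])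
    note l = labelling_itinerary[OF C, of m, unfolded labelling_def]
    show "finite (words D m)" using l by blast
    show "itinerary T C m x \<in> words D m" if "x \<in> space M" for x using l that by blast
    show "{x\<in>space M. itinerary T C m x = w} \<in> events" for w using l by blast
  qed
  have "{x\<in>space M. (x \<in> A) \<noteq> (itinerary T C m x \<in> W)} =
      (A - {x\<in>space M. itinerary T C m x \<in> W}) \<union> ({x\<in>space M. itinerary T C m x \<in> W} - A)"
    using sets.sets_into_space[OF A] by auto
  also have "\<dots> \<in> events" using A W by blast
  finally show ?thesis .
qed

lemma approximable_Compl:
  assumes "approximable C A" shows "approximable C (space M - A)"
  unfolding approximable_def
proof (intro conjI allI impI)
  show "space M - A \<in> events" using assms by (auto simp: approximable_def)
  fix \<epsilon> :: real assume "0 < \<epsilon>"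
  then obtain m W where "prob {x\<in>space M. (x \<in> A) \<noteq> (itinerary T C m x \<in> W)} \<le> \<epsilon>"
    using assms by (auto simp: approximable_def)
  moreover have "{x\<in>space M. (x \<in> space M - A) \<noteq> (itinerary T C m x \<in> - W)} = {x\<in>space M. (x \<in> A) \<noteq> (itinerary T C m x \<in> W)}"
    by auto
  ultimately have "prob {x\<in>space M. (x \<in> space M - A) \<noteq> (itinerary T C m x \<in> - W)} \<le> \<epsilon>" by simp
  then show "\<exists>m W. prob {x\<in>space M. (x \<in> space M - A) \<noteq> (itinerary T C m x \<in> W)} \<le> \<epsilon>" by blast
qed

lemma approximable_Un:
  assumes C: "labelling C D" and A: "approximable C A" and B: "approximable C B"
  shows "approximable C (A \<union> B)"
  unfolding approximable_def
proof (intro conjI allI impI)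
  show "A \<union> B \<in> events" using A B by (auto simp: approximable_def)
  fix \<epsilon> :: real assume e: "0 < \<epsilon>"
  then have e2: "0 < \<epsilon> / 2" by simp
  obtain m V where V: "prob {x\<in>space M. (x \<in> A) \<noteq> (itinerary T C m x \<in> V)} \<le> \<epsilon> / 2"
    using A e2 unfolding approximable_def by blast
  obtain k W where W: "prob {x\<in>space M. (x \<in> B) \<noteq> (itinerary T C k x \<in> W)} \<le> \<epsilon> / 2"
    using B e2 unfolding approximable_def by blast
  let ?U = "{w. take m w \<in> V \<or> take k w \<in> W}"
  have "prob {x\<in>space M. (x \<in> A \<union> B) \<noteq> (itinerary T C (max m k) x \<in> ?U)} \<le>
      prob ({x\<in>space M. (x \<in> A) \<noteq> (itinerary T C m x \<in> V)} \<union> {x\<in>space M. (x \<in> B) \<noteq> (itinerary T C k x \<in> W)})"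
    using A B by (intro finite_measure_mono sets.Un itinerary_sym_diff_events[OF C])
      (auto simp: take_itinerary approximable_def)
  also have "\<dots> \<le> prob {x\<in>space M. (x \<in> A) \<noteq> (itinerary T C m x \<in> V)} + prob {x\<in>space M. (x \<in> B) \<noteq> (itinerary T C k x \<in> W)}"
    using A B by (intro measure_Un_le itinerary_sym_diff_events[OF C]) (auto simp: approximable_def)
  also have "\<dots> \<le> \<epsilon>" using V W by simp
  finally show "\<exists>m W. prob {x\<in>space M. (x \<in> A \<union> B) \<noteq> (itinerary T C m x \<in> W)} \<le> \<epsilon>" by blast
qed

lemma approximable_empty: "approximable C {}"
  unfolding approximable_def by (auto intro!: exI[of _ "{}"])

lemma approximable_finite_UN:
  assumes C: "labelling C D" and "finite I" "\<And>i. i \<in> I \<Longrightarrow> approximable C (A i)"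
  shows "approximable C (\<Union>i\<in>I. A i)"
  using assms(2,3) by (induction I) (auto intro: approximable_empty approximable_Un[OF C])

text \<open>By continuity from below a finite partial union already misses at most \<epsilon>/2, and
  finite unions are approximable.\<close>

lemma approximable_UN:
  fixes A :: "nat \<Rightarrow> 'a set"
  assumes C: "labelling C D" and A: "\<And>n. approximable C (A n)"
  shows "approximable C (\<Union>n. A n)"
  unfolding approximable_def
proof (intro conjI allI impI)
  have Aev: "A n \<in> events" for n using A by (auto simp: approximable_def)
  then show U: "(\<Union>n. A n) \<in> events" by auto
  fix \<epsilon> :: real assume e: "0 < \<epsilon>"
  then have e2: "0 < \<epsilon> / 2" by simp
  define B where "B n = (\<Union>i\<le>n. A i)" for n
  have B: "approximable C (B n)" for n unfolding B_def by (intro approximable_finite_UN[OF C] A) auto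
  then have Bev: "B n \<in> events" for n by (auto simp: approximable_def)
  have "(\<lambda>n. prob (B n)) \<longlonglongrightarrow> prob (\<Union>n. B n)"
  proof (intro finite_Lim_measure_incseq)
    show "incseq B" unfolding incseq_def B_def by (intro allI impI UN_mono) auto
  qed (use Bev in auto)
  also have "(\<Union>n. B n) = (\<Union>n. A n)" by (auto simp: B_def)
  finally obtain n where "norm (prob (B n) - prob (\<Union>n. A n)) < \<epsilon> / 2" using LIMSEQ_D e2 by blast
  moreover have "prob ((\<Union>n. A n) - B n) = prob (\<Union>n. A n) - prob (B n)"
    using U Bev by (intro finite_measure_Diff) (auto simp: B_def)
  ultimately have d: "prob ((\<Union>n. A n) - B n) \<le> \<epsilon> / 2" by (simp add: abs_if split: if_splits)
  obtain m W where W: "prob {x\<in>space M. (x \<in> B n) \<noteq> (itinerary T C m x \<in> W)} \<le> \<epsilon> / 2"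
    using B[of n] e2 unfolding approximable_def by blast
  have "prob {x\<in>space M. (x \<in> (\<Union>n. A n)) \<noteq> (itinerary T C m x \<in> W)} \<le>
      prob (((\<Union>n. A n) - B n) \<union> {x\<in>space M. (x \<in> B n) \<noteq> (itinerary T C m x \<in> W)})"
    using U Bev by (intro finite_measure_mono sets.Un itinerary_sym_diff_events[OF C]) (auto simp: B_def)
  also have "\<dots> \<le> prob ((\<Union>n. A n) - B n) + prob {x\<in>space M. (x \<in> B n) \<noteq> (itinerary T C m x \<in> W)}"
    using U Bev by (intro measure_Un_le itinerary_sym_diff_events[OF C]) auto
  also have "\<dots> \<le> \<epsilon>" using d W by simp
  finally show "\<exists>m W. prob {x\<in>space M. (x \<in> (\<Union>n. A n)) \<noteq> (itinerary T C m x \<in> W)} \<le> \<epsilon>" by blast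
qed

end

lemma itinerary_Suc: "itinerary T X (Suc n) x = X x # itinerary T X n (T x)"
  unfolding itinerary_def by (simp add: upt_conv_Cons map_Suc_upt[symmetric] funpow_swap1 del: upt_Suc)

section \<open>Digits and cylinders of compositions of greedy maps\<close>

primrec digits :: "real list \<Rightarrow> real \<Rightarrow> int list" where
  "digits [] x = []"
| "digits (c # cs) x = \<lfloor>c * x\<rfloor> # digits cs (greedy_map c x)"

text \<open>These are the left ends of the digit cylinders, by \<open>cylinder_left_end\<close>;
  counting them bounds the number of words.\<close>

definition zero_preimages :: "real list \<Rightarrow> real set" where
  "zero_preimages cs = {x\<in>{0..<1}. fold greedy_map cs x = 0}"

lemma greedy_map_shift:
  assumes "0 \<le> y" "y < 1" "c > 0"
  shows "greedy_map c ((y + of_int d) / c) = y" "\<lfloor>c * ((y + of_int d) / c)\<rfloor> = d"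
  using assms by (auto simp: greedy_map_def floor_unique)

text \<open>All branches of the composition have the same slope, the product of the list, so the
  iterated transfer operator at 0 is an equally weighted sum over the preimages of 0. A general f is
  needed because each step of the induction replaces it by its transfer.\<close>

lemma sum_zero_preimages:
  assumes "\<forall>c\<in>set cs. c > 0" and "\<And>x. 1 \<le> x \<Longrightarrow> f x = 0"
  shows "finite (zero_preimages cs) \<and> (\<Sum>x\<in>zero_preimages cs. f x) = prod_list cs * fold transfer cs f 0"
  using assms
proof (induction cs arbitrary: f)
  case Nil
  have "zero_preimages [] = {0}" by (auto simp: zero_preimages_def)
  then show ?case by simp
next
  case (Cons c cs)
  have c: "c > 0" using Cons.prems by simp
  have t0: "transfer c f x = 0" if "1 \<le> x" for x using that by (simp add: transfer_def)
  have IH: "finite (zero_preimages cs)"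
    "(\<Sum>x\<in>zero_preimages cs. transfer c f x) = prod_list cs * fold transfer cs (transfer c f) 0"
    using Cons.IH[of "transfer c f"] Cons.prems(1) by (auto intro: t0)
  define e where "e = (\<lambda>(y, d). (y + real d) / c)"
  \<comment> \<open>In the incomplete last branch some candidates are at least 1; they are no
    preimages in [0,1), and f is 0 there.\<close>
  define J where "J = {yd \<in> zero_preimages cs \<times> {..<nat \<lceil>c\<rceil>}. e yd < 1}"
  have finJ: "finite J" unfolding J_def using IH(1) by auto
  have unit: "0 \<le> y" "y < 1" if "y \<in> zero_preimages cs" for y using that by (auto simp: zero_preimages_def)
  have inj: "inj_on e J"
  proof (rule inj_onI)
    fix u v assume uv: "u \<in> J" "v \<in> J" "e u = e v"
    obtain y d y' d' where [simp]: "u = (y, d)" "v = (y', d')" by (cases u, cases v)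
    have y: "y \<in> zero_preimages cs" "y' \<in> zero_preimages cs" using uv by (auto simp: J_def)
    have eq: "(y + of_int (int d)) / c = (y' + of_int (int d')) / c" using uv by (simp add: e_def)
    have "y = y'" using greedy_map_shift(1)[OF unit[OF y(1)] c, of "int d"] greedy_map_shift(1)[OF unit[OF y(2)] c, of "int d'"] unfolding eq by simp
    moreover have "int d = int d'" using greedy_map_shift(2)[OF unit[OF y(1)] c, of "int d"] greedy_map_shift(2)[OF unit[OF y(2)] c, of "int d'"] unfolding eq by simp
    ultimately show "u = v" by simp
  qed
  have img: "e ` J = zero_preimages (c # cs)"
  proof (intro equalityI subsetI)
    fix x assume "x \<in> e ` J"
    then obtain y d where x: "x = (y + of_int (int d)) / c" "y \<in> zero_preimages cs" "x < 1" by (auto simp: J_def e_def)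
    then show "x \<in> zero_preimages (c # cs)"
      using greedy_map_shift(1)[OF unit[OF x(2)] c, of "int d"] unit[OF x(2)] c by (auto simp: zero_preimages_def)
  next
    fix x assume x: "x \<in> zero_preimages (c # cs)"
    then have x01: "0 \<le> x" "x < 1" by (auto simp: zero_preimages_def)
    let ?u = "(greedy_map c x, nat \<lfloor>c * x\<rfloor>)"
    have eu: "e ?u = x" using x01 c by (simp add: e_def greedy_map_def)
    moreover have "?u \<in> J" using x x01 eu floor_less_ceiling[OF c x01] greedy_map_range[of c x]
      by (auto simp: J_def zero_preimages_def)
    ultimately show "x \<in> e ` J" by (metis image_eqI)
  qed
  have "(\<Sum>x\<in>zero_preimages (c # cs). f x) = (\<Sum>u\<in>J. f (e u))"
    unfolding img[symmetric] by (subst sum.reindex[OF inj]) simp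
  also have "\<dots> = (\<Sum>u\<in>zero_preimages cs \<times> {..<nat \<lceil>c\<rceil>}. f (e u))"
    using IH(1) Cons.prems(2) by (intro sum.mono_neutral_left) (auto simp: J_def not_less)
  also have "\<dots> = (\<Sum>y\<in>zero_preimages cs. \<Sum>d<nat \<lceil>c\<rceil>. f ((y + real d) / c))"
    by (subst sum.cartesian_product) (simp add: e_def case_prod_unfold)
  also have "\<dots> = (\<Sum>y\<in>zero_preimages cs. c * transfer c f y)"
    using unit c by (intro sum.cong refl) (simp add: transfer_def)
  also have "\<dots> = c * (prod_list cs * fold transfer cs (transfer c f) 0)"
    by (simp add: sum_distrib_left[symmetric] IH(2))
  finally show ?case using finite_imageI[OF finJ, of e] unfolding img by (simp add: mult.assoc)
qed

lemma fold_greedy_range: "0 \<le> x \<Longrightarrow> x < 1 \<Longrightarrow> fold greedy_map cs x \<in> {0..<1}"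
  using greedy_map_range by (induction cs arbitrary: x) auto

text \<open>On a cylinder the composition is affine with slope \<open>prod_list cs\<close>, so the
  subtracted quotient is the distance to the zero of this affine function. Incomplete branches are
  cut on the right only, so the zero still belongs to the cylinder.\<close>

lemma cylinder_left_end:
  assumes "\<forall>c\<in>set cs. c > 0" and "0 \<le> x" "x < 1"
  shows "x - fold greedy_map cs x / prod_list cs \<in> zero_preimages cs \<and>
    digits cs (x - fold greedy_map cs x / prod_list cs) = digits cs x"
  using assms
proof (induction cs arbitrary: x)
  case Nil
  then show ?case by (simp add: zero_preimages_def)
next
  case (Cons c cs)
  have c: "c > 0" using Cons.prems by simp
  let ?y = "greedy_map c x"
  let ?z = "?y - fold greedy_map cs ?y / prod_list cs"
  have IH: "?z \<in> zero_preimages cs" "digits cs ?z = digits cs ?y"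
    using Cons.IH[of ?y] Cons.prems greedy_map_range[of c x] by auto
  then have z: "0 \<le> ?z" "?z < 1" "fold greedy_map cs ?z = 0" by (auto simp: zero_preimages_def)
  have eq: "x - fold greedy_map (c # cs) x / prod_list (c # cs) = (?z + of_int \<lfloor>c * x\<rfloor>) / c"
    using c by (simp add: greedy_map_def field_simps)
  have pos: "prod_list cs \<ge> 0" using Cons.prems by (intro prod_list_nonneg) auto
  have "fold greedy_map cs ?y \<ge> 0"
    using fold_greedy_range[of ?y cs] greedy_map_range[of c x] by simp
  then have "?z \<le> ?y" using pos by simp
  then have "(?z + of_int \<lfloor>c * x\<rfloor>) / c \<le> (?y + of_int \<lfloor>c * x\<rfloor>) / c" using c by (intro divide_right_mono) auto
  also have "\<dots> = x" using c by (simp add: greedy_map_def)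
  finally have "(?z + of_int \<lfloor>c * x\<rfloor>) / c \<le> x" .
  then have less: "(?z + of_int \<lfloor>c * x\<rfloor>) / c < 1" using Cons.prems(3) by (rule le_less_trans)
  have ge: "0 \<le> (?z + of_int \<lfloor>c * x\<rfloor>) / c" using z c Cons.prems by simp
  show ?case unfolding eq
    using greedy_map_shift[OF z(1,2) c, of "\<lfloor>c * x\<rfloor>"] z(3) IH(2) less ge
    by (simp add: zero_preimages_def)
qed

text \<open>Undoing the maps one by one, the left end of the cylinder is computed from the digits
  alone.\<close>

lemma digits_determine:
  assumes "\<forall>c\<in>set cs. c > 0" and "digits cs x = digits cs y"
  shows "x - fold greedy_map cs x / prod_list cs = y - fold greedy_map cs y / prod_list cs"
  using assms
proof (induction cs arbitrary: x y)
  case (Cons c cs)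
  have c: "c > 0" and d: "\<lfloor>c * x\<rfloor> = \<lfloor>c * y\<rfloor>" using Cons.prems by auto
  have eq: "x - fold greedy_map (c # cs) x / prod_list (c # cs)
      = (greedy_map c x - fold greedy_map cs (greedy_map c x) / prod_list cs + of_int \<lfloor>c * x\<rfloor>) / c" for x
    using c by (simp add: greedy_map_def field_simps)
  have "greedy_map c x - fold greedy_map cs (greedy_map c x) / prod_list cs
      = greedy_map c y - fold greedy_map cs (greedy_map c y) / prod_list cs"
    using Cons.prems by (intro Cons.IH) auto
  then show ?case by (simp only: eq d)
qed simp

lemma digits_dist:
  assumes cs: "\<forall>c\<in>set cs. c > 0" and eq: "digits cs x = digits cs y"
    and xy: "0 \<le> x" "x < 1" "0 \<le> y" "y < 1"
  shows "y < x + 1 / prod_list cs"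
proof -
  have pos: "prod_list cs > 0" using cs by (induction cs) auto
  have "y = x + (fold greedy_map cs y - fold greedy_map cs x) / prod_list cs"
    using digits_determine[OF cs eq] by (simp add: diff_divide_distrib)
  also have "(fold greedy_map cs y - fold greedy_map cs x) / prod_list cs < 1 / prod_list cs"
    using fold_greedy_range[OF xy(1,2), of cs] fold_greedy_range[OF xy(3,4), of cs] pos
    by (intro divide_strict_right_mono) auto
  finally show ?thesis by simp
qed

lemma cylinder_subset:
  assumes cs: "\<forall>c\<in>set cs. c > 0"
  shows "\<exists>v. {x\<in>{0..<1}. digits cs x = w} \<subseteq> {v..<v + 1 / prod_list cs}"
proof (cases "{x\<in>{0..<1}. digits cs x = w} = {}")
  case False
  then obtain x where x: "0 \<le> x" "x < 1" "digits cs x = w" by auto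
  have pos: "prod_list cs > 0" using cs by (induction cs) auto
  have "y \<in> {x - fold greedy_map cs x / prod_list cs ..< x - fold greedy_map cs x / prod_list cs + 1 / prod_list cs}"
    if y: "0 \<le> y" "y < 1" "digits cs y = w" for y
  proof -
    have "0 \<le> fold greedy_map cs y / prod_list cs" "fold greedy_map cs y / prod_list cs < 1 / prod_list cs"
      using fold_greedy_range[OF y(1,2), of cs] pos by (auto intro: divide_strict_right_mono)
    moreover have "y = x - fold greedy_map cs x / prod_list cs + fold greedy_map cs y / prod_list cs"
      using digits_determine[OF cs, of x y] x y by simp
    ultimately show ?thesis unfolding atLeastLessThan_iff by linarith
  qed
  then show ?thesis by (intro exI[of _ "x - fold greedy_map cs x / prod_list cs"]) auto
qed auto

lemma card_digits:
  assumes b: "b > 1" and cs: "\<forall>c\<in>set cs. b \<le> c"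
  shows "finite (digits cs ` {0..<1}) \<and> real (card (digits cs ` {0..<1})) \<le> sup_bound b * prod_list cs"
proof -
  have cs0: "\<forall>c\<in>set cs. c > 0" using b cs by force
  have f: "unit_density (sup_bound b) (indicator {0..<1})"
    using decreasing_density_indicator[of 1] b by (simp add: unit_density_def mass_def sup_bound_def)
  have "finite (zero_preimages cs) \<and>
      (\<Sum>x\<in>zero_preimages cs. indicator {0..<1} x :: real) = prod_list cs * fold transfer cs (indicator {0..<1}) 0"
    using sum_zero_preimages[OF cs0, of "indicator {0..<1}"] by simp
  moreover have "(\<Sum>x\<in>zero_preimages cs. indicator {0..<1} x :: real) = (\<Sum>x\<in>zero_preimages cs. 1)"
    by (intro sum.cong) (auto simp: zero_preimages_def)
  moreover have "prod_list cs * fold transfer cs (indicator {0..<1}) 0 \<le> prod_list cs * sup_bound b"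
    using unit_density_fold[OF b cs f] cs0
    by (intro mult_left_mono prod_list_nonneg) (auto simp: unit_density_def intro: less_imp_le)
  ultimately have fin: "finite (zero_preimages cs)" and card: "real (card (zero_preimages cs)) \<le> sup_bound b * prod_list cs"
    by (auto simp: mult.commute)
  have sub: "digits cs ` {0..<1} \<subseteq> digits cs ` zero_preimages cs"
  proof (rule image_subsetI)
    fix x :: real assume "x \<in> {0..<1}"
    with cylinder_left_end[OF cs0, of x] show "digits cs x \<in> digits cs ` zero_preimages cs"
      by (auto intro: rev_image_eqI)
  qed
  have "card (digits cs ` {0..<1}) \<le> card (digits cs ` zero_preimages cs)"
    using sub fin by (intro card_mono) auto
  also have "\<dots> \<le> card (zero_preimages cs)" using fin by (rule card_image_le)
  finally show ?thesis using card sub fin by (meson finite_imageI finite_subset of_nat_le_iff order_trans)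
qed

section \<open>Finite unions of fibres\<close>

lemma fibre_setsE:
  assumes "E \<in> fibre_sets p M"
  obtains B where "E = (SIGMA i:{..<p}. B i)" "\<And>i. i < p \<Longrightarrow> B i \<in> sets (M i)"
  using assms by (auto simp: fibre_sets_def)

lemma fibre_setsI: "(\<And>i. i < p \<Longrightarrow> B i \<in> sets (M i)) \<Longrightarrow> (SIGMA i:{..<p}. B i) \<in> fibre_sets p M"
  by (auto simp: fibre_sets_def)

lemma fibre_sets_cong:
  "(\<And>i. i < p \<Longrightarrow> sets (M i) = sets (N i)) \<Longrightarrow> fibre_sets p M = fibre_sets p N"
  by (auto simp: fibre_sets_def)

lemma fibre_map_vimage:
  assumes "\<And>i. i < p \<Longrightarrow> \<sigma> i < p"
  shows "(\<lambda>(i, x). (\<sigma> i, F i x)) -` (SIGMA i:{..<p}. B i) \<inter> (SIGMA i:{..<p}. S i)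
    = (SIGMA i:{..<p}. F i -` B (\<sigma> i) \<inter> S i)"
  using assms by auto

lemma measurable_fibre_map:
  assumes \<sigma>: "\<And>i. i < p \<Longrightarrow> \<sigma> i < p" and F: "\<And>i. i < p \<Longrightarrow> F i \<in> measurable (M i) (N (\<sigma> i))"
    and A: "sets A = fibre_sets p M" and B: "sets B = fibre_sets p N"
  shows "(\<lambda>(i, x). (\<sigma> i, F i x)) \<in> measurable A B"
proof -
  have sp: "space A = (SIGMA i:{..<p}. space (M i))" "space B = (SIGMA i:{..<p}. space (N i))"
    using sets_eq_imp_space_eq[of A "fibre_algebra p M"] sets_eq_imp_space_eq[of B "fibre_algebra p N"] A B
    by (auto simp: sets_fibre_algebra space_fibre_algebra)
  show ?thesis
  proof (rule measurableI)
    fix z assume "z \<in> space A"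
    then show "(\<lambda>(i, x). (\<sigma> i, F i x)) z \<in> space B"
      unfolding sp using \<sigma> measurable_space[OF F] by auto
  next
    fix E assume "E \<in> sets B"
    then obtain D where D: "E = (SIGMA i:{..<p}. D i)" "\<And>i. i < p \<Longrightarrow> D i \<in> sets (N i)"
      unfolding B by (rule fibre_setsE) blast
    show "(\<lambda>(i, x). (\<sigma> i, F i x)) -` E \<inter> space A \<in> sets A"
    proof -
      have eq: "(\<lambda>(i, x). (\<sigma> i, F i x)) -` (SIGMA i:{..<p}. D i) \<inter> (SIGMA i:{..<p}. space (M i))
          = (SIGMA i:{..<p}. F i -` D (\<sigma> i) \<inter> space (M i))"
        using \<sigma> by (rule fibre_map_vimage)
      show ?thesis
        unfolding D(1) sp(1) A eq using D(2) \<sigma> by (intro fibre_setsI measurable_sets[OF F]) auto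
    qed
  qed
qed

lemma emeasure_fibre_measure_eq_0:
  assumes B: "\<And>i. i < p \<Longrightarrow> B i \<in> sets (M i)"
  shows "emeasure (fibre_measure p M) (SIGMA i:{..<p}. B i) = 0 \<longleftrightarrow> (\<forall>i<p. emeasure (M i) (B i) = 0)"
proof -
  have "emeasure (fibre_measure p M) (SIGMA i:{..<p}. B i) = (\<Sum>i<p. emeasure (M i) (B i)) / of_nat p"
    using B by (rule emeasure_fibre_measure)
  then show ?thesis by (simp only:) (auto simp: divide_ennreal_def)
qed

lemma prob_space_fibre_measure:
  assumes p: "p \<ge> 1" and M: "\<And>i. i < p \<Longrightarrow> prob_space (M i)"
  shows "prob_space (fibre_measure p M)"
proof (rule prob_spaceI)
  have "emeasure (fibre_measure p M) (space (fibre_measure p M)) = (\<Sum>i<p. emeasure (M i) (space (M i))) / of_nat p"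
    unfolding space_fibre_measure by (rule emeasure_fibre_measure) simp
  also have "(\<Sum>i<p. emeasure (M i) (space (M i))) = (\<Sum>i<p. 1)"
    using M by (intro sum.cong) (auto simp: prob_space.emeasure_space_1)
  also have "\<dots> / of_nat p = 1" using p by (simp add: ennreal_divide_self ennreal_of_nat_eq_real_of_nat)
  finally show "emeasure (fibre_measure p M) (space (fibre_measure p M)) = 1" .
qed

lemma fibre_measure_absolutely_continuous:
  assumes s: "\<And>i. i < p \<Longrightarrow> sets (M i) = sets (N i)"
    and ac: "\<And>i. i < p \<Longrightarrow> absolutely_continuous (M i) (N i)"
  shows "absolutely_continuous (fibre_measure p M) (fibre_measure p N)"
  unfolding absolutely_continuous_def
proof
  fix E assume E: "E \<in> null_sets (fibre_measure p M)"
  then have "E \<in> fibre_sets p M" by (auto simp: sets_fibre_measure[symmetric])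
  then obtain B where B: "E = (SIGMA i:{..<p}. B i)" "\<And>i. i < p \<Longrightarrow> B i \<in> sets (M i)"
    by (rule fibre_setsE) auto
  have "emeasure (M i) (B i) = 0" if "i < p" for i
    using emeasure_fibre_measure_eq_0[of p B M] B E that by (auto simp: null_sets_def)
  then have "emeasure (N i) (B i) = 0" if "i < p" for i
    using ac[OF that] B(2)[OF that] that by (auto simp: absolutely_continuous_def null_sets_def)
  then show "E \<in> null_sets (fibre_measure p N)"
    using emeasure_fibre_measure_eq_0[of p B N] B s
    by (auto simp: null_sets_def sets_fibre_measure intro!: fibre_setsI)
qed

lemma AE_fibre_measure:
  assumes B: "\<And>i. i < p \<Longrightarrow> {x\<in>space (M i). P (i, x)} \<in> sets (M i)"
  shows "(AE z in fibre_measure p M. P z) \<longleftrightarrow> (\<forall>i<p. AE x in M i. P (i, x))"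
proof -
  define D where "D i = {x\<in>space (M i). \<not> P (i, x)}" for i
  have D: "D i \<in> sets (M i)" if "i < p" for i
    using sets.compl_sets[OF B[OF that]] unfolding D_def by (rule back_subst[of "\<lambda>X. X \<in> _"]) auto
  have eq: "{z\<in>space (fibre_measure p M). \<not> P z} = (SIGMA i:{..<p}. D i)"
    by (auto simp: space_fibre_measure D_def)
  have "(AE z in fibre_measure p M. P z) \<longleftrightarrow> emeasure (fibre_measure p M) (SIGMA i:{..<p}. D i) = 0"
    by (rule AE_iff_measurable[OF _ eq]) (use D in \<open>auto simp: sets_fibre_measure intro!: fibre_setsI\<close>)
  also have "\<dots> \<longleftrightarrow> (\<forall>i<p. emeasure (M i) (D i) = 0)"
    using D by (rule emeasure_fibre_measure_eq_0)
  also have "\<dots> \<longleftrightarrow> (\<forall>i<p. AE x in M i. P (i, x))"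
    using AE_iff_measurable[OF D, of _ "\<lambda>x. P (_, x)"] unfolding D_def by blast
  finally show ?thesis .
qed

section \<open>Isomorphic systems\<close>

text \<open>No measure is fixed, only \<sigma>-algebras, and the two sides play symmetric roles.
  Each transport of measures therefore also runs backwards through \<open>swap\<close>, as
  uniqueness requires.\<close>

locale isomorphic_maps =
  fixes A :: "'a measure" and B :: "'b measure" and f :: "'a \<Rightarrow> 'b" and g :: "'b \<Rightarrow> 'a"
    and T :: "'a \<Rightarrow> 'a" and S :: "'b \<Rightarrow> 'b"
  assumes f [measurable]: "f \<in> measurable A B" and g [measurable]: "g \<in> measurable B A"
    and gf: "\<And>x. x \<in> space A \<Longrightarrow> g (f x) = x" and fg: "\<And>y. y \<in> space B \<Longrightarrow> f (g y) = y"
    and T [measurable]: "T \<in> measurable A A" and S [measurable]: "S \<in> measurable B B"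
    and fT: "\<And>x. x \<in> space A \<Longrightarrow> f (T x) = S (f x)"
begin

lemma swap: "isomorphic_maps B A g f S T"
proof
  fix y assume y: "y \<in> space B"
  then have gy: "g y \<in> space A" using measurable_space[OF g] by blast
  then have "g (f (T (g y))) = T (g y)" using gf measurable_space[OF T] by blast
  then show "g (S y) = T (g y)" using fT[OF gy] fg[OF y] by simp
qed (use f g gf fg T S in auto)

lemma invariant_distr:
  assumes s: "sets M = sets A" and inv: "invariant_measure M T"
  shows "invariant_measure (distr M B f) S"
proof -
  note [measurable_cong] = s
  have sp: "space M = space A" using s by (rule sets_eq_imp_space_eq)
  have d: "distr M M T = M" using inv by (simp add: invariant_measure_def)
  have "distr (distr M B f) (distr M B f) S = distr (distr M B f) B S" by (rule distr_cong) auto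
  also have "\<dots> = distr M B (S \<circ> f)" by (rule distr_distr) measurable
  also have "\<dots> = distr M B (f \<circ> T)" by (rule distr_cong) (auto simp: sp fT)
  also have "\<dots> = distr (distr M M T) B f" by (rule distr_distr[symmetric]) measurable
  finally show ?thesis unfolding d by (simp add: invariant_measure_def)
qed

lemma distr_absolutely_continuous:
  assumes s: "sets M = sets A" "sets N = sets A" and ac: "absolutely_continuous M N"
  shows "absolutely_continuous (distr M B f) (distr N B f)"
  unfolding absolutely_continuous_def
proof
  note [measurable_cong] = s
  fix E assume "E \<in> null_sets (distr M B f)"
  then have E: "E \<in> sets B" "f -` E \<inter> space M \<in> null_sets M"
    by (auto simp: null_sets_distr_iff)
  moreover have "space M = space N" using s by (metis sets_eq_imp_space_eq)
  ultimately have "f -` E \<inter> space N \<in> null_sets N" using ac by (auto simp: absolutely_continuous_def)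
  with E show "E \<in> null_sets (distr N B f)" by (simp add: null_sets_distr_iff)
qed

lemma prob_space_distr: "sets M = sets A \<Longrightarrow> prob_space M \<Longrightarrow> prob_space (distr M B f)"
  by (rule prob_space.prob_space_distr) (simp_all cong: measurable_cong_sets)

lemma distr_distr_inverse:
  assumes s: "sets M = sets A"
  shows "distr (distr M B f) A g = M"
proof -
  note [measurable_cong] = s
  have sp: "space M = space A" using s by (rule sets_eq_imp_space_eq)
  have "distr (distr M B f) A g = distr M A (g \<circ> f)" by (rule distr_distr) measurable
  also have "\<dots> = distr M M (\<lambda>x. x)" by (rule distr_cong) (auto simp: sp gf s)
  also have "\<dots> = M" by (rule distr_id2) simp
  finally show ?thesis .
qed

lemma ac_invariant_prob_distr:
  assumes s: "sets M = sets A" and N: "ac_invariant_prob M T N"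
  shows "ac_invariant_prob (distr M B f) S (distr N B f)"
  using N s unfolding ac_invariant_prob_def
  by (auto intro!: prob_space_distr distr_absolutely_continuous invariant_distr)

lemma ergodic_distr:
  assumes s: "sets M = sets A" and erg: "ergodic M T"
  shows "ergodic (distr M B f) S"
  unfolding ergodic_def
proof (intro conjI ballI impI)
  note [measurable_cong] = s
  have sp: "space M = space A" using s by (rule sets_eq_imp_space_eq)
  have M: "prob_space M" "invariant_measure M T"
    "\<And>E. E \<in> sets M \<Longrightarrow> T -` E \<inter> space M = E \<Longrightarrow> measure M E \<in> {0, 1}"
    using erg by (auto simp: ergodic_def)
  show "prob_space (distr M B f)" using s M(1) by (rule prob_space_distr)
  show "invariant_measure (distr M B f) S" using s M(2) by (rule invariant_distr)
  fix E assume "E \<in> sets (distr M B f)" and inv: "S -` E \<inter> space (distr M B f) = E"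
  then have E: "E \<in> sets B" and invB: "S -` E \<inter> space B = E" by auto
  have "measure (distr M B f) E = measure M (f -` E \<inter> space M)"
    using E by (intro measure_distr) auto
  moreover have "f -` E \<inter> space M \<in> sets M" using E by measurable
  moreover have "T -` (f -` E \<inter> space M) \<inter> space M = f -` E \<inter> space M"
  proof (intro set_eqI)
    fix x
    have "T x \<in> space A" "f x \<in> space B" if "x \<in> space A" using that measurable_space[OF T] measurable_space[OF f] by auto
    then show "x \<in> T -` (f -` E \<inter> space M) \<inter> space M \<longleftrightarrow> x \<in> f -` E \<inter> space M"
      using invB fT[of x] unfolding sp by auto
  qed
  ultimately show "measure (distr M B f) E \<in> {0, 1}" using M(3) by metis
qed

lemma itinerary_inverse:
  assumes y: "y \<in> space B"
  shows "itinerary S (\<lambda>y. X (g y)) n y = itinerary T X n (g y)"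
proof -
  interpret sw: isomorphic_maps B A g f S T by (rule swap)
  have "(S ^^ k) y \<in> space B \<and> g ((S ^^ k) y) = (T ^^ k) (g y)" for k
    using y measurable_space[OF S] by (induction k) (auto simp: sw.fT)
  then show ?thesis by (simp add: itinerary_def)
qed

text \<open>Instead of entropy itself, the hypotheses of the criterion
  \<open>measure_entropy_eqI\<close> are transported: the code composed with the inverse map
  produces the same words with the same probabilities.\<close>

lemma measure_entropy_distr:
  assumes s: "sets M = sets A" and M: "prob_space M" "invariant_measure M T"
    and C: "finite (C ` space M)" "\<And>c. {x\<in>space M. C x = c} \<in> sets M"
    and card: "\<And>n. real (card (itinerary T C n ` space M)) \<le> K * exp (real n * h)"
    and cyl: "\<And>n w. measure M {x\<in>space M. itinerary T C n x = w} \<le> K * exp (- (real n * h))"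
    and gen: "\<And>E. E \<in> sets M \<Longrightarrow> preserving_system.approximable M T C E"
  shows "measure_entropy (distr M B f) S = ereal h"
proof -
  note [measurable_cong] = s
  have sp: "space M = space A" using s by (rule sets_eq_imp_space_eq)
  interpret M: preserving_system M T using M by (simp add: preserving_system_def preserving_system_axioms_def)
  interpret N: preserving_system "distr M B f" S
    using prob_space_distr[OF s M(1)] invariant_distr[OF s M(2)]
    by (simp add: preserving_system_def preserving_system_axioms_def)
  have lab: "M.labelling C (C ` space M)" using C by (auto simp: M.labelling_def)
  have gB: "g ` space B = space M" unfolding sp
    using measurable_space[OF g] measurable_space[OF f] gf by force
  have ev: "{y\<in>space B. g y \<in> E} \<in> sets B" if "E \<in> sets M" for E using that by measurable
  have prob: "N.prob {y\<in>space B. P (g y)} = M.prob {x\<in>space M. P x}" if "{x\<in>space M. P x} \<in> sets M" for P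
  proof -
    have eqB: "{y\<in>space B. P (g y)} = {y\<in>space B. g y \<in> {x\<in>space M. P x}}" using gB by auto
    have "N.prob {y\<in>space B. P (g y)} = M.prob (f -` {y\<in>space B. P (g y)} \<inter> space M)"
      unfolding eqB by (rule measure_distr[OF _ ev[OF that]]) measurable
    also have "f -` {y\<in>space B. P (g y)} \<inter> space M = {x\<in>space M. P x}"
      using measurable_space[OF f] gf unfolding sp by auto
    finally show ?thesis .
  qed
  have it: "itinerary S (\<lambda>y. C (g y)) n ` space B = itinerary T C n ` space M" for n
    unfolding gB[symmetric] image_image by (intro image_cong refl itinerary_inverse)
  show ?thesis
  proof (rule N.measure_entropy_eqI[where C = "\<lambda>y. C (g y)" and K = K])
    show "finite ((\<lambda>y. C (g y)) ` space (distr M B f))"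
      using C(1) unfolding gB[symmetric] image_image by simp
    have "{y\<in>space B. C (g y) = c} = {y\<in>space B. g y \<in> {x\<in>space M. C x = c}}" for c using gB by auto
    then show "{y\<in>space (distr M B f). C (g y) = c} \<in> N.events" for c using ev[OF C(2), of c] by simp
    show "real (card (itinerary S (\<lambda>y. C (g y)) n ` space (distr M B f))) \<le> K * exp (real n * h)" for n
      using card[of n] by (simp add: it)
    show "N.prob {y\<in>space (distr M B f). itinerary S (\<lambda>y. C (g y)) n y = w} \<le> K * exp (- (real n * h))" for n w
    proof -
      have "{y\<in>space B. itinerary S (\<lambda>y. C (g y)) n y = w} = {y\<in>space B. itinerary T C n (g y) = w}"
        using itinerary_inverse by auto
      then show ?thesis
        using cyl[of n w] prob[of "\<lambda>x. itinerary T C n x = w"] M.labelling_itinerary[OF lab, of n]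
        by (simp add: M.labelling_def)
    qed
    fix E and \<epsilon> :: real assume "E \<in> N.events" and e: "0 < \<epsilon>"
    then have E: "E \<in> sets B" by simp
    define D where "D = f -` E \<inter> space M"
    have D: "D \<in> sets M" unfolding D_def using E by measurable
    then obtain m W where W: "M.prob {x\<in>space M. (x \<in> D) \<noteq> (itinerary T C m x \<in> W)} \<le> \<epsilon>"
      using gen[OF D] e unfolding M.approximable_def by blast
    have "{y\<in>space B. (y \<in> E) \<noteq> (itinerary S (\<lambda>y. C (g y)) m y \<in> W)} = {y\<in>space B. (g y \<in> D) \<noteq> (itinerary T C m (g y) \<in> W)}"
      using itinerary_inverse[of _ C m] fg gB by (auto simp: D_def)
    then have "N.prob {y\<in>space (distr M B f). (y \<in> E) \<noteq> (itinerary S (\<lambda>y. C (g y)) m y \<in> W)} \<le> \<epsilon>"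
      using W prob[OF M.itinerary_sym_diff_events[OF lab D, of m W]] by simp
    then show "\<exists>m W. N.prob {y\<in>space (distr M B f). (y \<in> E) \<noteq> (itinerary S (\<lambda>y. C (g y)) m y \<in> W)} \<le> \<epsilon>" by blast
  qed
qed

end

section \<open>The greedy skew product of an alternate base\<close>

definition greedy_skew :: "real list \<Rightarrow> nat \<times> real \<Rightarrow> nat \<times> real" where
  "greedy_skew b = (\<lambda>(i, x). ((i + 1) mod length b, greedy_map (base_at b (int i)) x))"

text \<open>The fibre index is part of the letter because the same digits may occur in several
  fibres.\<close>

definition digit_code :: "real list \<Rightarrow> nat \<times> real \<Rightarrow> nat \<times> int" where
  "digit_code b = (\<lambda>(i, x). (i, \<lfloor>base_at b (int i) * x\<rfloor>))"

definition base_block :: "real list \<Rightarrow> nat \<Rightarrow> nat \<Rightarrow> real list" where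
  "base_block b i n = map (\<lambda>k. base_at b (int i + int k)) [0..<n]"

lemma base_block_Suc: "base_block b i (Suc n) = base_at b (int i) # base_block b (Suc i) n"
  by (simp add: base_block_def upt_conv_Cons map_Suc_upt[symmetric] ac_simps del: upt_Suc)

lemma base_block_snoc: "base_block b i (Suc n) = base_block b i n @ [base_at b (int i + int n)]"
  by (simp add: base_block_def)

lemma length_base_block [simp]: "length (base_block b i n) = n"
  by (simp add: base_block_def)

lemma base_at_cong: "m mod int (length b) = n mod int (length b) \<Longrightarrow> base_at b m = base_at b n"
  by (simp add: base_at_def)

lemma base_block_mod: "base_block b (i mod length b) n = base_block b i n"
  unfolding base_block_def by (intro map_cong refl base_at_cong) (simp add: zmod_int mod_add_left_eq)

lemma sum_mod_shift: "(p :: nat) \<ge> 1 \<Longrightarrow> (\<Sum>i<p. G ((i + 1) mod p)) = (\<Sum>i<p. G i :: 'c :: comm_monoid_add)"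
proof (cases p)
  case (Suc q)
  have "(\<Sum>i<Suc q. G ((i + 1) mod Suc q)) = (\<Sum>i<q. G ((i + 1) mod Suc q)) + G 0" by simp
  also have "(\<Sum>i<q. G ((i + 1) mod Suc q)) = (\<Sum>i<q. G (Suc i))" by (intro sum.cong) auto
  also have "\<dots> + G 0 = (\<Sum>i<Suc q. G i)" by (simp add: sum.lessThan_Suc_shift add.commute del: sum.lessThan_Suc)
  finally show ?thesis using Suc by simp
qed simp

section \<open>Fibre measures, invariance and ergodicity of the skew product\<close>

locale alternate_base =
  fixes b :: "real list"
  assumes nonempty: "b \<noteq> []" and gt_1: "\<forall>c\<in>set b. 1 < c"
begin

abbreviation p :: nat where "p \<equiv> length b"

lemma p_pos: "p \<ge> 1" "p > 0" using nonempty by (auto simp: Suc_le_eq)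

definition min_base :: real where "min_base = Min (set b)"

lemma min_base: "min_base > 1" "base_at b n \<ge> min_base" "base_at b n > 1" "base_at b n > 0"
proof -
  have "nat (n mod int p) < p" using p_pos by (simp add: nat_less_iff)
  then have mem: "base_at b n \<in> set b" by (simp add: base_at_def)
  show 1: "min_base > 1" unfolding min_base_def using nonempty gt_1 by (subst Min_gr_iff) auto
  show 2: "base_at b n \<ge> min_base" unfolding min_base_def using mem by (intro Min_le) auto
  show "base_at b n > 1" "base_at b n > 0" using 1 2 by auto
qed

lemma base_block_ge: "\<forall>c\<in>set (base_block b i n). min_base \<le> c" "\<forall>c\<in>set (base_block b i n). c > 0"
  using min_base by (auto simp: base_block_def)

lemma prod_base_block_pos: "prod_list (base_block b i n) > 0"
proof -
  have "\<forall>c\<in>set cs. c > 0 \<Longrightarrow> prod_list cs > 0" for cs :: "real list" by (induction cs) auto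
  then show ?thesis using base_block_ge by blast
qed

text \<open>The indices i - p, ..., i - 1 and i, ..., i + p - 1 agree modulo p. The second form is
  the one that iterates of the skew product produce.\<close>

lemma greedy_return_eq: "greedy_return b i = fold greedy_map (base_block b i p)"
proof -
  have "[int i - int p..int i - 1] = map (\<lambda>k. int i - int p + int k) [0..<p]"
    by (rule nth_equalityI) (auto simp: nth_upto)
  moreover have "greedy_return b i = fold greedy_map (map (base_at b) [int i - int p..int i - 1])"
    by (simp add: greedy_return_def fold_map comp_def)
  ultimately have "greedy_return b i = fold greedy_map (map (base_at b) (map (\<lambda>k. int i - int p + int k) [0..<p]))"
    by (simp only:)
  also have "map (base_at b) (map (\<lambda>k. int i - int p + int k) [0..<p]) = base_block b i p"
    unfolding base_block_def map_map comp_def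
  proof (intro map_cong refl base_at_cong)
    fix k
    have "int i + int k = (int i - int p + int k) + int p" by simp
    then show "(int i - int p + int k) mod int p = (int i + int k) mod int p" by (metis mod_add_self2)
  qed
  finally show ?thesis .
qed

lemma mu_fibre_mod: "mu_fibre b (i mod p) = mu_fibre b i"
  unfolding mu_fibre_def greedy_return_eq base_block_mod ..

text \<open>This settles the \<open>THE\<close> in \<open>mu_fibre\<close>. The density found above
  is positive on [0,1), so its measure has the null sets of Lebesgue measure, and competitors
  absolutely continuous for one are so for the other.\<close>

lemma mu_fibre_density:
  obtains h \<epsilon> where "decreasing_density h" "h 0 \<le> sup_bound min_base" "\<epsilon> > 0" "\<And>x. 0 \<le> x \<Longrightarrow> x < 1 \<Longrightarrow> \<epsilon> \<le> h x"
    "mu_fibre b i = density lebesgue01 (\<lambda>x. ennreal (h x))"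
    "ac_invariant_prob lebesgue01 (greedy_return b i) (mu_fibre b i)"
    "\<And>N. ac_invariant_prob lebesgue01 (greedy_return b i) N \<Longrightarrow> N = mu_fibre b i"
    "ae_ergodic (mu_fibre b i) (greedy_return b i)"
proof -
  interpret expanding_composition "base_block b i p" min_base
    using min_base base_block_ge p_pos by unfold_locales (auto simp flip: length_greater_0_conv)
  let ?S = "greedy_return b i"
  obtain h \<epsilon> where h: "decreasing_density h" "h 0 \<le> sup_bound min_base" "\<epsilon> > 0" "\<And>x. 0 \<le> x \<Longrightarrow> x < 1 \<Longrightarrow> \<epsilon> \<le> h x"
    and N: "prob_space (density lebesgue01 (\<lambda>x. ennreal (h x)))"
      "invariant_measure (density lebesgue01 (\<lambda>x. ennreal (h x))) ?S"
      "ae_ergodic (density lebesgue01 (\<lambda>x. ennreal (h x))) ?S"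
    unfolding greedy_return_eq by (rule acip_facts) blast
  let ?N = "density lebesgue01 (\<lambda>x. ennreal (h x))"
  have null: "null_sets ?N = null_sets lebesgue01"
    using h by (intro density_lebesgue01_null_sets decreasing_density_measurable) (auto intro: less_le_trans)
  have ac: "ac_invariant_prob lebesgue01 ?S ?N"
    using N null by (simp add: ac_invariant_prob_def absolutely_continuous_def)
  have uniq: "N' = ?N" if "ac_invariant_prob lebesgue01 ?S N'" for N'
    using that null by (intro ac_invariant_unique[OF N]) (auto simp: ac_invariant_prob_def absolutely_continuous_def)
  have eq: "mu_fibre b i = ?N" unfolding mu_fibre_def using ac uniq by (rule the_equality)
  show thesis using that[of h \<epsilon>] h N ac uniq unfolding eq by blast
qed

lemma mu_fibre_acip: "ac_invariant_prob lebesgue01 (greedy_return b i) (mu_fibre b i)"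
  and mu_fibre_unique: "ac_invariant_prob lebesgue01 (greedy_return b i) N \<Longrightarrow> N = mu_fibre b i"
  and mu_fibre_ae_ergodic: "ae_ergodic (mu_fibre b i) (greedy_return b i)"
  by (rule mu_fibre_density[of i]; blast)+

lemma sets_mu_fibre [simp, measurable_cong]: "sets (mu_fibre b i) = sets lebesgue01"
  using mu_fibre_acip[of i] by (simp add: ac_invariant_prob_def)

lemma space_mu_fibre [simp]: "space (mu_fibre b i) = {0..<1}"
  using sets_eq_imp_space_eq[OF sets_mu_fibre] by simp

lemma prob_space_mu_fibre: "prob_space (mu_fibre b i)"
  using mu_fibre_acip[of i] by (simp add: ac_invariant_prob_def)

lemma null_sets_mu_fibre: "null_sets (mu_fibre b i) = null_sets lebesgue01"
proof (rule mu_fibre_density[of i])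
  fix h \<epsilon> assume "decreasing_density h" "\<epsilon> > 0" "\<And>x. 0 \<le> x \<Longrightarrow> x < 1 \<Longrightarrow> \<epsilon> \<le> h x"
    "mu_fibre b i = density lebesgue01 (\<lambda>x. ennreal (h x))"
  then show ?thesis
    using density_lebesgue01_null_sets[of h] by (auto intro!: decreasing_density_measurable intro: less_le_trans)
qed

lemma mu_fibre_interval:
  assumes r: "0 \<le> r"
  shows "emeasure (mu_fibre b i) ({v..<v + r} \<inter> {0..<1}) \<le> ennreal (sup_bound min_base * r)"
proof (rule mu_fibre_density[of i])
  fix h assume h: "decreasing_density h" "h 0 \<le> sup_bound min_base"
    and mu: "mu_fibre b i = density lebesgue01 (\<lambda>x. ennreal (h x))"
  have M: "sup_bound min_base \<ge> 0" using min_base by (simp add: sup_bound_def)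
  have "emeasure (mu_fibre b i) ({v..<v + r} \<inter> {0..<1}) = (\<integral>\<^sup>+x. ennreal (h x) * indicator ({v..<v + r} \<inter> {0..<1}) x \<partial>lborel)"
    unfolding mu using h by (intro emeasure_density_lebesgue01 decreasing_density_measurable) (auto simp: sets_lebesgue01_iff)
  also have "\<dots> \<le> (\<integral>\<^sup>+x. ennreal (sup_bound min_base) * indicator {v..<v + r} x \<partial>lborel)"
    using h decreasing_density_le[OF h(1)]
    by (intro nn_integral_mono) (auto simp: indicator_def intro!: ennreal_leI intro: order_trans)
  also have "\<dots> = ennreal (sup_bound min_base) * ennreal r" using r by (simp add: nn_integral_cmult)
  finally show ?thesis using M r by (simp add: ennreal_mult)
qed

text \<open>One greedy step intertwines the return maps of consecutive fibres. The image measure is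
  thus invariant for the next return map and absolutely continuous, and uniqueness identifies
  it.\<close>

lemma distr_mu_fibre: "distr (mu_fibre b i) lebesgue01 (greedy_map (base_at b (int i))) = mu_fibre b (Suc i)"
proof (rule mu_fibre_unique)
  let ?T = "greedy_map (base_at b (int i))" and ?S = "greedy_return b i" and ?S' = "greedy_return b (Suc i)"
  let ?N = "distr (mu_fibre b i) lebesgue01 ?T"
  interpret prob_space "mu_fibre b i" by (rule prob_space_mu_fibre)
  have S: "fold greedy_map (base_block b j n) \<in> measurable lebesgue01 lebesgue01" for j n
    using distr_fold_greedy[OF base_block_ge(2) decreasing_density_indicator[of 1]] by blast
  have T [measurable]: "?T \<in> measurable lebesgue01 lebesgue01" by (rule greedy_map_measurable01)
  have S1 [measurable]: "?S \<in> measurable lebesgue01 lebesgue01" "?S' \<in> measurable lebesgue01 lebesgue01"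
    unfolding greedy_return_eq by (rule S)+
  have "base_at b (int i + int p) = base_at b (int i)" by (rule base_at_cong) simp
  then have "base_at b (int i) # base_block b (Suc i) p = base_block b i p @ [base_at b (int i)]"
    using base_block_Suc[of b i p] base_block_snoc[of b i p] by simp
  then have comm: "?S' \<circ> ?T = ?T \<circ> ?S"
    unfolding greedy_return_eq by (metis fold_append fold_simps(1) fold_Cons fold_Nil id_comp)
  have inv: "distr (mu_fibre b i) lebesgue01 ?S = mu_fibre b i"
  proof -
    have "distr (mu_fibre b i) lebesgue01 ?S = distr (mu_fibre b i) (mu_fibre b i) ?S" by (rule distr_cong) auto
    then show ?thesis using mu_fibre_acip[of i] by (simp add: ac_invariant_prob_def invariant_measure_def)
  qed
  have "distr ?N ?N ?S' = distr ?N lebesgue01 ?S'" by (rule distr_cong) auto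
  also have "\<dots> = distr (mu_fibre b i) lebesgue01 (?T \<circ> ?S)" unfolding comm[symmetric] by (rule distr_distr) measurable
  also have "\<dots> = distr (distr (mu_fibre b i) lebesgue01 ?S) lebesgue01 ?T" by (rule distr_distr[symmetric]) measurable
  finally have "distr ?N ?N ?S' = ?N" unfolding inv .
  moreover have "absolutely_continuous lebesgue01 ?N"
  proof (rule mu_fibre_density[of i])
    fix h assume h: "decreasing_density h" and mu: "mu_fibre b i = density lebesgue01 (\<lambda>x. ennreal (h x))"
    have "?N = density lebesgue01 (\<lambda>x. ennreal (transfer (base_at b (int i)) h x))"
      unfolding mu using min_base(4) h
      by (intro distr_greedy_map_density decreasing_density_measurable) (auto simp: decreasing_densityD decreasing_density_nonneg)
    moreover have "transfer (base_at b (int i)) h \<in> borel_measurable lebesgue01"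
      by (intro borel_measurable_lebesgue01 transfer_measurable decreasing_density_measurable h)
    ultimately show ?thesis by (simp add: absolutely_continuousI_density)
  qed
  moreover have "prob_space ?N" by (rule prob_space_distr) measurable
  ultimately show "ac_invariant_prob lebesgue01 ?S' ?N"
    by (simp add: ac_invariant_prob_def invariant_measure_def)
qed

lemma sets_mu_base: "sets (mu_base b) = fibre_sets p (\<lambda>_. lebesgue01)"
  unfolding mu_base_def sets_fibre_measure by (rule fibre_sets_cong) simp

lemma sets_lambda_p: "sets (lambda_p p) = sets (mu_base b)"
  unfolding lambda_p_def sets_fibre_measure sets_mu_base ..

lemma space_mu_base: "space (mu_base b) = {..<p} \<times> {0..<1}"
  unfolding mu_base_def space_fibre_measure by simp

lemma emeasure_mu_base:
  "(\<And>i. i < p \<Longrightarrow> B i \<in> sets lebesgue01) \<Longrightarrow>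
    emeasure (mu_base b) (SIGMA i:{..<p}. B i) = (\<Sum>i<p. emeasure (mu_fibre b i) (B i)) / of_nat p"
  unfolding mu_base_def by (rule emeasure_fibre_measure) simp

lemma prob_space_mu_base: "prob_space (mu_base b)"
  unfolding mu_base_def using p_pos by (intro prob_space_fibre_measure prob_space_mu_fibre)

lemma greedy_skew_measurable: "greedy_skew b \<in> measurable (mu_base b) (mu_base b)"
  unfolding greedy_skew_def using p_pos
  by (intro measurable_fibre_map[OF _ _ sets_mu_base sets_mu_base] greedy_map_measurable01) auto

text \<open>Each fibre measure is carried to the next one, which permutes the summands of the
  average cyclically.\<close>

lemma greedy_skew_invariant: "invariant_measure (mu_base b) (greedy_skew b)"
  unfolding invariant_measure_def
proof (intro conjI greedy_skew_measurable measure_eqI)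
  fix E assume "E \<in> sets (distr (mu_base b) (mu_base b) (greedy_skew b))"
  then have E: "E \<in> sets (mu_base b)" by simp
  then obtain D where D: "E = (SIGMA i:{..<p}. D i)" "\<And>i. i < p \<Longrightarrow> D i \<in> sets lebesgue01"
    unfolding sets_mu_base by (rule fibre_setsE) blast
  let ?T = "\<lambda>i. greedy_map (base_at b (int i))"
  have D1: "D ((i + 1) mod p) \<in> sets lebesgue01" for i using D(2) p_pos by simp
  have pre: "greedy_skew b -` E \<inter> space (mu_base b) = (SIGMA i:{..<p}. ?T i -` D ((i + 1) mod p) \<inter> {0..<1})"
    unfolding D(1) greedy_skew_def space_mu_base using p_pos by (intro fibre_map_vimage) auto
  have m: "?T i -` D ((i + 1) mod p) \<inter> {0..<1} \<in> sets lebesgue01" for i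
    using measurable_sets[OF greedy_map_measurable01 D1] by simp
  have "emeasure (distr (mu_base b) (mu_base b) (greedy_skew b)) E =
      (\<Sum>i<p. emeasure (mu_fibre b i) (?T i -` D ((i + 1) mod p) \<inter> {0..<1})) / of_nat p"
    unfolding emeasure_distr[OF greedy_skew_measurable E] pre by (intro emeasure_mu_base m)
  also have "(\<Sum>i<p. emeasure (mu_fibre b i) (?T i -` D ((i + 1) mod p) \<inter> {0..<1}))
      = (\<Sum>i<p. emeasure (mu_fibre b ((i + 1) mod p)) (D ((i + 1) mod p)))"
  proof (intro sum.cong refl)
    fix i
    have "?T i \<in> measurable (mu_fibre b i) lebesgue01" using greedy_map_measurable01 by simp
    from emeasure_distr[OF this D1]
    show "emeasure (mu_fibre b i) (?T i -` D ((i + 1) mod p) \<inter> {0..<1}) = emeasure (mu_fibre b ((i + 1) mod p)) (D ((i + 1) mod p))"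
      unfolding distr_mu_fibre mu_fibre_mod by simp
  qed
  also have "\<dots> = (\<Sum>i<p. emeasure (mu_fibre b i) (D i))" using p_pos(1) by (rule sum_mod_shift)
  also have "\<dots> / of_nat p = emeasure (mu_base b) E" unfolding D(1) using D(2) by (rule emeasure_mu_base[symmetric])
  finally show "emeasure (distr (mu_base b) (mu_base b) (greedy_skew b)) E = emeasure (mu_base b) E" .
qed simp

lemma absolutely_continuous_mu_base:
  "absolutely_continuous (lambda_p p) (mu_base b)" "absolutely_continuous (mu_base b) (lambda_p p)"
  unfolding lambda_p_def mu_base_def
  by (rule fibre_measure_absolutely_continuous; simp add: absolutely_continuous_def null_sets_mu_fibre)+

lemma greedy_skew_acip: "ac_invariant_prob (lambda_p p) (greedy_skew b) (mu_base b)"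
  unfolding ac_invariant_prob_def
  using prob_space_mu_base sets_lambda_p absolutely_continuous_mu_base greedy_skew_invariant by simp

text \<open>Following the orbit once round all fibres shows that each section \<open>D i\<close> is
  invariant under its return map, so it has measure 0 or 1. A single step shows that all sections
  have the same measure, so the average is 0 or 1 as well.\<close>

lemma greedy_skew_ae_ergodic: "ae_ergodic (mu_base b) (greedy_skew b)"
  unfolding ae_ergodic_def
proof (intro ballI impI)
  fix E assume E: "E \<in> sets (mu_base b)" and ae: "AE z in mu_base b. (greedy_skew b z \<in> E) = (z \<in> E)"
  obtain D where D: "E = (SIGMA i:{..<p}. D i)" "\<And>i. i < p \<Longrightarrow> D i \<in> sets lebesgue01"
    using E unfolding sets_mu_base by (rule fibre_setsE) blast
  let ?T = "\<lambda>i. greedy_map (base_at b (int i))"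
  have Dm: "D (i mod p) \<in> sets lebesgue01" for i using D(2) p_pos by simp
  have mem: "(greedy_skew b (i, x) \<in> E) = (?T i x \<in> D (Suc i mod p))" for i x
    unfolding D(1) greedy_skew_def using p_pos by simp
  have Tm: "?T i \<in> measurable (mu_fibre b i) lebesgue01" for i using greedy_map_measurable01 by simp
  have "\<forall>i<p. AE x in mu_fibre b i. (greedy_skew b (i, x) \<in> E) = ((i, x) \<in> E)"
  proof (rule AE_fibre_measure[THEN iffD1])
    fix i assume i: "i < p"
    have "{x \<in> space (mu_fibre b i). (greedy_skew b (i, x) \<in> E) = ((i, x) \<in> E)} =
        ((?T i -` D (Suc i mod p) \<inter> {0..<1}) \<inter> D i) \<union> ({0..<1} - (?T i -` D (Suc i mod p) \<inter> {0..<1}) - D i)"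
      using i sets.sets_into_space[OF D(2)[OF i]] unfolding mem unfolding D(1) by auto
    also have "\<dots> \<in> sets lebesgue01"
      using measurable_sets[OF Tm Dm, of i "Suc i"] D(2)[OF i] sets.top[of lebesgue01] by simp
    finally show "{x \<in> space (mu_fibre b i). (greedy_skew b (i, x) \<in> E) = ((i, x) \<in> E)} \<in> sets (mu_fibre b i)" by simp
  qed (rule ae[unfolded mu_base_def])
  \<comment> \<open>Indices are read modulo p so that the inductions below can run past the last
    fibre.\<close>
  then have "AE x in mu_fibre b (i mod p). (?T (i mod p) x \<in> D (Suc (i mod p) mod p)) = (x \<in> D (i mod p))" for i
    unfolding mem using p_pos by (simp add: D(1))
  moreover have "base_at b (int (i mod p)) = base_at b (int i)" for i by (rule base_at_cong) (simp add: zmod_int)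
  ultimately have step: "AE x in mu_fibre b i. (?T i x \<in> D (Suc i mod p)) = (x \<in> D (i mod p))" for i
    by (simp only: mu_fibre_mod mod_Suc_eq)
  have iter: "AE x in mu_fibre b i. (fold greedy_map (base_block b i n) x \<in> D ((i + n) mod p)) = (x \<in> D (i mod p))" for i n
  proof (induction n arbitrary: i)
    case 0
    then show ?case by (simp add: base_block_def)
  next
    case (Suc n)
    have "AE x in distr (mu_fibre b i) lebesgue01 (?T i).
        (fold greedy_map (base_block b (Suc i) n) x \<in> D ((Suc i + n) mod p)) = (x \<in> D (Suc i mod p))"
      unfolding distr_mu_fibre by (rule Suc.IH)
    from AE_distrD[OF Tm this] step[of i] show ?case
      by eventually_elim (simp add: base_block_Suc)
  qed
  have 01: "measure (mu_fibre b i) (D i) \<in> {0, 1}" if i: "i < p" for i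
  proof -
    have "AE x in mu_fibre b i. (greedy_return b i x \<in> D i) = (x \<in> D i)"
      using iter[of i p] i by (simp add: greedy_return_eq)
    then show ?thesis using mu_fibre_ae_ergodic[of i] D(2)[OF i] unfolding ae_ergodic_def by simp
  qed
  have const: "emeasure (mu_fibre b i) (D (i mod p)) = emeasure (mu_fibre b 0) (D 0)" for i
  proof (induction i)
    case (Suc i)
    have "emeasure (mu_fibre b (Suc i)) (D (Suc i mod p)) = emeasure (mu_fibre b i) (?T i -` D (Suc i mod p) \<inter> space (mu_fibre b i))"
      unfolding distr_mu_fibre[symmetric] by (rule emeasure_distr[OF Tm Dm])
    also have "\<dots> = emeasure (mu_fibre b i) (D (i mod p))"
    proof (rule emeasure_eq_AE)
      show "AE x in mu_fibre b i. (x \<in> ?T i -` D (Suc i mod p) \<inter> space (mu_fibre b i)) = (x \<in> D (i mod p))"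
        using step[of i] AE_space by eventually_elim auto
    qed (use measurable_sets[OF Tm Dm] Dm in auto)
    finally show ?case using Suc by simp
  qed simp
  have "emeasure (mu_base b) E = (\<Sum>i<p. emeasure (mu_fibre b i) (D i)) / of_nat p"
    unfolding D(1) by (rule emeasure_mu_base[OF D(2)])
  also have "(\<Sum>i<p. emeasure (mu_fibre b i) (D i)) = (\<Sum>i<p. emeasure (mu_fibre b 0) (D 0))"
    using const by (intro sum.cong refl) (metis lessThan_iff mod_less)
  also have "\<dots> / of_nat p = emeasure (mu_fibre b 0) (D 0)"
    using p_pos by (simp add: ennreal_of_nat_eq_real_of_nat mult_divide_eq_ennreal mult.commute[of "ennreal _"])
  finally have "measure (mu_base b) E = measure (mu_fibre b 0) (D 0)" by (simp add: measure_def)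
  with 01[of 0] p_pos show "measure (mu_base b) E \<in> {0, 1}" by simp
qed

lemma greedy_skew_unique:
  assumes "ac_invariant_prob (lambda_p p) (greedy_skew b) N"
  shows "N = mu_base b"
proof (rule ac_invariant_unique[OF prob_space_mu_base greedy_skew_invariant greedy_skew_ae_ergodic])
  show "absolutely_continuous (mu_base b) N"
    using assms absolutely_continuous_mu_base(2) by (auto simp: ac_invariant_prob_def absolutely_continuous_def)
qed (use assms sets_lambda_p in \<open>auto simp: ac_invariant_prob_def\<close>)

subsection \<open>Cylinders\<close>

text \<open>The fibre index advances deterministically, so an itinerary holds no information beyond
  its first index and the digits.\<close>

lemma itinerary_digit_code:
  "itinerary (greedy_skew b) (digit_code b) n (i, x)
    = zip (map (\<lambda>k. (i + k) mod p) [0..<n]) (digits (base_block b i n) x)" if "i < p"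
  using that
proof (induction n arbitrary: i x)
  case 0
  then show ?case by (simp add: itinerary_def)
next
  case (Suc n)
  have "base_block b ((i + 1) mod p) n = base_block b (Suc i) n" using base_block_mod[of b "Suc i"] by simp
  moreover have "((i + 1) mod p + k) mod p = (i + Suc k) mod p" for k by (simp add: mod_add_left_eq)
  ultimately have "itinerary (greedy_skew b) (digit_code b) n (greedy_skew b (i, x))
      = zip (map (\<lambda>k. (i + Suc k) mod p) [0..<n]) (digits (base_block b (Suc i) n) (greedy_map (base_at b (int i)) x))"
    using Suc.IH[of "(i + 1) mod p"] p_pos by (simp add: greedy_skew_def)
  moreover have "map (\<lambda>k. (i + k) mod p) [0..<Suc n] = i # map (\<lambda>k. (i + Suc k) mod p) [0..<n]"
    using Suc.prems by (simp add: upt_conv_Cons map_Suc_upt[symmetric] del: upt_Suc)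
  ultimately show ?case
    by (simp add: itinerary_Suc digit_code_def base_block_Suc del: upt_Suc)
qed

lemma length_digits: "length (digits cs x) = length cs"
  by (induction cs arbitrary: x) auto

lemma map_snd_itinerary: "i < p \<Longrightarrow> map snd (itinerary (greedy_skew b) (digit_code b) n (i, x)) = digits (base_block b i n) x"
  by (simp add: itinerary_digit_code map_snd_zip length_digits)

definition rate :: real where "rate = ln (\<Prod>i<p. b ! i) / real p"

text \<open>The logarithm of a product of n consecutive entries minus n times \<open>rate\<close> is
  a sum of p-periodic terms with sum 0 over each period. It takes only finitely many values, and K
  is the exponential of a bound for them.\<close>

lemma prod_base_block_bounds:
  obtains K where "K > 0" "\<And>i n. prod_list (base_block b i n) \<le> K * exp (real n * rate)"
    "\<And>i n. exp (real n * rate) \<le> K * prod_list (base_block b i n)"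
proof -
  define v where "v k = ln (base_at b (int k)) - rate" for k
  define s where "s i n = (\<Sum>k<n. v (i + k))" for i n
  have vp: "v (k + p) = v k" for k
    unfolding v_def by (intro arg_cong2[where f = "(-)"] arg_cong[where f = ln] refl base_at_cong) simp
  have vm: "v (k mod p) = v k" for k
    unfolding v_def by (intro arg_cong2[where f = "(-)"] arg_cong[where f = ln] refl base_at_cong) (simp add: zmod_int)
  have s0: "s 0 p = 0"
  proof -
    have "(\<Sum>k<p. ln (base_at b (int k))) = (\<Sum>k<p. ln (b ! k))"
      by (intro sum.cong refl) (simp add: base_at_def)
    also have "\<dots> = ln (\<Prod>i<p. b ! i)"
    proof (rule ln_prod[symmetric])
      fix i assume "i \<in> {..<p}"
      then have "1 < b ! i" using gt_1 by simp
      then show "b ! i \<noteq> 0" by simp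
    qed simp
    finally show ?thesis using p_pos by (simp add: s_def v_def sum_subtractf rate_def)
  qed
  have sp: "s i p = 0" for i
  proof (induction i)
    case (Suc i)
    have "s i p + v (i + p) = (\<Sum>k<Suc p. v (i + k))" by (simp add: s_def)
    also have "\<dots> = v i + s (Suc i) p" unfolding s_def by (subst sum.lessThan_Suc_shift) simp
    finally show ?case using Suc vp by simp
  qed (rule s0)
  have add: "s i (n + m) = s i n + s (i + n) m" for i n m
    unfolding s_def by (induction m) (simp_all add: ac_simps)
  have smod: "s i (n mod p) = s i n" for i n
  proof -
    have "s i (q * p + r) = s i r" for q r
    proof (induction q)
      case (Suc q)
      have "s i (Suc q * p + r) = s i (q * p + r + p)" by (simp add: ac_simps)
      then show ?case using add[of i "q * p + r" p] sp Suc by simp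
    qed simp
    from this[of "n div p" "n mod p"] show ?thesis by simp
  qed
  have smod1: "s (i mod p) n = s i n" for i n
    unfolding s_def by (intro sum.cong refl) (metis vm mod_add_left_eq)
  define R where "R = Max ((\<lambda>(i, n). \<bar>s i n\<bar>) ` ({..<p} \<times> {..<p}))"
  have R: "\<bar>s i n\<bar> \<le> R" for i n
  proof -
    have "\<bar>s (i mod p) (n mod p)\<bar> \<le> R" unfolding R_def using p_pos by (intro Max_ge) auto
    then show ?thesis by (simp add: smod smod1)
  qed
  have prod: "prod_list (base_block b i n) = exp (s i n) * exp (real n * rate)" for i n
  proof (induction n)
    case 0
    then show ?case by (simp add: base_block_def s_def)
  next
    case (Suc n)
    have "base_at b (int i + int n) = exp (v (i + n)) * exp rate"
      using min_base(4)[of "int i + int n"] by (simp add: v_def exp_diff)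
    then show ?case unfolding base_block_snoc by (simp add: Suc s_def exp_add algebra_simps)
  qed
  show thesis
  proof (rule that[of "exp R"])
    fix i n
    have "exp (s i n) \<le> exp R" "1 \<le> exp R * exp (s i n)" using R[of i n] by (auto simp flip: exp_add)
    then show "prod_list (base_block b i n) \<le> exp R * exp (real n * rate)"
      "exp (real n * rate) \<le> exp R * prod_list (base_block b i n)"
      unfolding prod by (auto simp: mult.assoc[symmetric])
  qed simp
qed

lemma card_itinerary:
  "real (card (itinerary (greedy_skew b) (digit_code b) n ` space (mu_base b)))
    \<le> (\<Sum>i<p. sup_bound min_base * prod_list (base_block b i n))"
proof -
  let ?I = "itinerary (greedy_skew b) (digit_code b) n"
  let ?z = "\<lambda>i. zip (map (\<lambda>k. (i + k) mod p) [0..<n])"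
  let ?D = "\<lambda>i. digits (base_block b i n) ` {0..<1}"
  note D = card_digits[OF min_base(1) base_block_ge(1)]
  have "?I ` space (mu_base b) \<subseteq> (\<Union>i<p. ?z i ` ?D i)"
    unfolding space_mu_base by (auto simp: itinerary_digit_code simp del: upt_Suc)
  then have "card (?I ` space (mu_base b)) \<le> card (\<Union>i<p. ?z i ` ?D i)"
    using D by (intro card_mono) auto
  also have "\<dots> \<le> (\<Sum>i<p. card (?z i ` ?D i))" by (rule card_UN_le) simp
  also have "\<dots> \<le> (\<Sum>i<p. card (?D i))" using D by (intro sum_mono card_image_le) auto
  finally have "real (card (?I ` space (mu_base b))) \<le> (\<Sum>i<p. real (card (?D i)))"
    by (simp flip: of_nat_sum)
  also have "\<dots> \<le> (\<Sum>i<p. sup_bound min_base * prod_list (base_block b i n))"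
    using D by (intro sum_mono) auto
  finally show ?thesis .
qed

lemma digit_code_events: "{z\<in>space (mu_base b). digit_code b z = c} \<in> sets (mu_base b)"
proof -
  obtain j d where c: "c = (j, d)" by (cases c)
  have "{z\<in>space (mu_base b). digit_code b z = c} = (SIGMA i:{..<p}. {x\<in>{0..<1}. i = j \<and> \<lfloor>base_at b (int i) * x\<rfloor> = d})"
    unfolding space_mu_base c digit_code_def by auto
  also have "\<dots> \<in> sets (mu_base b)"
    unfolding sets_mu_base
  proof (intro fibre_setsI)
    fix i
    have "{x\<in>{0..<1}. i = j \<and> \<lfloor>base_at b (int i) * x\<rfloor> = d} \<in> sets borel" by measurable
    then show "{x\<in>{0..<1}. i = j \<and> \<lfloor>base_at b (int i) * x\<rfloor> = d} \<in> sets lebesgue01"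
      by (auto simp: sets_lebesgue01_iff)
  qed
  finally show ?thesis .
qed

lemma finite_digit_code: "finite (digit_code b ` space (mu_base b))"
proof (rule finite_subset)
  show "digit_code b ` space (mu_base b) \<subseteq> (SIGMA i:{..<p}. {0..\<lceil>base_at b (int i)\<rceil>})"
  proof (rule image_subsetI)
    fix z assume "z \<in> space (mu_base b)"
    then obtain i x where z: "z = (i, x)" "i < p" "0 \<le> x" "x < 1" by (auto simp: space_mu_base)
    have "base_at b (int i) * x \<le> base_at b (int i)" using z min_base(4)[of "int i"] by (simp add: mult_le_cancel_left1)
    then have "\<lfloor>base_at b (int i) * x\<rfloor> \<le> \<lceil>base_at b (int i)\<rceil>" by linarith
    moreover have "0 \<le> \<lfloor>base_at b (int i) * x\<rfloor>" using z min_base(4)[of "int i"] by simp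
    ultimately show "digit_code b z \<in> (SIGMA i:{..<p}. {0..\<lceil>base_at b (int i)\<rceil>})" using z by (simp add: digit_code_def)
  qed
qed auto

lemma preserving_system_greedy: "preserving_system (mu_base b) (greedy_skew b)"
  using prob_space_mu_base greedy_skew_invariant by (simp add: preserving_system_def preserving_system_axioms_def)

lemma labelling_digit_code: "preserving_system.labelling (mu_base b) (digit_code b) (digit_code b ` space (mu_base b))"
  unfolding preserving_system.labelling_def[OF preserving_system_greedy]
  using finite_digit_code digit_code_events by blast

lemma measure_mu_base_le:
  assumes E: "E \<subseteq> (SIGMA i:{..<p}. {v i..<v i + r i} \<inter> {0..<1})" and r: "\<And>i. i < p \<Longrightarrow> 0 \<le> r i"
  shows "measure (mu_base b) E \<le> (\<Sum>i<p. sup_bound min_base * r i) / real p"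
proof -
  let ?F = "SIGMA i:{..<p}. {v i..<v i + r i} \<inter> {0..<1}"
  interpret prob_space "mu_base b" by (rule prob_space_mu_base)
  have F: "{v i..<v i + r i} \<inter> {0..<1} \<in> sets lebesgue01" for i by (auto simp: sets_lebesgue01_iff)
  have M: "sup_bound min_base \<ge> 0" using min_base by (simp add: sup_bound_def)
  have "measure (mu_base b) E \<le> measure (mu_base b) ?F"
    using E F by (intro finite_measure_mono) (auto simp: sets_mu_base intro!: fibre_setsI)
  moreover have "ennreal (measure (mu_base b) ?F) \<le> ennreal ((\<Sum>i<p. sup_bound min_base * r i) / real p)"
  proof -
    have "ennreal (measure (mu_base b) ?F) = (\<Sum>i<p. emeasure (mu_fibre b i) ({v i..<v i + r i} \<inter> {0..<1})) / of_nat p"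
      unfolding emeasure_eq_measure[symmetric] using F by (rule emeasure_mu_base)
    also have "\<dots> \<le> (\<Sum>i<p. ennreal (sup_bound min_base * r i)) / of_nat p"
      using r by (intro divide_right_mono_ennreal sum_mono mu_fibre_interval) auto
    also have "(\<Sum>i<p. ennreal (sup_bound min_base * r i)) = ennreal (\<Sum>i<p. sup_bound min_base * r i)"
      using r M by (intro sum_ennreal) auto
    also have "\<dots> / of_nat p = ennreal ((\<Sum>i<p. sup_bound min_base * r i) / real p)"
      unfolding ennreal_of_nat_eq_real_of_nat using r M p_pos by (intro divide_ennreal sum_nonneg) auto
    finally show ?thesis .
  qed
  moreover have "0 \<le> (\<Sum>i<p. sup_bound min_base * r i) / real p" using r M by (intro divide_nonneg_nonneg sum_nonneg) auto
  ultimately show ?thesis by (simp add: ennreal_le_iff)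
qed

lemma measure_cylinder:
  "measure (mu_base b) {z\<in>space (mu_base b). itinerary (greedy_skew b) (digit_code b) n z = w}
    \<le> (\<Sum>i<p. sup_bound min_base * (1 / prod_list (base_block b i n))) / real p"
proof -
  have "\<forall>i. \<exists>v. {x\<in>{0..<1}. digits (base_block b i n) x = map snd w} \<subseteq> {v..<v + 1 / prod_list (base_block b i n)}"
    using cylinder_subset[OF base_block_ge(2)] by blast
  then obtain v where v: "\<And>i. {x\<in>{0..<1}. digits (base_block b i n) x = map snd w} \<subseteq> {v i..<v i + 1 / prod_list (base_block b i n)}"
    by metis
  show ?thesis
  proof (rule measure_mu_base_le)
    show "{z\<in>space (mu_base b). itinerary (greedy_skew b) (digit_code b) n z = w}
        \<subseteq> (SIGMA i:{..<p}. {v i..<v i + 1 / prod_list (base_block b i n)} \<inter> {0..<1})"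
    proof
      fix z assume "z \<in> {z\<in>space (mu_base b). itinerary (greedy_skew b) (digit_code b) n z = w}"
      then obtain i x where z: "z = (i, x)" "i < p" "x \<in> {0..<1}" "itinerary (greedy_skew b) (digit_code b) n (i, x) = w"
        by (auto simp: space_mu_base)
      then have "digits (base_block b i n) x = map snd w" using map_snd_itinerary by metis
      then have "x \<in> {v i..<v i + 1 / prod_list (base_block b i n)}" using v[of i] z(3) by blast
      then show "z \<in> (SIGMA i:{..<p}. {v i..<v i + 1 / prod_list (base_block b i n)} \<inter> {0..<1})" using z by simp
    qed
  qed (simp add: prod_base_block_pos less_imp_le)
qed

text \<open>Take all words that occur in the segment. A point outside with such a word shares a
  cylinder with a point below t, so it lies to the right of t by less than the length bound for the
  cylinder.\<close>

lemma approximable_initial_segment: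
  assumes i: "i < p"
  shows "preserving_system.approximable (mu_base b) (greedy_skew b) (digit_code b) ({i} \<times> ({..<t} \<inter> {0..<1}))"
    (is "preserving_system.approximable _ _ _ ?A")
proof -
  interpret preserving_system "mu_base b" "greedy_skew b" by (rule preserving_system_greedy)
  have A: "?A \<in> events"
  proof -
    have "?A = (SIGMA j:{..<p}. if j = i then {..<t} \<inter> {0..<1} else {})" using i by (auto split: if_splits)
    also have "\<dots> \<in> events" unfolding sets_mu_base by (intro fibre_setsI) (auto simp: sets_lebesgue01_iff)
    finally show ?thesis .
  qed
  have M: "sup_bound min_base > 0" using min_base by (simp add: sup_bound_def add_pos_pos)
  show ?thesis
    unfolding approximable_def
  proof (intro conjI A allI impI)
    fix \<epsilon> :: real assume e: "0 < \<epsilon>"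
    obtain n0 where n0: "sup_bound min_base / \<epsilon> < min_base ^ n0" using real_arch_pow[OF min_base(1)] by blast
    \<comment> \<open>At least one letter is needed: the first one reveals the fibre.\<close>
    define n where "n = Suc n0"
    let ?I = "itinerary (greedy_skew b) (digit_code b) n"
    let ?P = "prod_list (base_block b i n)"
    have "min_base ^ n0 \<le> min_base ^ n" unfolding n_def using min_base(1) by (intro power_increasing) auto
    also have "\<dots> \<le> ?P" using prod_list_ge_power[OF _ base_block_ge(1), of i n] min_base(1) by simp
    finally have P: "sup_bound min_base / \<epsilon> \<le> ?P" using n0 by simp
    have "prob {z\<in>space (mu_base b). (z \<in> ?A) \<noteq> (?I z \<in> ?I ` ?A)}
        \<le> (\<Sum>j<p. sup_bound min_base * (if j = i then 1 / ?P else 0)) / real p"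
    proof (rule measure_mu_base_le[where v = "\<lambda>_. t"])
      show "{z\<in>space (mu_base b). (z \<in> ?A) \<noteq> (?I z \<in> ?I ` ?A)}
          \<subseteq> (SIGMA j:{..<p}. {t..<t + (if j = i then 1 / ?P else 0)} \<inter> {0..<1})"
      proof
        fix z assume z: "z \<in> {z\<in>space (mu_base b). (z \<in> ?A) \<noteq> (?I z \<in> ?I ` ?A)}"
        then have nA: "z \<notin> ?A" and "?I z \<in> ?I ` ?A" by auto
        then obtain x where x: "x < t" "0 \<le> x" "x < 1" "?I z = ?I (i, x)" by auto
        obtain j y where y: "z = (j, y)" "j < p" "0 \<le> y" "y < 1" using z by (auto simp: space_mu_base)
        have "hd (?I z) = digit_code b (j, y)" "hd (?I (i, x)) = digit_code b (i, x)"
          by (simp_all add: n_def itinerary_Suc y)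
        then have j: "j = i" using x by (simp add: digit_code_def)
        have "digits (base_block b i n) x = digits (base_block b i n) y"
          using map_snd_itinerary[OF i, of n x] map_snd_itinerary[OF i, of n y] x y j by simp
        then have "y < x + 1 / ?P" using x y by (intro digits_dist base_block_ge)
        moreover have "t \<le> y" using nA y j by auto
        ultimately show "z \<in> (SIGMA j:{..<p}. {t..<t + (if j = i then 1 / ?P else 0)} \<inter> {0..<1})"
          using x y j by simp
      qed
    qed (use prod_base_block_pos[of i n] in auto)
    also have "(\<Sum>j<p. sup_bound min_base * (if j = i then 1 / ?P else 0)) = (\<Sum>j<p. if j = i then sup_bound min_base / ?P else 0)"
      by (intro sum.cong) auto
    also have "\<dots> = sup_bound min_base / ?P" using i by simp
    also have "sup_bound min_base / ?P / real p \<le> sup_bound min_base / ?P / 1"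
      using p_pos M prod_base_block_pos[of i n] by (intro divide_left_mono) (auto simp: Suc_le_eq)
    also have "\<dots> \<le> \<epsilon>" using P e prod_base_block_pos[of i n] by (simp add: field_simps)
    finally show "\<exists>m W. prob {z\<in>space (mu_base b). (z \<in> ?A) \<noteq> (itinerary (greedy_skew b) (digit_code b) m z \<in> W)} \<le> \<epsilon>" by blast
  qed
qed

text \<open>Half-lines generate the Borel sets, and approximability survives complements and
  countable unions; this is done in each fibre separately.\<close>

lemma approximable_mu_base:
  assumes E: "E \<in> sets (mu_base b)"
  shows "preserving_system.approximable (mu_base b) (greedy_skew b) (digit_code b) E"
proof -
  interpret preserving_system "mu_base b" "greedy_skew b" by (rule preserving_system_greedy)
  let ?ap = "approximable (digit_code b)"
  note lab = labelling_digit_code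
  have fib: "?ap ({i} \<times> (B \<inter> {0..<1}))" if i: "i < p" and "B \<in> sets borel" for i and B :: "real set"
  proof -
    have "B \<in> sigma_sets UNIV (range lessThan)"
      using that(2) unfolding borel_Iio by simp
    then show ?thesis
    proof induction
      case (Basic a)
      then show ?case using approximable_initial_segment[OF i] by auto
    next
      case Empty
      then show ?case by (simp add: approximable_empty)
    next
      case (Compl a)
      have full: "?ap ({i} \<times> {0..<1})" using approximable_initial_segment[OF i, of 1] by (simp add: lessThan_def Int_def conj_commute atLeastLessThan_def atLeast_def)
      \<comment> \<open>Approximability is closed under complements in the whole space only, so the
        other fibres are added before complementing.\<close>
      have "{i} \<times> ((UNIV - a) \<inter> {0..<1}) = space (mu_base b) - ((space (mu_base b) - {i} \<times> {0..<1}) \<union> {i} \<times> (a \<inter> {0..<1}))"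
        using i by (auto simp: space_mu_base)
      then show ?case
        by (simp only:) (intro approximable_Compl approximable_Un[OF lab] full Compl.IH)
    next
      case (Union a)
      have "{i} \<times> (\<Union> (range a) \<inter> {0..<1}) = (\<Union>n. {i} \<times> (a n \<inter> {0..<1}))" by auto
      then show ?case using approximable_UN[OF lab, of "\<lambda>n. {i} \<times> (a n \<inter> {0..<1})"] Union.IH by simp
    qed
  qed
  obtain D where D: "E = (SIGMA i:{..<p}. D i)" "\<And>i. i < p \<Longrightarrow> D i \<in> sets lebesgue01"
    using E unfolding sets_mu_base by (rule fibre_setsE) blast
  have "E = (\<Union>i\<in>{..<p}. {i} \<times> (D i \<inter> {0..<1}))"
    unfolding D(1) using D(2) by (auto simp: sets_lebesgue01_iff)
  moreover have "?ap (\<Union>i\<in>{..<p}. {i} \<times> (D i \<inter> {0..<1}))"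
    using D(2) by (intro approximable_finite_UN[OF lab] fib) (auto simp: sets_lebesgue01_iff)
  ultimately show ?thesis by simp
qed

section \<open>Conjugation to the lazy map\<close>

lemma base_at_base_shift: "base_at (base_shift b n) k = base_at b (n + k)"
proof -
  have lt: "nat (k mod int p) < p" using p_pos by (simp add: nat_less_iff)
  have "base_at (base_shift b n) k = base_at b (n + int (nat (k mod int p)))"
    unfolding base_at_def[of "base_shift b n"] using lt by (simp add: base_shift_def)
  also have "\<dots> = base_at b (n + k)" using p_pos by (intro base_at_cong) (simp add: mod_add_right_eq)
  finally show ?thesis .
qed

definition lazy_end :: "int \<Rightarrow> real" where "lazy_end n = x_base (base_shift b n)"

text \<open>Split off the first term of the series: the rest is the series of the shifted base
  divided by the current entry.\<close>

lemma lazy_end_rec: "base_at b n * lazy_end n = of_int \<lceil>base_at b n\<rceil> - 1 + lazy_end (n + 1)"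
proof -
  define t where "t n k = (of_int \<lceil>base_at b (n + int k)\<rceil> - 1) / (\<Prod>j\<le>k. base_at b (n + int j))" for n k
  have le: "lazy_end n = (\<Sum>k. t n k)" for n
    by (simp add: lazy_end_def x_base_def base_at_base_shift t_def)
  have Suc: "t n (Suc k) = t (n + 1) k / base_at b n" for n k
    by (simp add: t_def prod.atMost_Suc_shift ac_simps del: prod.atMost_Suc)
  have summ: "summable (t n)" for n
  proof (rule summable_comparison_test)
    let ?D = "Max (set b)"
    have D: "base_at b k \<le> ?D" for k
    proof -
      have "nat (k mod int p) < p" using p_pos by (simp add: nat_less_iff)
      then show ?thesis unfolding base_at_def by (intro Max_ge) auto
    qed
    \<comment> \<open>Numerators stay below the largest entry, and denominators grow at least like
      powers of the smallest one.\<close>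
    have "norm (t n k) \<le> ?D * (1 / min_base) ^ k" for k
    proof -
      have num: "0 \<le> (of_int \<lceil>base_at b (n + int k)\<rceil> - 1 :: real)" "(of_int \<lceil>base_at b (n + int k)\<rceil> - 1 :: real) \<le> ?D"
        using D[of "n + int k"] min_base(3)[of "n + int k"] by linarith+
      have den: "min_base ^ k \<le> (\<Prod>j\<le>k. base_at b (n + int j))"
      proof -
        have "min_base ^ k \<le> min_base ^ Suc k" using min_base(1) by (intro power_increasing) auto
        also have "\<dots> = (\<Prod>j\<le>k. min_base)" by simp
        also have "\<dots> \<le> (\<Prod>j\<le>k. base_at b (n + int j))" using min_base by (intro prod_mono) (auto intro: less_imp_le order_trans)
        finally show ?thesis .
      qed
      have "0 \<le> t n k" unfolding t_def using min_base(4)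
        by (intro divide_nonneg_nonneg num(1) prod_nonneg) (simp add: less_imp_le)
      then have "norm (t n k) = t n k" by simp
      also have "\<dots> \<le> ?D / min_base ^ k" unfolding t_def using num den min_base(1) order_trans[OF num] by (intro frac_le) auto
      finally show ?thesis by (simp add: power_one_over field_simps)
    qed
    then show "\<exists>N. \<forall>k\<ge>N. norm (t n k) \<le> ?D * (1 / min_base) ^ k" by blast
    show "summable (\<lambda>k. ?D * (1 / min_base) ^ k)"
      using min_base(1) by (intro summable_mult summable_geometric) auto
  qed
  have "lazy_end n = (\<Sum>k. t n (Suc k)) + t n 0" unfolding le using suminf_split_head[OF summ[of n]] by simp
  also have "(\<Sum>k. t n (Suc k)) = lazy_end (n + 1) / base_at b n"
    unfolding Suc le by (rule suminf_divide[OF summ])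
  finally show ?thesis using min_base(4)[of n] by (simp add: t_def field_simps)
qed

text \<open>By \<open>lazy_end_rec\<close> the reflection turns the greedy digit into its complement
  with respect to \<lceil>\<beta>\<rceil> - 1 and the floor into a ceiling, so the remainders are
  reflected as well.\<close>

lemma conj_map_greedy_skew: "conj_map b (greedy_skew b z) = lazy_map b (conj_map b z)"
proof -
  obtain i y where z: "z = (i, y)" by (cases z)
  let ?\<beta> = "base_at b (int i)" and ?x = "lazy_end (int i)" and ?x' = "lazy_end (int i + 1)"
  have x': "lazy_end (int ((i + 1) mod p)) = ?x'"
  proof -
    have "base_shift b (int ((i + 1) mod p)) = base_shift b (int i + 1)"
      unfolding base_shift_def
      by (intro map_cong refl base_at_cong) (simp only: zmod_int of_nat_add of_nat_1 mod_add_left_eq)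
    then show ?thesis by (simp add: lazy_end_def)
  qed
  have rec: "?\<beta> * ?x = of_int \<lceil>?\<beta>\<rceil> - 1 + ?x'" by (rule lazy_end_rec)
  have "?\<beta> * (?x - y) - ?x' = of_int (\<lceil>?\<beta>\<rceil> - 1) + - (?\<beta> * y)" using rec by (simp add: algebra_simps)
  then have ceil: "\<lceil>?\<beta> * (?x - y) - ?x'\<rceil> = \<lceil>?\<beta>\<rceil> - 1 - \<lfloor>?\<beta> * y\<rfloor>"
    by (simp only: ceiling_add_of_int ceiling_minus add.commute[of "of_int _"])
  have "?\<beta> * (?x - y) - of_int (\<lceil>?\<beta>\<rceil> - 1 - \<lfloor>?\<beta> * y\<rfloor>) = ?x' - (?\<beta> * y - of_int \<lfloor>?\<beta> * y\<rfloor>)"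
    using rec by (simp add: algebra_simps)
  then show ?thesis
    unfolding z greedy_skew_def conj_map_def lazy_map_def
    using x' ceil by (simp add: greedy_map_def lazy_end_def)
qed

lemma conj_map_conj_map: "conj_map b (conj_map b z) = z"
  by (cases z) (simp add: conj_map_def)

lemma sets_lazy_algebra: "sets (lazy_algebra b) = fibre_sets p (\<lambda>i. restrict_space borel (lazy_interval b i))"
  by (simp add: lazy_algebra_def sets_fibre_algebra)

lemma isomorphic_greedy_lazy:
  "isomorphic_maps (mu_base b) (lazy_algebra b) (conj_map b) (conj_map b) (greedy_skew b) (lazy_map b)"
proof -
  let ?F = "\<lambda>i x. x_base (base_shift b (int i)) - x"
  have f: "conj_map b \<in> measurable (mu_base b) (lazy_algebra b)"
    unfolding conj_map_def
  proof (rule measurable_fibre_map[OF _ _ sets_mu_base sets_lazy_algebra])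
    fix i
    have "?F i \<in> measurable (restrict_space borel {0..<1}) (restrict_space borel (lazy_interval b i))"
      by (rule measurable_restrict_space3) (auto simp: lazy_interval_def)
    then show "?F i \<in> measurable lebesgue01 (restrict_space borel (lazy_interval b i))"
      by (simp add: measurable_cong_sets[OF sets_lebesgue01 refl])
  qed
  have g: "conj_map b \<in> measurable (lazy_algebra b) (mu_base b)"
    unfolding conj_map_def
  proof (rule measurable_fibre_map[OF _ _ sets_lazy_algebra sets_mu_base])
    fix i
    have "?F i \<in> measurable (restrict_space borel (lazy_interval b i)) (restrict_space borel {0..<1})"
      by (rule measurable_restrict_space3) (auto simp: lazy_interval_def)
    then show "?F i \<in> measurable (restrict_space borel (lazy_interval b i)) lebesgue01"
      by (simp add: measurable_cong_sets[OF refl sets_lebesgue01])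
  qed
  have "lazy_map b = conj_map b \<circ> (greedy_skew b \<circ> conj_map b)"
    by (simp add: fun_eq_iff conj_map_greedy_skew conj_map_conj_map)
  then have S: "lazy_map b \<in> measurable (lazy_algebra b) (lazy_algebra b)"
    using measurable_comp[OF measurable_comp[OF g greedy_skew_measurable] f] by simp
  show ?thesis
    using f g S greedy_skew_measurable conj_map_greedy_skew conj_map_conj_map by unfold_locales auto
qed

section \<open>Entropy and transport to the lazy system\<close>

lemma lazy_entropy: "measure_entropy (mu_lazy b) (lazy_map b) = ereal rate"
proof -
  interpret isomorphic_maps "mu_base b" "lazy_algebra b" "conj_map b" "conj_map b" "greedy_skew b" "lazy_map b"
    by (rule isomorphic_greedy_lazy)
  obtain K where K: "K > 0" "\<And>i n. prod_list (base_block b i n) \<le> K * exp (real n * rate)"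
    "\<And>i n. exp (real n * rate) \<le> K * prod_list (base_block b i n)"
    by (rule prod_base_block_bounds) blast
  have M: "sup_bound min_base > 0" using min_base by (simp add: sup_bound_def add_pos_pos)
  \<comment> \<open>The factor p counts the starting fibres of the words. The average over fibres
    would not require it in the bound on cylinders, but the criterion takes one constant for
    both.\<close>
  define C where "C = real p * (sup_bound min_base * K)"
  show ?thesis
    unfolding mu_lazy_def
  proof (rule measure_entropy_distr[where C = "digit_code b" and K = C])
    fix n
    have "real (card (itinerary (greedy_skew b) (digit_code b) n ` space (mu_base b)))
        \<le> (\<Sum>i<p. sup_bound min_base * (K * exp (real n * rate)))"
      using K M by (intro order_trans[OF card_itinerary] sum_mono mult_left_mono) auto
    then show "real (card (itinerary (greedy_skew b) (digit_code b) n ` space (mu_base b))) \<le> C * exp (real n * rate)"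
      by (simp add: C_def mult.assoc)
    fix w
    have inv: "1 / prod_list (base_block b i n) \<le> K * exp (- (real n * rate))" for i
      using K(3)[of n i] prod_base_block_pos[of i n] by (simp add: exp_minus field_simps)
    have "measure (mu_base b) {z\<in>space (mu_base b). itinerary (greedy_skew b) (digit_code b) n z = w}
        \<le> (\<Sum>i<p. sup_bound min_base * (K * exp (- (real n * rate)))) / real p"
      using inv M by (intro order_trans[OF measure_cylinder] divide_right_mono sum_mono mult_left_mono) auto
    also have "\<dots> = 1 * (sup_bound min_base * (K * exp (- (real n * rate))))" using p_pos by simp
    also have "\<dots> \<le> real p * (sup_bound min_base * (K * exp (- (real n * rate))))"
      using p_pos M K by (intro mult_right_mono) (auto simp: Suc_le_eq)
    finally show "measure (mu_base b) {z\<in>space (mu_base b). itinerary (greedy_skew b) (digit_code b) n z = w} \<le> C * exp (- (real n * rate))"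
      by (simp add: C_def mult.assoc)
  qed (use prob_space_mu_base greedy_skew_invariant finite_digit_code digit_code_events approximable_mu_base in auto)
qed

lemma lazy_system:
  shows "ac_invariant_prob (lambda_lazy b) (lazy_map b) (mu_lazy b)"
    and "ac_invariant_prob (lambda_lazy b) (lazy_map b) N \<Longrightarrow> N = mu_lazy b"
    and "equivalent_measures (mu_lazy b) (lambda_lazy b)"
    and "ergodic (mu_lazy b) (lazy_map b)"
proof -
  interpret isomorphic_maps "mu_base b" "lazy_algebra b" "conj_map b" "conj_map b" "greedy_skew b" "lazy_map b"
    by (rule isomorphic_greedy_lazy)
  interpret sw: isomorphic_maps "lazy_algebra b" "mu_base b" "conj_map b" "conj_map b" "lazy_map b" "greedy_skew b"
    by (rule swap)
  show "ac_invariant_prob (lambda_lazy b) (lazy_map b) (mu_lazy b)"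
    unfolding lambda_lazy_def mu_lazy_def by (rule ac_invariant_prob_distr[OF sets_lambda_p greedy_skew_acip])
  show "equivalent_measures (mu_lazy b) (lambda_lazy b)"
    unfolding equivalent_measures_def lambda_lazy_def mu_lazy_def
    using absolutely_continuous_mu_base sets_lambda_p by (auto intro!: distr_absolutely_continuous)
  show "ergodic (mu_lazy b) (lazy_map b)"
    unfolding mu_lazy_def
    by (intro ergodic_distr ergodic_if_ae_ergodic prob_space_mu_base greedy_skew_invariant greedy_skew_ae_ergodic refl)
  assume N: "ac_invariant_prob (lambda_lazy b) (lazy_map b) N"
  then have s: "sets N = sets (lazy_algebra b)" by (simp add: ac_invariant_prob_def lambda_lazy_def)
  \<comment> \<open>A competitor is pulled back to the greedy side, identified there, and pushed
    forward again.\<close>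
  have "ac_invariant_prob (distr (lambda_lazy b) (mu_base b) (conj_map b)) (greedy_skew b) (distr N (mu_base b) (conj_map b))"
    using N by (intro sw.ac_invariant_prob_distr) (simp_all add: lambda_lazy_def)
  also have "distr (lambda_lazy b) (mu_base b) (conj_map b) = lambda_p p"
    unfolding lambda_lazy_def by (rule distr_distr_inverse[OF sets_lambda_p])
  finally have "distr N (mu_base b) (conj_map b) = mu_base b" by (rule greedy_skew_unique)
  then show "N = mu_lazy b" using sw.distr_distr_inverse[OF s] by (simp add: mu_lazy_def)
qed

end

theorem theorem32:
  fixes p :: nat and \<beta> :: "real list"
  assumes "p \<ge> 1" and "length \<beta> = p" and "\<forall>i<p. \<beta> ! i > 1"
  shows "ac_invariant_prob (lambda_lazy \<beta>) (lazy_map \<beta>) (mu_lazy \<beta>) \<and>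
    (\<forall>N. ac_invariant_prob (lambda_lazy \<beta>) (lazy_map \<beta>) N \<longrightarrow> N = mu_lazy \<beta>) \<and>
    equivalent_measures (mu_lazy \<beta>) (lambda_lazy \<beta>) \<and>
    ergodic (mu_lazy \<beta>) (lazy_map \<beta>) \<and>
    measure_entropy (mu_lazy \<beta>) (lazy_map \<beta>) = ereal (1 / real p * ln (\<Prod>i<p. \<beta> ! i))"
proof -
  interpret alternate_base \<beta>
    using assms by unfold_locales (auto simp: in_set_conv_nth)
  have "rate = 1 / real p * ln (\<Prod>i<p. \<beta> ! i)" using assms(2) by (simp add: rate_def)
  then show ?thesis using lazy_system lazy_entropy by metis
qed

end
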